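(* Let $d\ge1$, let $\kappa=(\kappa_1,\dots,\kappa_d)$ with all $\kappa_i\ge0$, let $\mu\ge0$, and assume $\alpha_{\kappa,\mu}=|\kappa|+\mu+\frac{d-1}{2}<\frac12$. For $f\in L^1_{\mathbf{u}(\kappa,\mu)}(\mathbb{V}^{d+1})\cap L^1_{\mathbf{u}(\kappa,\mu),*}(\mathbb{V}^{d+1})$ and $g\in L^1_{u(2\alpha_{\kappa,\mu})}(\mathbb{R}_+)\cap L^1_{u(2\alpha_{\kappa,\mu}+\frac12)}(\mathbb{R}_+)$, $$\|f*_{\mathbb{V}}g\|_{1,\kappa,\mu}\le\|f\|_{1,\kappa,\mu}\,\|g\|_{1,u(2\alpha_{\kappa,\mu})}+\|f\|^*_{1,\kappa,\mu}\,\|g\|_{1,u(2\alpha_{\kappa,\mu}+\frac12)}.$$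
   Context: Notation: $|\kappa|=\kappa_1+\dots+\kappa_d$, $h_\kappa(x)=\prod_{i=1}^d|x_i|^{\kappa_i}$, $\mathbb{R}_+=[0,\infty)$. The solid cone is $\mathbb{V}^{d+1}=\{(x,t)\in\mathbb{R}^d\times\mathbb{R}_+:\|x\|\le t\}$. Put $W_{\kappa,\mu}(x,t)=h_\kappa^2(x)(t^2-\|x\|^2)^{\mu-\frac12}e^{-t}$, $\mathbf{u}(x,t)=h_\kappa^2(x)(t^2-\|x\|^2)^{\mu-\frac12}$, and $\mathbf{b}_{\kappa,\mu}=1/\int_{\mathbb{V}^{d+1}}W_{\kappa,\mu}\,dx\,dt$. Norms: $\|f\|_{1,\kappa,\mu}=\mathbf{b}_{\kappa,\mu}\int_{\mathbb{V}^{d+1}}|f(x,t)|e^{-t/2}\,\mathbf{u}(x,t)\,dx\,dt$ and $\|f\|^*_{1,\kappa,\mu}=\mathbf{b}_{\kappa,\mu}\int_{\mathbb{V}^{d+1}}|f(x,t)|e^{-t/2}\sqrt t\,\mathbf{u}(x,t)\,dx\,dt$, with spaces $L^1_{\mathbf{u}(\kappa,\mu)}(\mathbb{V}^{d+1})$ and $L^1_{\mathbf{u}(\kappa,\mu),*}(\mathbb{V}^{d+1})$. On $\mathbb{R}_+$: $\|g\|_{1,u(\alpha)}=\frac{1}{\Gamma(\alpha+1)}\int_0^\infty|g(t)|e^{-t/2}t^\alpha\,dt$, with space $L^1_{u(\alpha)}(\mathbb{R}_+)$. Generalized translation: for $(x,t)\in\mathbb{V}^{d+1}$ and $\alpha=\alpha_{\kappa,\mu}>0$,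 $$\mathbf{T}_{(x,t)}g(y,s)=C_{\kappa,\mu}\int_{[-1,1]^{d+1}}\int_0^\pi g(t+s+2\boldsymbol\rho\cos\theta)e^{-\boldsymbol\rho\cos\theta}j_{\alpha-1}(\boldsymbol\rho\sin\theta)(\sin\theta)^{2\alpha-1}\,d\theta\,\Phi_\kappa(u')(1-u_{d+1}^2)^{\mu-1}\,du,$$ where $u=(u',u_{d+1})$, $\boldsymbol\rho=\sqrt{\tfrac12\big(ts+\sum_{i=1}^dx_iy_iu_i+\sqrt{t^2-\|x\|^2}\sqrt{s^2-\|y\|^2}\,u_{d+1}\big)}$, $j_\alpha(z)=z^{-\alpha}J_\alpha(z)$ ($J_\alpha$ the Bessel function), $\Phi_\kappa(u')=\prod_{i=1}^d(1+u_i)(1-u_i^2)^{\kappa_i-1}$, $C_{\kappa,\mu}=\frac{2^{\alpha-1}\Gamma(\alpha+\frac12)}{\sqrt\pi}\,c_{\mu-\frac12}\prod_{i=1}^dc_{\kappa_i-\frac12}$, $c_\lambda=\frac{\Gamma(\lambda+1)}{\Gamma(\frac12)\Gamma(\lambda+\frac12)}$. If $\kappa_i=0$, $c_{\kappa_i-\frac12}\int_{-1}^1f(u_i)(1+u_i)(1-u_i^2)^{\kappa_i-1}du_i$ is replaced by its limit $f(1)$; if $\mu=0$, $c_{\mu-\frac12}\int_{-1}^1f(u_{d+1})(1-u_{d+1}^2)^{\mu-1}du_{d+1}$ is replaced by its limit $\frac12[f(1)+f(-1)]$. If $\alpha_{\kappa,\mu}=0$ (i.e. $d=1$, $\kappa=0$,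 $\mu=0$), put $\mathbf{T}_{(x,t)}g(y,s)=\frac12[E(\rho_+)+E(\rho_-)]$, where $\rho_\pm=\sqrt{\tfrac12\big(ts+xy\pm\sqrt{t^2-x^2}\sqrt{s^2-y^2}\big)}$ and $$E(\rho)=\tfrac12\big[e^{-\rho}g(t+s+2\rho)+e^{\rho}g(t+s-2\rho)\big]-\tfrac12\rho^2\int_0^\pi g(t+s+2\rho\cos\theta)e^{-\rho\cos\theta}j_1(\rho\sin\theta)\sin\theta\,d\theta.$$ Pseudo convolution: $f*_{\mathbb{V}}g(x,t)=\mathbf{b}_{\kappa,\mu}\int_{\mathbb{V}^{d+1}}f(y,s)\,\mathbf{T}_{(x,t)}g(y,s)\,W_{\kappa,\mu}(y,s)\,dy\,ds$. *)

theory Defs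
  imports "HOL-Probability.Probability"
begin

text \<open>
  The dimension \<open>d\<close> is \<open>CARD('n)\<close>. Real powers are written with \<open>powr\<close>, for which \<open>0 powr a = 0\<close>
  even if \<open>a \<le> 0\<close>; in the weights below this changes values on Lebesgue null sets only.
\<close>

definition cone :: "((real ^ 'n) \<times> real) set" where
  "cone = {(x, t). 0 \<le> t \<and> norm x \<le> t}"

definition h_wt :: "real ^ 'n \<Rightarrow> real ^ 'n \<Rightarrow> real" where
  "h_wt \<kappa> x = (\<Prod>i\<in>UNIV. \<bar>x $ i\<bar> powr (\<kappa> $ i))"

definition u_wt :: "real ^ 'n \<Rightarrow> real \<Rightarrow> (real ^ 'n) \<times> real \<Rightarrow> real" where
  "u_wt \<kappa> \<mu> = (\<lambda>(x, t). (h_wt \<kappa> x)\<^sup>2 * (t\<^sup>2 - (norm x)\<^sup>2) powr (\<mu> - 1/2))"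

definition W_wt :: "real ^ 'n \<Rightarrow> real \<Rightarrow> (real ^ 'n) \<times> real \<Rightarrow> real" where
  "W_wt \<kappa> \<mu> = (\<lambda>(x, t). (h_wt \<kappa> x)\<^sup>2 * (t\<^sup>2 - (norm x)\<^sup>2) powr (\<mu> - 1/2) * exp (- t))"

definition b_const :: "real ^ 'n \<Rightarrow> real \<Rightarrow> real" where
  "b_const \<kappa> \<mu> = 1 / (LINT p:cone|lborel. W_wt \<kappa> \<mu> p)"

definition alpha :: "real ^ 'n \<Rightarrow> real \<Rightarrow> real" where
  "alpha \<kappa> \<mu> = (\<Sum>i\<in>UNIV. \<kappa> $ i) + \<mu> + (real CARD('n) - 1) / 2"


subsection \<open>Weighted \<open>L\<^sup>1\<close> spaces and norms\<close>

definition cone_L1 :: "real ^ 'n \<Rightarrow> real \<Rightarrow> ((real ^ 'n) \<times> real \<Rightarrow> real) set" where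
  "cone_L1 \<kappa> \<mu> = {f. set_integrable lborel cone
     (\<lambda>p. f p * exp (- snd p / 2) * u_wt \<kappa> \<mu> p)}"

definition cone_norm1 :: "real ^ 'n \<Rightarrow> real \<Rightarrow> ((real ^ 'n) \<times> real \<Rightarrow> real) \<Rightarrow> real" where
  "cone_norm1 \<kappa> \<mu> f =
     b_const \<kappa> \<mu> * (LINT p:cone|lborel. \<bar>f p\<bar> * exp (- snd p / 2) * u_wt \<kappa> \<mu> p)"

definition cone_L1_star :: "real ^ 'n \<Rightarrow> real \<Rightarrow> ((real ^ 'n) \<times> real \<Rightarrow> real) set" where
  "cone_L1_star \<kappa> \<mu> = {f. set_integrable lborel cone
     (\<lambda>p. f p * exp (- snd p / 2) * sqrt (snd p) * u_wt \<kappa> \<mu> p)}"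

definition cone_norm1_star :: "real ^ 'n \<Rightarrow> real \<Rightarrow> ((real ^ 'n) \<times> real \<Rightarrow> real) \<Rightarrow> real" where
  "cone_norm1_star \<kappa> \<mu> f =
     b_const \<kappa> \<mu> * (LINT p:cone|lborel. \<bar>f p\<bar> * exp (- snd p / 2) * sqrt (snd p) * u_wt \<kappa> \<mu> p)"

text \<open>Functions on \<open>[0,\<infinity>)\<close> are total functions whose values at negative reals are irrelevant.\<close>

definition half_L1 :: "real \<Rightarrow> (real \<Rightarrow> real) set" where
  "half_L1 a = {g. set_integrable lborel {0..} (\<lambda>t. g t * exp (- t / 2) * t powr a)}"

definition half_norm1 :: "real \<Rightarrow> (real \<Rightarrow> real) \<Rightarrow> real" where
  "half_norm1 a g =
     1 / Gamma (a + 1) * (LINT t:{0..}|lborel. \<bar>g t\<bar> * exp (- t / 2) * t powr a)"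


subsection \<open>Bessel functions\<close>

text \<open>The power series of the Bessel function of the first kind, used only for \<open>z > 0\<close>.\<close>

definition bessel_J :: "real \<Rightarrow> real \<Rightarrow> real" where
  "bessel_J \<nu> z =
     (\<Sum>k. (-1) ^ k * rGamma (real k + \<nu> + 1) / fact k * (z / 2) powr (2 * real k + \<nu>))"

text \<open>\<open>j\<^sub>\<nu>(z) = z\<^sup>-\<^sup>\<nu> J\<^sub>\<nu>(z)\<close>, extended continuously to \<open>z = 0\<close>.\<close>

definition bessel_j :: "real \<Rightarrow> real \<Rightarrow> real" where
  "bessel_j \<nu> z =
     (if z = 0 then rGamma (\<nu> + 1) / 2 powr \<nu> else z powr (- \<nu>) * bessel_J \<nu> z)"


subsection \<open>Generalized translation\<close>

definition c_const :: "real \<Rightarrow> real" where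
  "c_const l = Gamma (l + 1) / (Gamma (1/2) * Gamma (l + 1/2))"

text \<open>
  Integration of \<open>f\<close> against \<open>refl_measure k\<close> is
  \<open>c\<^sub>k\<^sub>-\<^sub>1\<^sub>/\<^sub>2 \<integral> f(u) (1 + u) (1 - u\<^sup>2)\<^sup>k\<^sup>-\<^sup>1 du\<close> over \<open>[-1,1]\<close> for \<open>k > 0\<close>, and its limit \<open>f(1)\<close> for \<open>k = 0\<close>.
  Integration against \<open>sym_measure m\<close> is \<open>c\<^sub>m\<^sub>-\<^sub>1\<^sub>/\<^sub>2 \<integral> f(v) (1 - v\<^sup>2)\<^sup>m\<^sup>-\<^sup>1 dv\<close> over \<open>[-1,1]\<close> for \<open>m > 0\<close>,
  and its limit \<open>(f(1) + f(-1)) / 2\<close> for \<open>m = 0\<close>.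
\<close>

definition refl_measure :: "real \<Rightarrow> real measure" where
  "refl_measure k =
     (if k = 0 then return borel 1
      else density lborel (\<lambda>u. ennreal (indicator {-1..1} u *
             (c_const (k - 1/2) * (1 + u) * (1 - u\<^sup>2) powr (k - 1)))))"

definition sym_measure :: "real \<Rightarrow> real measure" where
  "sym_measure m =
     (if m = 0 then distr (uniform_count_measure {-1, 1}) borel (\<lambda>v. v)
      else density lborel (\<lambda>v. ennreal (indicator {-1..1} v *
             (c_const (m - 1/2) * (1 - v\<^sup>2) powr (m - 1)))))"

definition cube_measure :: "real ^ 'n \<Rightarrow> real \<Rightarrow> (('n \<Rightarrow> real) \<times> real) measure" where
  "cube_measure \<kappa> \<mu> = (\<Pi>\<^sub>M i\<in>UNIV. refl_measure (\<kappa> $ i)) \<Otimes>\<^sub>M sym_measure \<mu>"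

text \<open>
  All measures above live on the full line, so integrals against \<open>cube_measure\<close> are restricted to
  \<open>cube\<close>: outside it, \<open>g\<close> would be evaluated at negative arguments, where it need not be measurable.
\<close>

definition cube :: "(('n \<Rightarrow> real) \<times> real) set" where
  "cube = (UNIV \<rightarrow> {-1..1}) \<times> {-1..1}"

definition rho ::
  "(real ^ 'n) \<times> real \<Rightarrow> (real ^ 'n) \<times> real \<Rightarrow> ('n \<Rightarrow> real) \<times> real \<Rightarrow> real" where
  "rho = (\<lambda>(x, t) (y, s) (u, v).
     sqrt (1/2 * (t * s + (\<Sum>i\<in>UNIV. x $ i * y $ i * u i)
       + sqrt (t\<^sup>2 - (norm x)\<^sup>2) * sqrt (s\<^sup>2 - (norm y)\<^sup>2) * v)))"

text \<open>The constants \<open>c\<close> in \<open>C\<^sub>\<kappa>\<^sub>,\<^sub>\<mu>\<close> are contained in \<open>cube_measure\<close>.\<close>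

definition trans_pos :: "real ^ 'n \<Rightarrow> real \<Rightarrow> (real \<Rightarrow> real)
    \<Rightarrow> (real ^ 'n) \<times> real \<Rightarrow> (real ^ 'n) \<times> real \<Rightarrow> real" where
  "trans_pos \<kappa> \<mu> g p q =
     (let a = alpha \<kappa> \<mu> in
      2 powr (a - 1) * Gamma (a + 1/2) / sqrt pi *
      (LINT w:cube|cube_measure \<kappa> \<mu>. (LINT \<theta>:{0..pi}|lborel.
         (let \<rho> = rho p q w in
          g (snd p + snd q + 2 * \<rho> * cos \<theta>) * exp (- \<rho> * cos \<theta>)
            * bessel_j (a - 1) (\<rho> * sin \<theta>) * (sin \<theta>) powr (2 * a - 1)))))"

definition E_term :: "(real \<Rightarrow> real) \<Rightarrow> real \<Rightarrow> real \<Rightarrow> real \<Rightarrow> real" where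
  "E_term g t s \<rho> =
     1/2 * (exp (- \<rho>) * g (t + s + 2 * \<rho>) + exp \<rho> * g (t + s - 2 * \<rho>))
     - 1/2 * \<rho>\<^sup>2 * (LINT \<theta>:{0..pi}|lborel.
         g (t + s + 2 * \<rho> * cos \<theta>) * exp (- \<rho> * cos \<theta>) * bessel_j 1 (\<rho> * sin \<theta>) * sin \<theta>)"

text \<open>
  For nonnegative parameters, \<open>alpha \<kappa> \<mu> = 0\<close> only if \<open>d = 1\<close>, \<open>\<kappa> = 0\<close> and \<open>\<mu> = 0\<close>; then
  \<open>\<rho>\<^sub>+\<close> and \<open>\<rho>\<^sub>-\<close> are the values of \<open>rho\<close> at \<open>u\<^sub>1 = 1\<close> and \<open>u\<^sub>2 = 1\<close>, \<open>u\<^sub>2 = -1\<close>.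
\<close>

definition gen_trans :: "real ^ 'n \<Rightarrow> real \<Rightarrow> (real \<Rightarrow> real)
    \<Rightarrow> (real ^ 'n) \<times> real \<Rightarrow> (real ^ 'n) \<times> real \<Rightarrow> real" where
  "gen_trans \<kappa> \<mu> g p q =
     (if alpha \<kappa> \<mu> = 0
      then 1/2 * (E_term g (snd p) (snd q) (rho p q (\<lambda>_. 1, 1))
                + E_term g (snd p) (snd q) (rho p q (\<lambda>_. 1, -1)))
      else trans_pos \<kappa> \<mu> g p q)"


subsection \<open>Pseudo convolution\<close>

definition pconv_integrand :: "real ^ 'n \<Rightarrow> real \<Rightarrow> ((real ^ 'n) \<times> real \<Rightarrow> real) \<Rightarrow> (real \<Rightarrow> real)
    \<Rightarrow> (real ^ 'n) \<times> real \<Rightarrow> (real ^ 'n) \<times> real \<Rightarrow> real" where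
  "pconv_integrand \<kappa> \<mu> f g p q = f q * gen_trans \<kappa> \<mu> g p q * W_wt \<kappa> \<mu> q"

definition pconv :: "real ^ 'n \<Rightarrow> real \<Rightarrow> ((real ^ 'n) \<times> real \<Rightarrow> real) \<Rightarrow> (real \<Rightarrow> real)
    \<Rightarrow> (real ^ 'n) \<times> real \<Rightarrow> real" where
  "pconv \<kappa> \<mu> f g p = b_const \<kappa> \<mu> * (LINT q:cone|lborel. pconv_integrand \<kappa> \<mu> f g p q)"

end

theory Submission
  imports Defs
begin

text \<open>
  The assumption on \<open>\<alpha>\<close> forces \<open>d = 1\<close>; write \<open>\<sigma>\<^sub>m\<close> for \<open>sym_measure m\<close>.
  Poisson's integral gives \<open>\<bar>j\<^bsub>\<alpha>-1\<^esub>(z)\<bar> \<le> j\<^bsub>\<alpha>-1\<^esub>(0) + C z\<close>, so that the translation is dominated by a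
  sum of two positive operators, the second carrying an additional factor \<open>\<rho>\<close>.
  Now \<open>\<rho> = \<surd>(ts) \<tau>\<close> with \<open>\<tau>\<^sup>2 = (1 + \<xi>)/2\<close> and
  \<open>\<xi> = (x/t)(y/s)u + \<surd>(1 - (x/t)\<^sup>2) \<surd>(1 - (y/s)\<^sup>2) v\<close>. Integrated over \<open>x/t\<close>, \<open>u\<close> and \<open>v\<close>, the
  variable \<open>\<xi>\<close> has law \<open>\<sigma>\<^bsub>\<alpha>+1/2\<^esub>\<close> independently of \<open>y/s\<close>, and the product of \<open>\<tau>\<close> with the independent
  variable \<open>cos \<theta>\<close> again has a law \<open>\<sigma>\<^sub>m\<close>, namely with \<open>m = 2\<alpha> + 1/2\<close>, respectively \<open>m = 2\<alpha> + 1\<close> for the part with the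
  factor \<open>\<rho>\<close>. Both laws are identified by their moments, which covers the degenerate parameters
  \<open>\<kappa> = 0\<close>, \<open>\<mu> = 0\<close> and \<open>\<alpha> = 0\<close> without case distinctions. What remains are the Laguerre translations
  on the half line for the weights \<open>r\<^bsup>2\<alpha>\<^esup>\<close> and \<open>r\<^bsup>2\<alpha>+1/2\<^esup>\<close>, which preserve these weights.
\<close>

subsection \<open>Beta integrals\<close>

text \<open>For 0 <= \<alpha> < 1/2 the order \<alpha> - 1 lies in [-1, -1/2), where z^(1-\<alpha>)
  J(z) is unbounded: it grows like z^(1/2-\<alpha>). Dominating the kernel by its value at 0 is
  therefore impossible, and the linear term, taken at z = \<rho> sin \<theta>, is the price. Its
  factor \<rho> contains sqrt t and sqrt s: sqrt t raises the exponent of the half-line weight from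
  2\<alpha> to 2\<alpha> + 1/2, and sqrt s is the extra weight of the starred norm of f. All
  estimates put absolute values inside the integrals, so Tonelli applies, and it suffices to fix the
  point (y, s) and to integrate the translation over (x, t). The constants telescope. The linear
  term carries Gamma(\<alpha>+1/2) / Gamma(\<alpha>+1); the law of \<xi> multiplies this by a Beta
  quotient, which leaves Gamma(2\<alpha>+1) / Gamma(2\<alpha>+3/2). This quotient trades the Gamma
  factor of the first half-line norm for that of the second, and \<open>b_const\<close> cancels what
  both terms have in common.\<close>

lemma nn_integral_Beta:
  fixes a b :: real
  assumes "a > 0" "b > 0"
  shows "(\<integral>\<^sup>+x. ennreal (indicator {0..1} x * (x powr (a - 1) * (1 - x) powr (b - 1))) \<partial>lborel)
    = ennreal (Beta a b)"
proof -
  have "((\<lambda>x. indicator {0..1} x *\<^sub>R (x powr (a - 1) * (1 - x) powr (b - 1))) has_integral Beta a b) UNIV"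
  proof -
    have "(\<lambda>x. indicator {0..1} x *\<^sub>R (x powr (a - 1) * (1 - x) powr (b - 1)))
        = (\<lambda>x. if x \<in> {0..1} then x powr (a - 1) * (1 - x) powr (b - 1) else 0)"
      by (auto simp: indicator_def)
    then show ?thesis
      using has_integral_Beta_real[OF assms] by (simp only: has_integral_restrict_UNIV)
  qed
  then show ?thesis
    by (subst nn_integral_has_integral_lborel[symmetric, where I = "Beta a b"])
       (auto simp: indicator_def)
qed

lemma nn_integral_even:
  fixes h :: "real \<Rightarrow> ennreal"
  assumes [measurable]: "h \<in> borel_measurable borel" and even: "\<And>x. h (- x) = h x"
  shows "(\<integral>\<^sup>+x. h x * indicator {-1..1} x \<partial>lborel) = 2 * (\<integral>\<^sup>+x. h x * indicator {0..1} x \<partial>lborel)"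
proof -
  have "(\<integral>\<^sup>+x. h x * indicator {-1..1} x \<partial>lborel)
      = (\<integral>\<^sup>+x. h x * indicator {-1..0} x + h x * indicator {0..1} x \<partial>lborel)"
    by (intro nn_integral_cong_AE AE_I[of _ _ "{0}"]) (auto simp: indicator_def split: if_splits)
  also have "\<dots> = (\<integral>\<^sup>+x. h x * indicator {-1..0} x \<partial>lborel) + (\<integral>\<^sup>+x. h x * indicator {0..1} x \<partial>lborel)"
    by (rule nn_integral_add) auto
  also have "(\<integral>\<^sup>+x. h x * indicator {-1..0} x \<partial>lborel) = (\<integral>\<^sup>+x. h x * indicator {0..1} x \<partial>lborel)"
    by (subst nn_integral_real_affine[where c = "-1" and t = 0])
       (auto simp: even indicator_def intro!: nn_integral_cong)
  finally show ?thesis by (simp add: mult_2)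
qed

text \<open>Serves the substitutions x -> x^2 and \<theta> -> - cos \<theta>, whose derivatives
  supply the spare factor. It covers 0 because \<open>0 powr a = 0\<close> for every
  \<open>a\<close>.\<close>

lemma powr_square_mult:
  fixes x p :: real
  assumes "0 \<le> x"
  shows "(x\<^sup>2) powr (p - 1) * x = x powr (2 * p - 1)"
proof (cases "x = 0")
  case False
  then have "(x\<^sup>2) powr (p - 1) * x = x * x powr (2 * (p - 1))"
    using assms by (simp add: powr_powr flip: powr_numeral)
  also have "\<dots> = x powr (1 + 2 * (p - 1))"
    using assms by (rule powr_mult_base)
  finally show ?thesis by (simp add: algebra_simps)
qed auto

text \<open>Substituting x^2 in the Beta integral gives twice an integral over [0,1], which evenness
  turns into one over [-1,1]. Masses and moments of \<open>sym_measure\<close>,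
  \<open>refl_measure\<close> and \<open>eta\<close> reduce to this integral.\<close>

lemma nn_integral_Beta_symmetric:
  fixes a b :: real
  assumes "a > 0" "b > 0"
  shows "(\<integral>\<^sup>+x. ennreal (indicator {-1..1} x * (\<bar>x\<bar> powr (2 * a - 1) * (1 - x\<^sup>2) powr (b - 1))) \<partial>lborel)
    = ennreal (Beta a b)"
proof -
  let ?f = "\<lambda>x::real. x powr (a - 1) * (1 - x) powr (b - 1)"
  have "ennreal (Beta a b) = (\<integral>\<^sup>+x. ennreal (?f x * indicator {0\<^sup>2..1\<^sup>2} x) \<partial>lborel)"
    by (subst nn_integral_Beta[OF assms, symmetric]) (simp add: mult.commute)
  also have "\<dots> = (\<integral>\<^sup>+x. ennreal (?f (x\<^sup>2) * (2 * x) * indicator {0..1} x) \<partial>lborel)"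
    by (rule nn_integral_substitution[where g = "\<lambda>x. x\<^sup>2" and g' = "\<lambda>x. 2 * x"])
       (auto intro!: derivative_eq_intros continuous_intros simp: set_borel_measurable_def)
  also have "\<dots> = (\<integral>\<^sup>+x. 2 * (ennreal (\<bar>x\<bar> powr (2 * a - 1) * (1 - x\<^sup>2) powr (b - 1)) * indicator {0..1} x) \<partial>lborel)"
  proof (intro nn_integral_cong)
    fix x :: real
    have "(x\<^sup>2) powr (a - 1) * x = x powr (2 * a - 1)" if "x \<ge> 0"
      using that by (rule powr_square_mult)
    then show "ennreal (?f (x\<^sup>2) * (2 * x) * indicator {0..1} x) =
      2 * (ennreal (\<bar>x\<bar> powr (2 * a - 1) * (1 - x\<^sup>2) powr (b - 1)) * indicator {0..1} x)"
      by (auto simp: indicator_def ennreal_mult[symmetric] mult_ac simp flip: ennreal_numeral)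
  qed
  also have "\<dots> = 2 * (\<integral>\<^sup>+x. ennreal (\<bar>x\<bar> powr (2 * a - 1) * (1 - x\<^sup>2) powr (b - 1)) * indicator {0..1} x \<partial>lborel)"
    by (rule nn_integral_cmult) simp
  also have "\<dots> = (\<integral>\<^sup>+x. ennreal (\<bar>x\<bar> powr (2 * a - 1) * (1 - x\<^sup>2) powr (b - 1)) * indicator {-1..1} x \<partial>lborel)"
    by (rule nn_integral_even[symmetric]) auto
  also have "\<dots> = (\<integral>\<^sup>+x. ennreal (indicator {-1..1} x * (\<bar>x\<bar> powr (2 * a - 1) * (1 - x\<^sup>2) powr (b - 1))) \<partial>lborel)"
    by (intro nn_integral_cong) (simp add: indicator_def)
  finally show ?thesis ..
qed

lemma has_bochner_integral_Beta_symmetric: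
  fixes a b :: real
  assumes "a > 0" "b > 0"
  shows "has_bochner_integral lborel
    (\<lambda>x. indicator {-1..1} x * (\<bar>x\<bar> powr (2 * a - 1) * (1 - x\<^sup>2) powr (b - 1))) (Beta a b)"
proof (rule has_bochner_integral_nn_integral)
  show "0 \<le> Beta a b" using assms by (simp add: Beta_def)
qed (use nn_integral_Beta_symmetric[OF assms] in \<open>auto simp: indicator_def\<close>)

lemma integral_lborel_odd:
  fixes h :: "real \<Rightarrow> real"
  assumes "\<And>x. h (- x) = - h x"
  shows "(LINT x|lborel. h x) = 0"
proof -
  have "(LINT x|lborel. h x) = (LINT x|lborel. h (- x))"
    using lborel_integral_real_affine[of "-1" h 0] by simp
  then show ?thesis by (simp add: assms)
qed

lemma Beta_pos_real: "0 < a \<Longrightarrow> 0 < b \<Longrightarrow> 0 < Beta a (b::real)"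
  by (simp add: Beta_def)

text \<open>Puts moments of Beta type densities into the form of quotients of rising factorials; the
  product laws below hold because such factorials cancel.\<close>

lemma Beta_shift_ratio:
  fixes a b :: real
  assumes "a > 0" "b > 0"
  shows "Beta (a + real i) (b + real j) / Beta a b
     = pochhammer a i * pochhammer b j / pochhammer (a + b) (i + j)"
  using assms Gamma_real_pos[of a] Gamma_real_pos[of b] Gamma_real_pos[of "a + b"]
  by (simp add: Beta_def pochhammer_Gamma nonpos_Ints_def add_ac field_simps)

subsection \<open>The measures on the cube\<close>

lemma sets_sym_measure [measurable_cong, simp]: "sets (sym_measure m) = sets borel"
  by (simp add: sym_measure_def)

lemma sets_refl_measure [measurable_cong, simp]: "sets (refl_measure k) = sets borel"
  by (simp add: refl_measure_def)

lemma space_sym_measure [simp]: "space (sym_measure m) = UNIV"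
  by (simp add: sym_measure_def)

lemma space_refl_measure [simp]: "space (refl_measure k) = UNIV"
  by (simp add: refl_measure_def)

lemma c_const_eq_Beta: "0 < m \<Longrightarrow> c_const (m - 1/2) = 1 / Beta (1/2) m"
  using Gamma_real_pos[of m] by (simp add: c_const_def Beta_def add.commute)

lemma sym_measure_pos:
  "0 < m \<Longrightarrow> sym_measure m = density lborel
     (\<lambda>v. ennreal (indicator {-1..1} v * (1 - v\<^sup>2) powr (m - 1) / Beta (1/2) m))"
  by (simp add: sym_measure_def c_const_eq_Beta)

lemma refl_measure_pos:
  "0 < k \<Longrightarrow> refl_measure k = density lborel
     (\<lambda>v. ennreal (indicator {-1..1} v * ((1 + v) * (1 - v\<^sup>2) powr (k - 1)) / Beta (1/2) k))"
  by (simp add: refl_measure_def c_const_eq_Beta)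

text \<open>An even power shifts the first Beta parameter by n/2; an odd one integrates to 0 by
  symmetry.\<close>

lemma has_bochner_integral_power_weight:
  fixes m :: real
  assumes "0 < m"
  shows "has_bochner_integral lborel
    (\<lambda>v. indicator {-1..1} v * (1 - v\<^sup>2) powr (m - 1) * v ^ n)
    (if even n then Beta (1/2 + real (n div 2)) m else 0)"
proof -
  let ?f = "\<lambda>n v. indicator {-1..1} v * (1 - v\<^sup>2) powr (m - 1) * v ^ n :: real"
  have even: "has_bochner_integral lborel (?f (2 * j)) (Beta (1/2 + real j) m)" for j
  proof -
    have "has_bochner_integral lborel
        (\<lambda>x. indicator {-1..1} x * (\<bar>x\<bar> powr (2 * (1/2 + real j) - 1) * (1 - x\<^sup>2) powr (m - 1)))
        (Beta (1/2 + real j) m)"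
      using assms by (intro has_bochner_integral_Beta_symmetric) auto
    \<comment> \<open>The origin is left out because for j = 0 the left side contains v^0 = 1, while
      \<open>0 powr 0 = 0\<close> on the right.\<close>
    moreover have "?f (2 * j) v =
        indicator {-1..1} v * (\<bar>v\<bar> powr (2 * (1/2 + real j) - 1) * (1 - v\<^sup>2) powr (m - 1))"
      if "v \<noteq> 0" for v
    proof -
      have "\<bar>v\<bar> powr (real (2 * j)) = \<bar>v\<bar> ^ (2 * j)"
        using that by (subst powr_realpow) auto
      also have "\<dots> = v ^ (2 * j)" by (simp add: power_mult)
      finally show ?thesis by (simp add: algebra_simps)
    qed
    then have "AE v in lborel. ?f (2 * j) v =
        indicator {-1..1} v * (\<bar>v\<bar> powr (2 * (1/2 + real j) - 1) * (1 - v\<^sup>2) powr (m - 1))"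
      using AE_lborel_singleton[of "0::real"] by auto
    ultimately show ?thesis
      by (subst has_bochner_integral_cong_AE) auto
  qed
  show ?thesis
  proof (cases "even n")
    case True
    then show ?thesis using even[of "n div 2"] by simp
  next
    case False
    have "integrable lborel (?f n)"
    proof (rule Bochner_Integration.integrable_bound)
      show "integrable lborel (?f 0)" using even[of 0] by (auto simp: has_bochner_integral_iff)
      show "AE x in lborel. norm (?f n x) \<le> norm (?f 0 x)"
        by (auto simp: abs_mult power_abs indicator_def intro!: mult_left_le power_le_one)
    qed simp
    moreover have "(LINT v|lborel. ?f n v) = 0"
      using False by (intro integral_lborel_odd) (auto simp: indicator_def)
    ultimately show ?thesis using False by (simp add: has_bochner_integral_iff)
  qed
qed

lemma prob_space_density_lborel:
  fixes w :: "real \<Rightarrow> real"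
  assumes "has_bochner_integral lborel w 1" "\<And>x. 0 \<le> w x"
  shows "prob_space (density lborel (\<lambda>x. ennreal (w x)))"
proof
  have [measurable]: "w \<in> borel_measurable lborel"
    using assms(1) by (auto simp: has_bochner_integral_iff)
  have "(\<integral>\<^sup>+x. ennreal (w x) \<partial>lborel) = ennreal 1"
    using assms by (subst nn_integral_eq_integral) (auto simp: has_bochner_integral_iff)
  then show "emeasure (density lborel (\<lambda>x. ennreal (w x))) (space (density lborel (\<lambda>x. ennreal (w x)))) = 1"
    by (simp add: emeasure_density)
qed

lemma prob_space_sym_measure: "0 \<le> m \<Longrightarrow> prob_space (sym_measure m)"
proof (cases "m = 0")
  case True
  have "prob_space (uniform_count_measure {-1, 1::real})"
    by (intro prob_space_uniform_count_measure) auto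
  then show ?thesis
    by (auto simp: True sym_measure_def intro!: prob_space.prob_space_distr)
next
  case False
  assume "0 \<le> m"
  with False have m: "m > 0" by simp
  from has_bochner_integral_divide_zero[OF has_bochner_integral_power_weight[OF m, of 0], of "Beta (1/2) m"] m
  show ?thesis
    unfolding sym_measure_pos[OF m]
    by (intro prob_space_density_lborel) (simp_all add: Beta_pos_real less_imp_neq[symmetric] less_imp_le)
qed

lemma AE_sym_measure: "0 \<le> m \<Longrightarrow> AE v in sym_measure m. \<bar>v\<bar> \<le> 1"
proof (cases "m = 0")
  case True
  show ?thesis
    unfolding True sym_measure_def
    by (simp, subst AE_distr_iff) (auto simp: space_uniform_count_measure intro!: AE_I2)
next
  case False
  assume "0 \<le> m"
  with False have m: "m > 0" by simp
  show ?thesis unfolding sym_measure_pos[OF m]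
    by (subst AE_density) (auto simp: indicator_def ennreal_zero_less_divide)
qed

text \<open>For m = 0 there are point masses at 1 and -1. The lemma is applied at c = -1, where ((1
  + \<xi>) / 2) powr 0 is 0 instead of 1.\<close>

lemma AE_sym_measure_not_eq: "0 < m \<Longrightarrow> AE v in sym_measure m. v \<noteq> c"
  unfolding sym_measure_pos using AE_lborel_singleton[of c]
  by (subst AE_density) auto

text \<open>At m = 0 the quotient is 1, the even moment of the two point masses, so a single formula
  covers all m >= 0.\<close>

lemma sym_measure_moment:
  assumes "0 \<le> m"
  shows "(LINT v|sym_measure m. v ^ n) =
    (if even n then pochhammer (1/2) (n div 2) / pochhammer (m + 1/2) (n div 2) else 0)"
proof (cases "m = 0")
  case True
  have "pochhammer (1/2::real) j \<noteq> 0" for j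
    by (intro pochhammer_pos less_imp_neq[symmetric]) simp
  moreover have "(LINT v|uniform_count_measure {-1, 1::real}. v ^ n) = (1 + (-1) ^ n) / 2"
    by (subst integral_uniform_count_measure) auto
  ultimately show ?thesis
    unfolding True sym_measure_def by (simp only: refl if_True, subst integral_distr) auto
next
  case False
  with assms have m: "m > 0" by simp
  have "(LINT v|sym_measure m. v ^ n) =
      (LINT v|lborel. indicator {-1..1} v * (1 - v\<^sup>2) powr (m - 1) * v ^ n) / Beta (1/2) m"
    unfolding sym_measure_pos[OF m] using m
    by (subst integral_density) (auto simp: Beta_pos_real less_imp_le)
  also have "\<dots> = (if even n then Beta (1/2 + real (n div 2)) m / Beta (1/2) m else 0)"
    using has_bochner_integral_power_weight[OF m, of n] by (auto simp: has_bochner_integral_iff)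
  finally show ?thesis
    using Beta_shift_ratio[of "1/2" m "n div 2" 0] m by (simp add: add.commute)
qed

text \<open>For even n only the summand 1 of the factor 1 + v contributes, so the even moments agree
  with those of \<open>sym_measure k\<close>.\<close>

lemma has_bochner_integral_refl_weight:
  fixes k :: real
  assumes "0 < k" "even n"
  shows "has_bochner_integral lborel
    (\<lambda>v. indicator {-1..1} v * ((1 + v) * (1 - v\<^sup>2) powr (k - 1)) * v ^ n)
    (Beta (1/2 + real (n div 2)) k)"
  using has_bochner_integral_add[OF has_bochner_integral_power_weight[OF assms(1), of n]
      has_bochner_integral_power_weight[OF assms(1), of "Suc n"]] assms(2)
  by (simp add: algebra_simps)

lemma prob_space_refl_measure: "0 \<le> k \<Longrightarrow> prob_space (refl_measure k)"
proof (cases "k = 0")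
  case True
  then show ?thesis by (simp add: refl_measure_def prob_space_return)
next
  case False
  assume "0 \<le> k"
  with False have k: "k > 0" by simp
  from has_bochner_integral_divide_zero[OF has_bochner_integral_refl_weight[OF k, of 0], of "Beta (1/2) k"] k
  show ?thesis
    unfolding refl_measure_pos[OF k]
    by (intro prob_space_density_lborel)
       (auto simp add: Beta_pos_real less_imp_neq[symmetric] less_imp_le indicator_def)
qed

lemma AE_refl_measure: "0 \<le> k \<Longrightarrow> AE v in refl_measure k. \<bar>v\<bar> \<le> 1"
proof (cases "k = 0")
  case True
  have "AE v in return borel (1::real). \<bar>v\<bar> \<le> 1"
    by (subst AE_return) auto
  then show ?thesis unfolding True refl_measure_def by simp
next
  case False
  assume "0 \<le> k"
  with False have k: "k > 0" by simp
  show ?thesis unfolding refl_measure_pos[OF k]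
    by (subst AE_density) (auto simp: indicator_def)
qed

text \<open>The odd moments do not vanish, but in \<open>cone_product_law\<close> every odd power of
  u is multiplied by a vanishing integral over v or w.\<close>

lemma refl_measure_even_moment:
  assumes "0 \<le> k" "even n"
  shows "(LINT v|refl_measure k. v ^ n) = pochhammer (1/2) (n div 2) / pochhammer (k + 1/2) (n div 2)"
proof (cases "k = 0")
  case True
  have "pochhammer (1/2::real) j \<noteq> 0" for j
    by (intro pochhammer_pos less_imp_neq[symmetric]) simp
  then show ?thesis
    unfolding True refl_measure_def by (simp add: integral_return)
next
  case False
  with assms have k: "k > 0" by simp
  have "(LINT v|refl_measure k. v ^ n) =
      (LINT v|lborel. indicator {-1..1} v * ((1 + v) * (1 - v\<^sup>2) powr (k - 1)) * v ^ n) / Beta (1/2) k"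
    unfolding refl_measure_pos[OF k] using k
    by (subst integral_density) (auto simp: Beta_pos_real less_imp_le indicator_def)
  also have "\<dots> = Beta (1/2 + real (n div 2)) k / Beta (1/2) k"
    using has_bochner_integral_refl_weight[OF k, of n] assms by (auto simp: has_bochner_integral_iff)
  finally show ?thesis
    using Beta_shift_ratio[of "1/2" k "n div 2" 0] k by (simp add: add.commute)
qed

text \<open>The law of \<open>x/t\<close> on a slice \<open>t = const\<close> of the weighted cone.\<close>

definition eta :: "real \<Rightarrow> real \<Rightarrow> real measure" where
  "eta k m = density lborel (\<lambda>w. ennreal
     (indicator {-1..1} w * (\<bar>w\<bar> powr (2 * k) * (1 - w\<^sup>2) powr (m - 1/2)) / Beta (k + 1/2) (m + 1/2)))"

lemma sets_eta [measurable_cong, simp]: "sets (eta k m) = sets borel"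
  by (simp add: eta_def)

lemma space_eta [simp]: "space (eta k m) = UNIV"
  by (simp add: eta_def)

text \<open>The extra factors shift the two Beta parameters independently. These mixed moments are
  the ones that the binomial expansion in \<open>cone_product_law\<close> produces.\<close>

lemma has_bochner_integral_eta_weight:
  fixes k m :: real
  assumes "0 \<le> k" "0 \<le> m"
  shows "has_bochner_integral lborel
    (\<lambda>w. indicator {-1..1} w * (\<bar>w\<bar> powr (2 * k) * (1 - w\<^sup>2) powr (m - 1/2)) * (w ^ (2 * i) * (1 - w\<^sup>2) ^ j))
    (Beta (k + 1/2 + real i) (m + 1/2 + real j))"
proof -
  have "has_bochner_integral lborel
      (\<lambda>x. indicator {-1..1} x * (\<bar>x\<bar> powr (2 * (k + 1/2 + real i) - 1) * (1 - x\<^sup>2) powr (m + 1/2 + real j - 1)))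
      (Beta (k + 1/2 + real i) (m + 1/2 + real j))"
    using assms by (intro has_bochner_integral_Beta_symmetric) auto
  moreover have pw: "indicator {-1..1} w * (\<bar>w\<bar> powr (2 * k) * (1 - w\<^sup>2) powr (m - 1/2)) * (w ^ (2 * i) * (1 - w\<^sup>2) ^ j)
      = indicator {-1..1} w * (\<bar>w\<bar> powr (2 * (k + 1/2 + real i) - 1) * (1 - w\<^sup>2) powr (m + 1/2 + real j - 1))"
    if "w \<noteq> 0" "w \<noteq> 1" "w \<noteq> -1" for w
  proof (cases "\<bar>w\<bar> \<le> 1")
    case True
    with that have "\<bar>w\<bar> < 1" by auto
    then have pos: "1 - w\<^sup>2 > 0" by (simp add: abs_square_less_1)
    have "\<bar>w\<bar> powr (2 * (k + 1/2 + real i) - 1) = \<bar>w\<bar> powr (2 * k + real (2 * i))"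
      by (simp add: algebra_simps)
    also have "\<dots> = \<bar>w\<bar> powr (2 * k) * \<bar>w\<bar> ^ (2 * i)"
      using that by (subst powr_add, subst powr_realpow) auto
    also have "\<bar>w\<bar> ^ (2 * i) = w ^ (2 * i)" by (simp add: power_mult)
    finally have 1: "\<bar>w\<bar> powr (2 * (k + 1/2 + real i) - 1) = \<bar>w\<bar> powr (2 * k) * w ^ (2 * i)" .
    have "(1 - w\<^sup>2) powr (m + 1/2 + real j - 1) = (1 - w\<^sup>2) powr (m - 1/2 + real j)"
      by (simp add: algebra_simps)
    also have "\<dots> = (1 - w\<^sup>2) powr (m - 1/2) * (1 - w\<^sup>2) ^ j"
      using pos by (subst powr_add, subst powr_realpow) auto
    finally show ?thesis unfolding 1 by simp
  qed (auto simp: indicator_def)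
  have "AE w in lborel.
      indicator {-1..1} w * (\<bar>w\<bar> powr (2 * k) * (1 - w\<^sup>2) powr (m - 1/2)) * (w ^ (2 * i) * (1 - w\<^sup>2) ^ j)
      = indicator {-1..1} w * (\<bar>w\<bar> powr (2 * (k + 1/2 + real i) - 1) * (1 - w\<^sup>2) powr (m + 1/2 + real j - 1))"
    using AE_lborel_singleton[of "0::real"] AE_lborel_singleton[of "1::real"] AE_lborel_singleton[of "-1::real"]
    by eventually_elim (rule pw)
  ultimately show ?thesis
    by (subst has_bochner_integral_cong_AE) auto
qed

lemma prob_space_eta: "0 \<le> k \<Longrightarrow> 0 \<le> m \<Longrightarrow> prob_space (eta k m)"
  using has_bochner_integral_divide_zero[OF has_bochner_integral_eta_weight[of k m 0 0], of "Beta (k + 1/2) (m + 1/2)"]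
  unfolding eta_def
  by (intro prob_space_density_lborel)
    (auto simp add: Beta_pos_real less_imp_neq[symmetric] less_imp_le indicator_def)

lemma AE_eta: "AE v in eta k m. \<bar>v\<bar> \<le> 1"
  unfolding eta_def by (subst AE_density) (auto simp: indicator_def)

lemma eta_moment_even:
  assumes "0 \<le> k" "0 \<le> m"
  shows "(LINT w|eta k m. w ^ (2 * i) * (1 - w\<^sup>2) ^ j) =
    pochhammer (k + 1/2) i * pochhammer (m + 1/2) j / pochhammer (k + m + 1) (i + j)"
proof -
  have "(LINT w|eta k m. w ^ (2 * i) * (1 - w\<^sup>2) ^ j) =
     (LINT w|lborel. indicator {-1..1} w * (\<bar>w\<bar> powr (2 * k) * (1 - w\<^sup>2) powr (m - 1/2)) * (w ^ (2 * i) * (1 - w\<^sup>2) ^ j))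
       / Beta (k + 1/2) (m + 1/2)"
    unfolding eta_def using assms
    by (subst integral_density) (auto simp: Beta_pos_real less_imp_le indicator_def)
  also have "\<dots> = Beta (k + 1/2 + real i) (m + 1/2 + real j) / Beta (k + 1/2) (m + 1/2)"
    using has_bochner_integral_eta_weight[OF assms, of i j] by (auto simp: has_bochner_integral_iff)
  finally show ?thesis
    using Beta_shift_ratio[of "k + 1/2" "m + 1/2" i j] assms by (simp add: add_ac)
qed

lemma eta_odd:
  fixes h :: "real \<Rightarrow> real"
  assumes "0 \<le> k" "0 \<le> m" "h \<in> borel_measurable borel" "\<And>w. h (- w) = - h w"
  shows "(LINT w|eta k m. h w) = 0"
proof -
  have "(LINT w|eta k m. h w) =
     (LINT w|lborel. indicator {-1..1} w * (\<bar>w\<bar> powr (2 * k) * (1 - w\<^sup>2) powr (m - 1/2)) / Beta (k + 1/2) (m + 1/2) * h w)"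
    unfolding eta_def using assms
    by (subst integral_density) (auto simp: Beta_pos_real less_imp_le indicator_def)
  also have "\<dots> = 0"
    by (intro integral_lborel_odd) (auto simp: indicator_def assms(4))
  finally show ?thesis .
qed

lemma one_minus_sq_affine: "1 - (-1 + 2 * p)\<^sup>2 = 4 * (p * (1 - p))" for p :: real
  by (simp add: power2_eq_square algebra_simps)

text \<open>With \<xi> = 2p - 1 the density becomes a multiple of (p (1 - p))^(m-1), so p = (1 +
  \<xi>)/2 has the Beta(m, m) distribution, and the right side is its moment of order r.\<close>

lemma sym_measure_half_moment:
  assumes "0 < m" "0 \<le> r"
  shows "(\<integral>\<^sup>+\<xi>. ennreal (((1 + \<xi>) / 2) powr r) \<partial>sym_measure m) = ennreal (Beta (m + r) m / Beta m m)"
proof -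
  \<comment> \<open>The factor 2 is the Jacobian of \<xi> = -1 + 2p, the power of 4 comes from
    \<open>one_minus_sq_affine\<close>.\<close>
  define A where "A = 2 * 4 powr (m - 1) / Beta (1/2) m"
  have A: "A \<ge> 0" using assms by (simp add: A_def Beta_pos_real less_imp_le)
  have *: "(\<integral>\<^sup>+\<xi>. ennreal (((1 + \<xi>) / 2) powr r) \<partial>sym_measure m) = ennreal (A * Beta (m + r) m)"
    if "0 \<le> r" for r
  proof -
    have "(\<integral>\<^sup>+\<xi>. ennreal (((1 + \<xi>) / 2) powr r) \<partial>sym_measure m) =
       (\<integral>\<^sup>+\<xi>. ennreal (indicator {-1..1} \<xi> * (1 - \<xi>\<^sup>2) powr (m - 1) / Beta (1/2) m) * ennreal (((1 + \<xi>) / 2) powr r) \<partial>lborel)"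
      unfolding sym_measure_pos[OF assms(1)] by (subst nn_integral_density) auto
    also have "\<dots> = ennreal 2 * (\<integral>\<^sup>+p. ennreal (indicator {-1..1} (-1 + 2 * p) * (1 - (-1 + 2 * p)\<^sup>2) powr (m - 1) / Beta (1/2) m)
        * ennreal (((1 + (-1 + 2 * p)) / 2) powr r) \<partial>lborel)"
      by (subst nn_integral_real_affine[where c = 2 and t = "-1"]) auto
    also have "(\<integral>\<^sup>+p. ennreal (indicator {-1..1} (-1 + 2 * p) * (1 - (-1 + 2 * p)\<^sup>2) powr (m - 1) / Beta (1/2) m)
        * ennreal (((1 + (-1 + 2 * p)) / 2) powr r) \<partial>lborel)
       = (\<integral>\<^sup>+p. ennreal (4 powr (m - 1) / Beta (1/2) m) * ennreal (indicator {0..1} p * (p powr (m + r - 1) * (1 - p) powr (m - 1))) \<partial>lborel)"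
    proof (intro nn_integral_cong)
      fix p :: real
      show "ennreal (indicator {-1..1} (-1 + 2 * p) * (1 - (-1 + 2 * p)\<^sup>2) powr (m - 1) / Beta (1/2) m)
          * ennreal (((1 + (-1 + 2 * p)) / 2) powr r) =
        ennreal (4 powr (m - 1) / Beta (1/2) m) * ennreal (indicator {0..1} p * (p powr (m + r - 1) * (1 - p) powr (m - 1)))"
      proof (cases "0 \<le> p \<and> p \<le> 1")
        case True
        have "p powr (m + r - 1) = p powr (m - 1) * p powr r"
          by (simp add: powr_add[symmetric] algebra_simps)
        moreover have "(4 * (p * (1 - p))) powr (m - 1) = 4 powr (m - 1) * (p powr (m - 1) * (1 - p) powr (m - 1))"
          using True by (simp only: powr_mult)
        ultimately show ?thesis using True assms
          by (subst one_minus_sq_affine, subst (1 2) ennreal_mult[symmetric])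
             (simp_all add: Beta_pos_real less_imp_le)
      qed (auto simp: indicator_def)
    qed
    also have "\<dots> = ennreal (4 powr (m - 1) / Beta (1/2) m) * ennreal (Beta (m + r) m)"
      using assms that by (subst nn_integral_cmult, simp, subst nn_integral_Beta) auto
    also have "ennreal 2 * \<dots> = ennreal (A * Beta (m + r) m)"
      using assms that by (simp add: A_def Beta_pos_real less_imp_le ennreal_mult[symmetric] mult_ac
          del: ennreal_numeral)
    finally show ?thesis .
  qed
  \<comment> \<open>The case r = 0, where the integral is the total mass 1, evaluates
    \<open>A\<close> as 1 / \<open>Beta m m\<close> without the duplication formula.\<close>
  interpret prob_space "sym_measure m" using assms by (intro prob_space_sym_measure) simp
  have "AE \<xi> in sym_measure m. \<xi> \<noteq> -1" using assms(1) by (rule AE_sym_measure_not_eq)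
  then have "(\<integral>\<^sup>+\<xi>. ennreal (((1 + \<xi>) / 2) powr 0) \<partial>sym_measure m) = (\<integral>\<^sup>+\<xi>. 1 \<partial>sym_measure m)"
    by (intro nn_integral_cong_AE) auto
  also have "\<dots> = 1" using emeasure_space_1 by simp
  finally have "ennreal (A * Beta m m) = ennreal 1" using *[of 0] by simp
  then have "A * Beta m m = 1" using A assms by (subst (asm) ennreal_inj) (auto simp: Beta_pos_real less_imp_le)
  then have "A = 1 / Beta m m" using Beta_pos_real[OF assms(1) assms(1)] by (simp add: field_simps)
  with *[OF assms(2)] show ?thesis by simp
qed

subsection \<open>Laws identified by their moments\<close>

text \<open>Sum and integral commute because the n-th term is bounded by the norm of c n. Banach
  space values let the lemma serve both the complex exponential series of characteristic functions
  and the real series for cos and sin in Poisson's integral, the last one with Y = X.\<close>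

lemma sums_moments:
  fixes c :: "nat \<Rightarrow> 'b::{banach, second_countable_topology}" and X Y :: "'a \<Rightarrow> real"
  assumes "prob_space M" and [measurable]: "X \<in> borel_measurable M" "Y \<in> borel_measurable M"
    and bX: "AE x in M. \<bar>X x\<bar> \<le> 1" and bY: "AE x in M. \<bar>Y x\<bar> \<le> 1"
    and se: "summable (\<lambda>n. norm (c n))"
  shows "(\<lambda>n. (LINT x|M. Y x * X x ^ n) *\<^sub>R c n) sums (LINT x|M. (\<Sum>n. (Y x * X x ^ n) *\<^sub>R c n))"
proof -
  interpret prob_space M by fact
  have b: "AE x in M. norm ((Y x * X x ^ n) *\<^sub>R c n) \<le> norm (c n)" for n
    using bX bY
  proof eventually_elim
    case (elim x)
    then have "\<bar>Y x\<bar> * \<bar>X x\<bar> ^ n \<le> 1" by (intro mult_le_one power_le_one) auto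
    then show ?case by (simp add: abs_mult power_abs mult_left_le_one_le)
  qed
  have int: "integrable M (\<lambda>x. (Y x * X x ^ n) *\<^sub>R c n)" for n
    using b[of n] by (intro integrable_const_bound[of _ "norm (c n)"]) auto
  have int': "integrable M (\<lambda>x. Y x * X x ^ n)" for n
    using bX bY by (intro integrable_const_bound[of _ 1])
      (auto simp: abs_mult power_abs intro!: mult_le_one power_le_one)
  have "(\<lambda>n. LINT x|M. (Y x * X x ^ n) *\<^sub>R c n) sums (LINT x|M. (\<Sum>n. (Y x * X x ^ n) *\<^sub>R c n))"
  proof (rule sums_integral)
    have "AE x in M. \<forall>n. norm ((Y x * X x ^ n) *\<^sub>R c n) \<le> norm (c n)"
      using b by (subst AE_all_countable) blast
    then show "AE x in M. summable (\<lambda>n. norm ((Y x * X x ^ n) *\<^sub>R c n))"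
    proof eventually_elim
      case (elim x)
      then show ?case by (intro summable_comparison_test'[OF se, of 0]) auto
    qed
    show "summable (\<lambda>n. LINT x|M. norm ((Y x * X x ^ n) *\<^sub>R c n))"
    proof (rule summable_comparison_test'[OF se, of 0])
      fix n
      have "(LINT x|M. norm ((Y x * X x ^ n) *\<^sub>R c n)) \<le> (LINT x|M. norm (c n))"
        using b[of n] integrable_norm[OF int[of n]] by (intro integral_mono_AE) auto
      then show "norm (LINT x|M. norm ((Y x * X x ^ n) *\<^sub>R c n)) \<le> norm (c n)"
        by (simp add: prob_space)
    qed
  qed (rule int)
  then show ?thesis using int' by simp
qed

lemma char_sums_moments:
  fixes X :: "'a \<Rightarrow> real"
  assumes "prob_space M" "X \<in> borel_measurable M" "AE x in M. \<bar>X x\<bar> \<le> 1"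
  shows "(\<lambda>n. (LINT x|M. X x ^ n) *\<^sub>R ((\<i> * complex_of_real t) ^ n / fact n)) sums (LINT x|M. iexp (t * X x))"
proof -
  have "summable (\<lambda>n. \<bar>t\<bar> ^ n / fact n)"
    using summable_exp[of "\<bar>t\<bar>"] by (simp add: divide_inverse mult.commute)
  then have "summable (\<lambda>n. norm ((\<i> * complex_of_real t) ^ n / fact n))"
    by (simp add: norm_divide norm_power norm_mult)
  from sums_moments[OF assms(1,2) _ assms(3) _ this, of "\<lambda>_. 1"]
  have "(\<lambda>n. (LINT x|M. X x ^ n) *\<^sub>R ((\<i> * complex_of_real t) ^ n / fact n))
     sums (LINT x|M. (\<Sum>n. X x ^ n *\<^sub>R ((\<i> * complex_of_real t) ^ n / fact n)))"
    by simp
  moreover have "(\<Sum>n. X x ^ n *\<^sub>R ((\<i> * complex_of_real t) ^ n / fact n)) = iexp (t * X x)" for x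
    by (simp add: exp_def power_mult_distrib scaleR_conv_of_real divide_inverse mult_ac)
  ultimately show ?thesis by (simp only:)
qed

text \<open>A bounded variable has an everywhere convergent expansion of its characteristic function
  with the moments as coefficients; equal moments thus give equal characteristic functions.\<close>

lemma distr_eq_if_moments_eq:
  fixes X :: "'a \<Rightarrow> real"
  assumes "prob_space M" "X \<in> borel_measurable M" "AE x in M. \<bar>X x\<bar> \<le> 1"
    and "prob_space N" and sN: "sets N = sets borel" and "AE x in N. \<bar>x\<bar> \<le> 1"
    and mom: "\<And>n. (LINT x|M. X x ^ n) = (LINT x|N. x ^ n)"
  shows "distr M borel X = N"
proof (rule Levy_uniqueness)
  have [measurable_cong]: "sets N = sets borel" by fact
  show "real_distribution (distr M borel X)"
    using assms by (simp add: real_distribution_def real_distribution_axioms_def prob_space.prob_space_distr)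
  show "real_distribution N"
    using assms sets_eq_imp_space_eq[OF sN] by (simp add: real_distribution_def real_distribution_axioms_def)
  show "char (distr M borel X) = char N"
  proof
    fix t
    have "char (distr M borel X) t = (LINT x|M. iexp (t * X x))"
      using assms(2) by (simp add: char_def integral_distr)
    also have "\<dots> = (LINT x|N. iexp (t * x))"
      using char_sums_moments[OF assms(1-3), of t] char_sums_moments[OF assms(4) _ assms(6), of t]
      by (simp add: mom measurable_ident_sets[OF sN] sums_iff)
    finally show "char (distr M borel X) t = char N t" by (simp add: char_def)
  qed
qed

lemma nn_integral_eq_if_moments_eq:
  fixes X :: "'a \<Rightarrow> real"
  assumes "prob_space M" "X \<in> borel_measurable M" "AE x in M. \<bar>X x\<bar> \<le> 1"
    and "prob_space N" "sets N = sets borel" "AE x in N. \<bar>x\<bar> \<le> 1"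
    and "\<And>n. (LINT x|M. X x ^ n) = (LINT x|N. x ^ n)"
    and "F \<in> borel_measurable borel"
  shows "(\<integral>\<^sup>+x. F (X x) \<partial>M) = (\<integral>\<^sup>+x. F x \<partial>N)"
proof -
  have "(\<integral>\<^sup>+x. F x \<partial>N) = (\<integral>\<^sup>+x. F x \<partial>distr M borel X)"
    using assms by (subst distr_eq_if_moments_eq[OF assms(1-7)]) auto
  then show ?thesis using assms by (simp add: nn_integral_distr)
qed

lemma integral_pair_mult:
  fixes f :: "'a \<Rightarrow> real" and g :: "'b \<Rightarrow> real"
  assumes "prob_space M" "prob_space N" "integrable M f" "integrable N g"
  shows "integrable (M \<Otimes>\<^sub>M N) (\<lambda>x. f (fst x) * g (snd x))"
    "(LINT x|(M \<Otimes>\<^sub>M N). f (fst x) * g (snd x)) = (LINT x|M. f x) * (LINT y|N. g y)"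
proof -
  interpret M: prob_space M by fact
  interpret N: prob_space N by fact
  interpret P: pair_prob_space M N ..
  have [measurable]: "f \<in> borel_measurable M" "g \<in> borel_measurable N" using assms by auto
  show *: "integrable (M \<Otimes>\<^sub>M N) (\<lambda>x. f (fst x) * g (snd x))"
    using assms by (intro P.Fubini_integrable) (auto simp: abs_mult)
  show "(LINT x|(M \<Otimes>\<^sub>M N). f (fst x) * g (snd x)) = (LINT x|M. f x) * (LINT y|N. g y)"
    using P.integral_fst'[OF *] by simp
qed

lemma (in prob_space) integrable_bounded_power:
  assumes "X \<in> borel_measurable M" "AE x in M. \<bar>X x\<bar> \<le> 1"
  shows "integrable M (\<lambda>x. X x ^ n :: real)"
  using assms by (intro integrable_const_bound[of _ 1]) (auto simp: power_abs intro!: power_le_one)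

lemma nn_integral_pair_prob:
  assumes "prob_space M" "prob_space N" "F \<in> borel_measurable (M \<Otimes>\<^sub>M N)"
  shows "(\<integral>\<^sup>+x. F x \<partial>(M \<Otimes>\<^sub>M N)) = (\<integral>\<^sup>+x. \<integral>\<^sup>+y. F (x, y) \<partial>N \<partial>M)"
proof -
  interpret N: prob_space N by fact
  show ?thesis using assms(3) by (rule N.nn_integral_fst[symmetric])
qed

section \<open>Two product laws, proved by cancelling rising factorials in the moments\<close>

text \<open>Under the normalised weight ((1 + \<xi>)/2)^r the variable p = (1 + \<xi>)/2 has law
  Beta(m + r, m). With (z)_j for rising factorials, the moments of order 2j of sqrt p and of a are
  (m+r)_j / (2m+r)_j and (1/2)_j / (m+r)_j. Their product is that moment of the law on the right;
  odd moments vanish by the symmetry of a.\<close>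

lemma Gegenbauer_product_law:
  fixes m r :: real
  assumes "0 < m" "0 \<le> r" "0 \<le> m + r - 1/2" and [measurable]: "F \<in> borel_measurable borel"
  shows "(\<integral>\<^sup>+\<xi>. ennreal (((1 + \<xi>) / 2) powr r) * (\<integral>\<^sup>+a. F (sqrt ((1 + \<xi>) / 2) * a) \<partial>sym_measure (m + r - 1/2)) \<partial>sym_measure m)
     = ennreal (Beta (m + r) m / Beta m m) * (\<integral>\<^sup>+a. F a \<partial>sym_measure (2 * m + r - 1/2))"
proof -
  define e where "e = Beta (m + r) m / Beta m m"
  have e: "e > 0" using assms by (simp add: e_def Beta_pos_real)
  define S where "S = sym_measure (m + r - 1/2)"
  define L where "L = density (sym_measure m) (\<lambda>\<xi>. ennreal (((1 + \<xi>) / 2) powr r / e))"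
  have [measurable_cong, simp]: "sets L = sets borel" "sets S = sets borel" by (auto simp: L_def S_def)
  have pS: "prob_space S" unfolding S_def using assms by (intro prob_space_sym_measure) auto
  have pL: "prob_space L"
  proof
    have "(\<integral>\<^sup>+\<xi>. ennreal (((1 + \<xi>) / 2) powr r / e) \<partial>sym_measure m) =
      (\<integral>\<^sup>+\<xi>. ennreal (1 / e) * ennreal (((1 + \<xi>) / 2) powr r) \<partial>sym_measure m)"
      using e by (intro nn_integral_cong) (simp flip: ennreal_mult)
    also have "\<dots> = ennreal (1 / e) * ennreal e"
      using assms by (subst nn_integral_cmult) (auto simp: sym_measure_half_moment e_def)
    also have "\<dots> = 1" using e by (simp flip: ennreal_mult)
    finally show "emeasure L (space L) = 1" by (simp add: L_def emeasure_density)
  qed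
  have AES: "AE a in S. \<bar>a\<bar> \<le> 1" unfolding S_def using assms by (intro AE_sym_measure) auto
  have "AE \<xi> in sym_measure m. \<bar>\<xi>\<bar> \<le> 1" using assms by (intro AE_sym_measure) auto
  then have AEL': "AE \<xi> in L. \<bar>\<xi>\<bar> \<le> 1"
    unfolding L_def by (subst AE_density) auto
  have AEL: "AE \<xi> in L. 0 \<le> (1 + \<xi>) / 2 \<and> sqrt ((1 + \<xi>) / 2) \<le> 1"
    using AEL' by eventually_elim auto
  interpret S: prob_space S by fact
  interpret L: prob_space L by fact
  interpret P: pair_prob_space L S ..
  have momL: "(LINT \<xi>|L. sqrt ((1 + \<xi>) / 2) ^ (2 * j)) = pochhammer (m + r) j / pochhammer (2 * m + r) j" for j
  proof -
    have "(\<integral>\<^sup>+\<xi>. ennreal (sqrt ((1 + \<xi>) / 2) ^ (2 * j)) \<partial>L)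
        = (\<integral>\<^sup>+\<xi>. ennreal (((1 + \<xi>) / 2) powr r / e) * ennreal (sqrt ((1 + \<xi>) / 2) ^ (2 * j)) \<partial>sym_measure m)"
      unfolding L_def by (subst nn_integral_density) auto
    also have "\<dots> = (\<integral>\<^sup>+\<xi>. ennreal (1 / e) * ennreal (((1 + \<xi>) / 2) powr (r + real j)) \<partial>sym_measure m)"
    proof (intro nn_integral_cong_AE)
      have "AE \<xi> in sym_measure m. \<xi> \<noteq> -1" using assms(1) by (rule AE_sym_measure_not_eq)
      moreover have "AE \<xi> in sym_measure m. \<bar>\<xi>\<bar> \<le> 1"
        using assms by (intro AE_sym_measure) auto
      ultimately show "AE \<xi> in sym_measure m. ennreal (((1 + \<xi>) / 2) powr r / e) * ennreal (sqrt ((1 + \<xi>) / 2) ^ (2 * j))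
        = ennreal (1 / e) * ennreal (((1 + \<xi>) / 2) powr (r + real j))"
      proof eventually_elim
        case (elim \<xi>)
        then have "0 < (1 + \<xi>) / 2" by auto
        then have "sqrt ((1 + \<xi>) / 2) ^ (2 * j) = ((1 + \<xi>) / 2) powr real j"
          by (simp add: power_mult powr_realpow)
        with e show ?case by (simp add: powr_add flip: ennreal_mult)
      qed
    qed
    also have "\<dots> = ennreal (1 / e) * ennreal (Beta (m + (r + real j)) m / Beta m m)"
      using assms by (subst nn_integral_cmult) (auto simp: sym_measure_half_moment)
    also have "\<dots> = ennreal (Beta (m + r + real j) m / Beta (m + r) m)"
      using assms e by (subst ennreal_mult[symmetric])
        (auto simp: e_def Beta_pos_real less_imp_le add_ac less_imp_neq[symmetric])
    also have "Beta (m + r + real j) m / Beta (m + r) m = pochhammer (m + r) j / pochhammer (2 * m + r) j"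
      using Beta_shift_ratio[of "m + r" m j 0] assms by (simp add: algebra_simps)
    finally show ?thesis
      using assms by (subst integral_eq_nn_integral)
        (auto simp: pochhammer_nonneg zero_le_even_power)
  qed
  have "(\<integral>\<^sup>+x. F (sqrt ((1 + fst x) / 2) * snd x) \<partial>(L \<Otimes>\<^sub>M S)) = (\<integral>\<^sup>+a. F a \<partial>sym_measure (2 * m + r - 1/2))"
  proof (rule nn_integral_eq_if_moments_eq)
    show "prob_space (L \<Otimes>\<^sub>M S)" by (rule prob_space_pair[OF pL pS])
    show "AE x in L \<Otimes>\<^sub>M S. \<bar>sqrt ((1 + fst x) / 2) * snd x\<bar> \<le> 1"
    proof (rule P.AE_pair_measure)
      show "AE x in L. AE y in S. \<bar>sqrt ((1 + fst (x, y)) / 2) * snd (x, y)\<bar> \<le> 1"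
        using AEL
      proof eventually_elim
        case (elim \<xi>)
        show ?case using AES
          by eventually_elim (use elim in \<open>auto simp: abs_mult intro!: mult_le_one\<close>)
      qed
    qed measurable
    show "prob_space (sym_measure (2 * m + r - 1/2))" "AE x in sym_measure (2 * m + r - 1/2). \<bar>x\<bar> \<le> 1"
      using assms by (auto intro!: prob_space_sym_measure AE_sym_measure)
    show "(LINT x|(L \<Otimes>\<^sub>M S). (sqrt ((1 + fst x) / 2) * snd x) ^ n) = (LINT x|sym_measure (2 * m + r - 1/2). x ^ n)" for n
    proof -
      have "(LINT x|(L \<Otimes>\<^sub>M S). (sqrt ((1 + fst x) / 2) * snd x) ^ n) =
         (LINT x|(L \<Otimes>\<^sub>M S). sqrt ((1 + fst x) / 2) ^ n * snd x ^ n)"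
        by (simp add: power_mult_distrib)
      also have "\<dots> = (LINT \<xi>|L. sqrt ((1 + \<xi>) / 2) ^ n) * (LINT a|S. a ^ n)"
        using AEL AES by (intro integral_pair_mult pS pL S.integrable_bounded_power L.integrable_bounded_power) auto
      also have "\<dots> = (LINT x|sym_measure (2 * m + r - 1/2). x ^ n)"
      proof (cases "even n")
        case True
        have "pochhammer (m + r) (n div 2) \<noteq> 0"
          using assms by (intro pochhammer_pos less_imp_neq[symmetric]) auto
        with True momL[of "n div 2"] assms show ?thesis
          unfolding S_def by (simp add: sym_measure_moment)
      next
        case False
        with assms show ?thesis unfolding S_def by (simp add: sym_measure_moment)
      qed
      finally show ?thesis .
    qed
  qed auto
  also have "(\<integral>\<^sup>+x. F (sqrt ((1 + fst x) / 2) * snd x) \<partial>(L \<Otimes>\<^sub>M S))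
      = (\<integral>\<^sup>+\<xi>. \<integral>\<^sup>+a. F (sqrt ((1 + \<xi>) / 2) * a) \<partial>S \<partial>L)"
    by (subst nn_integral_pair_prob[OF pL pS]) auto
  also have "\<dots> = (\<integral>\<^sup>+\<xi>. ennreal (((1 + \<xi>) / 2) powr r / e) * (\<integral>\<^sup>+a. F (sqrt ((1 + \<xi>) / 2) * a) \<partial>S) \<partial>sym_measure m)"
    unfolding L_def by (subst nn_integral_density) auto
  finally have "ennreal e * (\<integral>\<^sup>+a. F a \<partial>sym_measure (2 * m + r - 1/2)) =
      ennreal e * (\<integral>\<^sup>+\<xi>. ennreal (((1 + \<xi>) / 2) powr r / e) * (\<integral>\<^sup>+a. F (sqrt ((1 + \<xi>) / 2) * a) \<partial>S) \<partial>sym_measure m)"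
    by simp
  also have "\<dots> = (\<integral>\<^sup>+\<xi>. ennreal (((1 + \<xi>) / 2) powr r) * (\<integral>\<^sup>+a. F (sqrt ((1 + \<xi>) / 2) * a) \<partial>S) \<partial>sym_measure m)"
    using e by (subst nn_integral_cmult[symmetric]) (auto simp: mult.assoc[symmetric] simp flip: ennreal_mult)
  finally show ?thesis by (simp add: e_def S_def)
qed

text \<open>Since (1/2)_j = (2j)! / (4^j j!), the factorials of even numbers cancel. The even part
  of a binomial expansion of degree 2n thereby becomes a full expansion of degree n.\<close>

lemma binomial_pochhammer_half:
  assumes "i \<le> n"
  shows "real ((2 * n) choose (2 * i)) * (pochhammer (1/2) i * pochhammer (1/2) (n - i))
    = real (n choose i) * pochhammer (1/2) n"
proof -
  have ph: "pochhammer (1/2) j = fact (2 * j) / (4 ^ j * fact j :: real)" for j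
  proof -
    have "(4::real) ^ j = 2 ^ (2 * j)" by (simp add: power_mult)
    then show ?thesis using fact_double[of j, where 'a = real] by simp
  qed
  have "2 * n - 2 * i = 2 * (n - i)" by simp
  moreover have "(4::real) ^ n = 4 ^ i * 4 ^ (n - i)" using assms by (simp flip: power_add)
  ultimately show ?thesis
    using assms by (simp add: ph binomial_fact field_simps)
qed

lemma sum_atMost_double_even:
  fixes f :: "nat \<Rightarrow> 'a::comm_monoid_add"
  assumes "\<And>j. odd j \<Longrightarrow> f j = 0"
  shows "(\<Sum>j\<le>2 * n. f j) = (\<Sum>i\<le>n. f (2 * i))"
  by (induction n) (auto simp: assms)

text \<open>Cauchy-Schwarz for the unit vectors (w, sqrt(1 - w^2)) and (c, sqrt(1 - c^2)).\<close>

lemma abs_cone_product_le: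
  fixes w u v c :: real
  assumes "\<bar>w\<bar> \<le> 1" "\<bar>u\<bar> \<le> 1" "\<bar>v\<bar> \<le> 1" "\<bar>c\<bar> \<le> 1"
  shows "\<bar>w * c * u + sqrt (1 - w\<^sup>2) * sqrt (1 - c\<^sup>2) * v\<bar> \<le> 1"
proof -
  have w2: "w\<^sup>2 \<le> 1" and c2: "c\<^sup>2 \<le> 1" using assms by (auto simp: abs_square_le_1)
  have "\<bar>w * c * u + sqrt (1 - w\<^sup>2) * sqrt (1 - c\<^sup>2) * v\<bar> \<le> \<bar>w\<bar> * \<bar>c\<bar> * \<bar>u\<bar> + sqrt (1 - w\<^sup>2) * sqrt (1 - c\<^sup>2) * \<bar>v\<bar>"
    using w2 c2 by (intro order.trans[OF abs_triangle_ineq]) (simp add: abs_mult)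
  also have "\<dots> \<le> \<bar>w\<bar> * \<bar>c\<bar> + sqrt (1 - w\<^sup>2) * sqrt (1 - c\<^sup>2)"
    using assms w2 c2 by (intro add_mono mult_left_le) auto
  also have "\<dots> \<le> (w\<^sup>2 + c\<^sup>2) / 2 + ((1 - w\<^sup>2) + (1 - c\<^sup>2)) / 2"
  proof (intro add_mono)
    show "\<bar>w\<bar> * \<bar>c\<bar> \<le> (w\<^sup>2 + c\<^sup>2) / 2"
      using sum_squares_bound[of "\<bar>w\<bar>" "\<bar>c\<bar>"] by simp
    show "sqrt (1 - w\<^sup>2) * sqrt (1 - c\<^sup>2) \<le> ((1 - w\<^sup>2) + (1 - c\<^sup>2)) / 2"
      using sum_squares_bound[of "sqrt (1 - w\<^sup>2)" "sqrt (1 - c\<^sup>2)"] w2 c2 by simp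
  qed
  also have "\<dots> = 1" by (simp add: field_simps)
  finally show ?thesis .
qed

text \<open>In the expansion of an even power, the factorials in k + 1/2 and m + 1/2 from the mixed
  moments of w cancel against the denominators of the moments of u and v. By
  \<open>binomial_pochhammer_half\<close> the rest sums to (1/2)_N / (k+m+1)_N times (c^2 + (1 -
  c^2))^N, so c disappears.\<close>

lemma cone_product_law:
  fixes k m c :: real
  assumes k: "0 \<le> k" and m: "0 \<le> m" and c: "\<bar>c\<bar> \<le> 1" and [measurable]: "F \<in> borel_measurable borel"
  shows "(\<integral>\<^sup>+w. \<integral>\<^sup>+u. \<integral>\<^sup>+v. F (w * c * u + sqrt (1 - w\<^sup>2) * sqrt (1 - c\<^sup>2) * v)
      \<partial>sym_measure m \<partial>refl_measure k \<partial>eta k m) = (\<integral>\<^sup>+\<xi>. F \<xi> \<partial>sym_measure (k + m + 1/2))"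
proof -
  define E R S where "E = eta k m" and "R = refl_measure k" and "S = sym_measure m"
  have [measurable_cong, simp]: "sets E = sets borel" "sets R = sets borel" "sets S = sets borel"
    by (auto simp: E_def R_def S_def)
  have pE: "prob_space E" and pR: "prob_space R" and pS: "prob_space S"
    using k m by (auto simp: E_def R_def S_def prob_space_eta prob_space_refl_measure prob_space_sym_measure)
  have AEE: "AE w in E. \<bar>w\<bar> \<le> 1" and AER: "AE u in R. \<bar>u\<bar> \<le> 1" and AES: "AE v in S. \<bar>v\<bar> \<le> 1"
    unfolding E_def R_def S_def using k m by (simp_all add: AE_eta AE_refl_measure AE_sym_measure)
  interpret E: prob_space E by fact
  interpret R: prob_space R by fact
  interpret S: prob_space S by fact
  interpret RS: pair_prob_space R S ..
  have pRS: "prob_space (R \<Otimes>\<^sub>M S)" by (rule prob_space_pair[OF pR pS])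
  interpret RS': prob_space "R \<Otimes>\<^sub>M S" by fact
  interpret ERS: pair_prob_space E "R \<Otimes>\<^sub>M S" ..
  define X where "X x = fst x * c * fst (snd x) + sqrt (1 - (fst x)\<^sup>2) * sqrt (1 - c\<^sup>2) * snd (snd x)"
    for x :: "real \<times> real \<times> real"
  have [measurable]: "X \<in> borel_measurable (E \<Otimes>\<^sub>M (R \<Otimes>\<^sub>M S))"
    unfolding X_def by measurable
  have X_le: "\<bar>X (w, u, v)\<bar> \<le> 1" if "\<bar>w\<bar> \<le> 1" "\<bar>u\<bar> \<le> 1" "\<bar>v\<bar> \<le> 1" for w u v
    using abs_cone_product_le[OF that c] by (simp add: X_def)
  define T where "T n j = real (n choose j) * c ^ j * sqrt (1 - c\<^sup>2) ^ (n - j) *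
     ((LINT w|E. w ^ j * sqrt (1 - w\<^sup>2) ^ (n - j)) * ((LINT u|R. u ^ j) * (LINT v|S. v ^ (n - j))))" for n j
  have mom: "(LINT x|(E \<Otimes>\<^sub>M (R \<Otimes>\<^sub>M S)). X x ^ n) = (\<Sum>j\<le>n. T n j)" for n
  proof -
    define g where "g j x = real (n choose j) * c ^ j * sqrt (1 - c\<^sup>2) ^ (n - j) *
      ((fst x ^ j * sqrt (1 - (fst x)\<^sup>2) ^ (n - j)) * (\<lambda>y. fst y ^ j * snd y ^ (n - j)) (snd x))"
      for j and x :: "real \<times> real \<times> real"
    have i1: "integrable E (\<lambda>w. w ^ j * sqrt (1 - w\<^sup>2) ^ (n - j))" for j
      using AEE by (intro E.integrable_const_bound[of _ 1])
        (auto simp: abs_mult power_abs abs_square_le_1 intro!: mult_le_one power_le_one)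
    have i2: "integrable (R \<Otimes>\<^sub>M S) (\<lambda>y. fst y ^ j * snd y ^ (n - j))"
       and e2: "(LINT y|(R \<Otimes>\<^sub>M S). fst y ^ j * snd y ^ (n - j)) = (LINT u|R. u ^ j) * (LINT v|S. v ^ (n - j))" for j
      using AER AES by (auto intro!: integral_pair_mult[OF pR pS] R.integrable_bounded_power S.integrable_bounded_power)
    have "X x ^ n = (\<Sum>j\<le>n. g j x)" for x
      unfolding X_def binomial_ring g_def by (intro sum.cong) (auto simp: power_mult_distrib)
    then have "(LINT x|(E \<Otimes>\<^sub>M (R \<Otimes>\<^sub>M S)). X x ^ n) = (LINT x|(E \<Otimes>\<^sub>M (R \<Otimes>\<^sub>M S)). (\<Sum>j\<le>n. g j x))" by simp
    also have "\<dots> = (\<Sum>j\<le>n. LINT x|(E \<Otimes>\<^sub>M (R \<Otimes>\<^sub>M S)). g j x)"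
      unfolding g_def using integral_pair_mult(1)[OF pE pRS i1 i2]
      by (intro Bochner_Integration.integral_sum) auto
    also have "\<dots> = (\<Sum>j\<le>n. T n j)"
      unfolding g_def T_def using integral_pair_mult(2)[OF pE pRS i1 i2] e2
      by (intro sum.cong) auto
    finally show ?thesis .
  qed
  have "(\<integral>\<^sup>+x. F (X x) \<partial>(E \<Otimes>\<^sub>M (R \<Otimes>\<^sub>M S))) = (\<integral>\<^sup>+\<xi>. F \<xi> \<partial>sym_measure (k + m + 1/2))"
  proof (rule nn_integral_eq_if_moments_eq)
    show "prob_space (E \<Otimes>\<^sub>M (R \<Otimes>\<^sub>M S))" by (rule prob_space_pair[OF pE pRS])
    have AERS: "AE y in R \<Otimes>\<^sub>M S. \<bar>fst y\<bar> \<le> 1 \<and> \<bar>snd y\<bar> \<le> 1"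
    proof (rule RS.AE_pair_measure)
      show "AE u in R. AE v in S. \<bar>fst (u, v)\<bar> \<le> 1 \<and> \<bar>snd (u, v)\<bar> \<le> 1"
        using AER by eventually_elim (use AES in auto)
    qed measurable
    show "AE x in E \<Otimes>\<^sub>M (R \<Otimes>\<^sub>M S). \<bar>X x\<bar> \<le> 1"
    proof (rule ERS.AE_pair_measure)
      show "AE w in E. AE y in R \<Otimes>\<^sub>M S. \<bar>X (w, y)\<bar> \<le> 1"
        using AEE
      proof eventually_elim
        case (elim w)
        show ?case using AERS by eventually_elim (use elim X_le in \<open>auto simp: split_beta\<close>)
      qed
    qed measurable
    show "prob_space (sym_measure (k + m + 1/2))" "AE x in sym_measure (k + m + 1/2). \<bar>x\<bar> \<le> 1"
      using k m by (auto intro!: prob_space_sym_measure AE_sym_measure)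
    show "(LINT x|(E \<Otimes>\<^sub>M (R \<Otimes>\<^sub>M S)). X x ^ n) = (LINT x|sym_measure (k + m + 1/2). x ^ n)" for n
    proof (cases "even n")
      case True
      then obtain N where n: "n = 2 * N" by (elim evenE)
      \<comment> \<open>Here the symmetry of v is decisive: odd moments of u are nonzero.\<close>
      have T0: "T n j = 0" if "odd j" for j
      proof (cases "j \<le> n")
        case True
        with that n have "odd (n - j)" by simp
        with m show ?thesis by (simp add: T_def S_def sym_measure_moment)
      qed (simp add: T_def)
      have T1: "T n (2 * i) = pochhammer (1/2) N / pochhammer (k + m + 1) N * (real (N choose i) * (c\<^sup>2) ^ i * (1 - c\<^sup>2) ^ (N - i))"
        if "i \<le> N" for i
      proof -
        have d: "n - 2 * i = 2 * (N - i)" using n by simp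
        have c2: "c\<^sup>2 \<le> 1" using c by (simp add: abs_square_le_1)
        have "(LINT w|E. w ^ (2 * i) * sqrt (1 - w\<^sup>2) ^ (2 * (N - i))) = (LINT w|E. w ^ (2 * i) * (1 - w\<^sup>2) ^ (N - i))"
          using AEE by (intro integral_cong_AE)
            (auto elim!: eventually_mono simp: power_mult abs_square_le_1)
        also have "\<dots> = pochhammer (k + 1/2) i * pochhammer (m + 1/2) (N - i) / pochhammer (k + m + 1) N"
          using eta_moment_even[OF k m, of i "N - i"] that by (simp add: E_def)
        finally have e1: "(LINT w|E. w ^ (2 * i) * sqrt (1 - w\<^sup>2) ^ (2 * (N - i))) = \<dots>" .
        have nz: "pochhammer (k + 1/2) i \<noteq> 0" "pochhammer (m + 1/2) (N - i) \<noteq> 0" "pochhammer (k + m + 1) N \<noteq> 0"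
          using k m by (auto intro!: pochhammer_pos less_imp_neq[symmetric])
        have sq: "sqrt (1 - c\<^sup>2) ^ (2 * (N - i)) = (1 - c\<^sup>2) ^ (N - i)"
          using c2 by (simp add: power_mult)
        have cp: "c ^ (2 * i) = (c\<^sup>2) ^ i" by (simp add: power_mult)
        have mR: "(LINT u|R. u ^ (2 * i)) = pochhammer (1/2) i / pochhammer (k + 1/2) i"
          unfolding R_def using k by (subst refl_measure_even_moment) auto
        have mS: "(LINT v|S. v ^ (2 * (N - i))) = pochhammer (1/2) (N - i) / pochhammer (m + 1/2) (N - i)"
          unfolding S_def using m by (subst sym_measure_moment) auto
        have "T n (2 * i) = (real ((2 * N) choose (2 * i)) * (pochhammer (1/2) i * pochhammer (1/2) (N - i)))
            / pochhammer (k + m + 1) N * ((c\<^sup>2) ^ i * (1 - c\<^sup>2) ^ (N - i))"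
          unfolding T_def d e1 sq mR mS cp using nz by (simp add: n)
        then show ?thesis
          unfolding binomial_pochhammer_half[OF that] by simp
      qed
      have "(\<Sum>j\<le>n. T n j) = (\<Sum>i\<le>N. T n (2 * i))"
        unfolding n using T0[unfolded n] by (rule sum_atMost_double_even)
      also have "\<dots> = pochhammer (1/2) N / pochhammer (k + m + 1) N * (\<Sum>i\<le>N. real (N choose i) * (c\<^sup>2) ^ i * (1 - c\<^sup>2) ^ (N - i))"
        by (simp add: T1 sum_distrib_left)
      also have "(\<Sum>i\<le>N. real (N choose i) * (c\<^sup>2) ^ i * (1 - c\<^sup>2) ^ (N - i)) = (c\<^sup>2 + (1 - c\<^sup>2)) ^ N"
        by (rule binomial_ring[symmetric])
      finally show ?thesis
        using k m unfolding mom by (subst sym_measure_moment) (auto simp: n add_ac)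
    next
      case False
      have "T n j = 0" if "j \<le> n" for j
      proof (cases "even j")
        case True
        with that False have "odd (n - j)" by simp
        with m show ?thesis by (simp add: T_def S_def sym_measure_moment)
      next
        case odd: False
        \<comment> \<open>With n and j odd, n - j is even and the moments of u and v are both
          nonzero; only the odd power of w makes the term vanish.\<close>
        have "(LINT w|E. w ^ j * sqrt (1 - w\<^sup>2) ^ (n - j)) = 0"
          unfolding E_def using odd by (intro eta_odd k m) auto
        then show ?thesis by (simp add: T_def)
      qed
      then have "(\<Sum>j\<le>n. T n j) = 0" by simp
      with False k m show ?thesis unfolding mom by (subst sym_measure_moment) auto
    qed
  qed auto
  also have "(\<integral>\<^sup>+x. F (X x) \<partial>(E \<Otimes>\<^sub>M (R \<Otimes>\<^sub>M S))) = (\<integral>\<^sup>+w. \<integral>\<^sup>+y. F (X (w, y)) \<partial>(R \<Otimes>\<^sub>M S) \<partial>E)"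
    by (rule nn_integral_pair_prob[OF pE pRS]) measurable
  also have "\<dots> = (\<integral>\<^sup>+w. \<integral>\<^sup>+u. \<integral>\<^sup>+v. F (X (w, u, v)) \<partial>S \<partial>R \<partial>E)"
    by (intro nn_integral_cong nn_integral_pair_prob[OF pR pS]) measurable
  finally show ?thesis unfolding X_def E_def R_def S_def by simp
qed

subsection \<open>Laguerre translations\<close>

text \<open>
  The map \<open>(t, a) \<mapsto> (X, w) = (a \<surd>t, t - X\<^sup>2)\<close> turns the generalized translation by \<open>s\<close>
  into the shift of \<open>X\<close> by \<open>\<surd>s\<close>, which preserves the measure \<open>w\<^bsup>b - 1/2\<^esup> dX dw\<close>.
\<close>

lemma Laguerre_translation_invariant:
  fixes G :: "real \<Rightarrow> ennreal"
  assumes b: "0 \<le> b" and s: "0 \<le> s" and [measurable]: "G \<in> borel_measurable borel"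
  shows "(\<integral>\<^sup>+t. ennreal (indicator {0<..} t * t powr b) *
      (\<integral>\<^sup>+a. G (t + s + 2 * (sqrt (t * s) * a)) \<partial>sym_measure (b + 1/2)) \<partial>lborel)
    = (\<integral>\<^sup>+r. ennreal (indicator {0<..} r * r powr b) * G r \<partial>lborel)"
proof -
  define A where "A = Beta (1/2) (b + 1/2)"
  have A: "A > 0" using b by (simp add: A_def Beta_pos_real)
  define K where "K s = (\<integral>\<^sup>+t. ennreal (indicator {0<..} t * t powr b) *
      (\<integral>\<^sup>+a. G (t + s + 2 * (sqrt (t * s) * a)) \<partial>sym_measure (b + 1/2)) \<partial>lborel)" for s
  define w0 where "w0 w = ennreal (indicator {0<..} w * w powr (b - 1/2) / A)" for w
  have [measurable]: "w0 \<in> borel_measurable borel" unfolding w0_def by measurable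
  \<comment> \<open>The right side is free of s, which reduces the claim to s = 0.\<close>
  have *: "K s = (\<integral>\<^sup>+X. \<integral>\<^sup>+w. G (w + X\<^sup>2) * w0 w \<partial>lborel \<partial>lborel)" if s: "0 \<le> s" for s
  proof -
    have "ennreal (indicator {0<..} t * t powr b) * (\<integral>\<^sup>+a. G (t + s + 2 * (sqrt (t * s) * a)) \<partial>sym_measure (b + 1/2))
      = (\<integral>\<^sup>+X. G (t + s + 2 * (sqrt s * X)) * w0 (t - X\<^sup>2) \<partial>lborel)" for t
    proof (cases "t > 0")
      case True
      have "(\<integral>\<^sup>+X. G (t + s + 2 * (sqrt s * X)) * w0 (t - X\<^sup>2) \<partial>lborel)
        = ennreal (sqrt t) * (\<integral>\<^sup>+a. G (t + s + 2 * (sqrt s * (sqrt t * a))) * w0 (t - (sqrt t * a)\<^sup>2) \<partial>lborel)"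
        using True by (subst nn_integral_real_affine[where c = "sqrt t" and t = 0]) auto
      also have "\<dots> = (\<integral>\<^sup>+a. ennreal (sqrt t) * (G (t + s + 2 * (sqrt s * (sqrt t * a))) * w0 (t - (sqrt t * a)\<^sup>2)) \<partial>lborel)"
        by (rule nn_integral_cmult[symmetric]) measurable
      also have "\<dots> = (\<integral>\<^sup>+a. ennreal (t powr b) *
          (ennreal (indicator {-1..1} a * (1 - a\<^sup>2) powr (b + 1/2 - 1) / A) * G (t + s + 2 * (sqrt (t * s) * a))) \<partial>lborel)"
      proof (rule nn_integral_cong_AE)
        show "AE a in lborel. ennreal (sqrt t) * (G (t + s + 2 * (sqrt s * (sqrt t * a))) * w0 (t - (sqrt t * a)\<^sup>2))
          = ennreal (t powr b) *
          (ennreal (indicator {-1..1} a * (1 - a\<^sup>2) powr (b + 1/2 - 1) / A) * G (t + s + 2 * (sqrt (t * s) * a)))"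
          using AE_lborel_singleton[of "1::real"] AE_lborel_singleton[of "-1::real"]
        proof eventually_elim
          case (elim a)
          have eq: "t - (sqrt t * a)\<^sup>2 = t * (1 - a\<^sup>2)" using True by (simp add: power_mult_distrib algebra_simps)
          have arg: "t + s + 2 * (sqrt s * (sqrt t * a)) = t + s + 2 * (sqrt (t * s) * a)"
            by (simp add: real_sqrt_mult mult_ac)
          have "ennreal (sqrt t) * w0 (t * (1 - a\<^sup>2)) =
            ennreal (t powr b) * ennreal (indicator {-1..1} a * (1 - a\<^sup>2) powr (b + 1/2 - 1) / A)"
          proof (cases "\<bar>a\<bar> < 1")
            case a: True
            then have "1 - a\<^sup>2 > 0" by (simp add: abs_square_less_1)
            moreover have "sqrt t * t powr (b - 1/2) = t powr b"
              using True by (simp add: powr_half_sqrt[symmetric] powr_add[symmetric])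
            moreover have "a \<in> {-1..1}" using a by auto
            ultimately show ?thesis using True A
              by (simp add: w0_def powr_mult ennreal_mult[symmetric] mult_ac)
          next
            case a: False
            then have "t * (1 - a\<^sup>2) \<le> 0"
              using abs_square_less_1[of a] True by (intro mult_nonneg_nonpos) auto
            then have "w0 (t * (1 - a\<^sup>2)) = 0" by (simp add: w0_def indicator_def)
            moreover have "a \<notin> {-1..1}" using a elim by auto
            ultimately show ?thesis by simp
          qed
          then show ?case unfolding eq arg
            by (subst mult.commute[of "G _"], simp only: mult.assoc[symmetric])
        qed
      qed
      also have "\<dots> = ennreal (t powr b) * (\<integral>\<^sup>+a. 
          ennreal (indicator {-1..1} a * (1 - a\<^sup>2) powr (b + 1/2 - 1) / A) * G (t + s + 2 * (sqrt (t * s) * a)) \<partial>lborel)"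
        by (rule nn_integral_cmult) measurable
      also have "(\<integral>\<^sup>+a. 
          ennreal (indicator {-1..1} a * (1 - a\<^sup>2) powr (b + 1/2 - 1) / A) * G (t + s + 2 * (sqrt (t * s) * a)) \<partial>lborel)
        = (\<integral>\<^sup>+a. G (t + s + 2 * (sqrt (t * s) * a)) \<partial>sym_measure (b + 1/2))"
        using b unfolding A_def by (subst sym_measure_pos, simp, subst nn_integral_density) auto
      finally show ?thesis using True by simp
    next
      case False
      have "w0 (t - X\<^sup>2) = 0" for X
      proof -
        have "\<not> X\<^sup>2 < t" using zero_le_power2[of X] False by linarith
        then show ?thesis by (simp add: w0_def indicator_def)
      qed
      with False show ?thesis by simp
    qed
    then have "K s = (\<integral>\<^sup>+t. \<integral>\<^sup>+X. G (t + s + 2 * (sqrt s * X)) * w0 (t - X\<^sup>2) \<partial>lborel \<partial>lborel)"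
      unfolding K_def by simp
    also have "\<dots> = (\<integral>\<^sup>+X. \<integral>\<^sup>+t. G (t + s + 2 * (sqrt s * X)) * w0 (t - X\<^sup>2) \<partial>lborel \<partial>lborel)"
      by (rule lborel_pair.Fubini'[symmetric]) measurable
    \<comment> \<open>Writing t = w + X^2 completes the square in the argument of G; s survives only
      as a shift of X and is removed next.\<close>
    also have "\<dots> = (\<integral>\<^sup>+X. \<integral>\<^sup>+w. G (w + (sqrt s + X)\<^sup>2) * w0 w \<partial>lborel \<partial>lborel)"
    proof (rule nn_integral_cong)
      fix X :: real
      have eq: "X\<^sup>2 + w + s + 2 * (sqrt s * X) = w + (sqrt s + X)\<^sup>2" for w
        using s by (simp add: power2_sum)
      show "(\<integral>\<^sup>+t. G (t + s + 2 * (sqrt s * X)) * w0 (t - X\<^sup>2) \<partial>lborel)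
        = (\<integral>\<^sup>+w. G (w + (sqrt s + X)\<^sup>2) * w0 w \<partial>lborel)"
        by (subst nn_integral_real_affine[where c = 1 and t = "X\<^sup>2"]) (simp_all add: eq)
    qed
    also have "\<dots> = (\<integral>\<^sup>+X. \<integral>\<^sup>+w. G (w + X\<^sup>2) * w0 w \<partial>lborel \<partial>lborel)"
      by (subst (2) nn_integral_real_affine[where c = 1 and t = "sqrt s"]) auto
    finally show ?thesis .
  qed
  \<comment> \<open>At s = 0 the argument of G no longer depends on a, and the inner integral is G t
    times the total mass 1.\<close>
  have "prob_space (sym_measure (b + 1/2))" using b by (intro prob_space_sym_measure) auto
  then have "K 0 = (\<integral>\<^sup>+r. ennreal (indicator {0<..} r * r powr b) * G r \<partial>lborel)"
    using prob_space.emeasure_space_1[of "sym_measure (b + 1/2)"] by (simp add: K_def)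
  moreover have "K s = K 0" using * s by simp
  ultimately show ?thesis unfolding K_def by simp
qed

subsection \<open>A bound for Bessel functions\<close>

text \<open>The first absolute moment is the coefficient of z in the estimate of Poisson's
  integral.\<close>

lemma sym_measure_abs_moment:
  assumes "0 < m"
  shows "integrable (sym_measure m) (\<lambda>x. \<bar>x\<bar>)" "(LINT x|sym_measure m. \<bar>x\<bar>) = Beta 1 m / Beta (1/2) m"
proof -
  have "(\<integral>\<^sup>+x. ennreal \<bar>x\<bar> \<partial>sym_measure m) =
      (\<integral>\<^sup>+x. ennreal (indicator {-1..1} x * (1 - x\<^sup>2) powr (m - 1) / Beta (1/2) m) * ennreal \<bar>x\<bar> \<partial>lborel)"
    unfolding sym_measure_pos[OF assms] by (subst nn_integral_density) auto
  also have "\<dots> = (\<integral>\<^sup>+x. ennreal (1 / Beta (1/2) m) *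
      ennreal (indicator {-1..1} x * (\<bar>x\<bar> powr (2 * 1 - 1) * (1 - x\<^sup>2) powr (m - 1))) \<partial>lborel)"
    using assms by (intro nn_integral_cong) (simp add: ennreal_mult[symmetric] Beta_pos_real less_imp_le indicator_def)
  also have "\<dots> = ennreal (1 / Beta (1/2) m) * ennreal (Beta 1 m)"
    using assms by (subst nn_integral_cmult, simp, subst nn_integral_Beta_symmetric) auto
  also have "\<dots> = ennreal (Beta 1 m / Beta (1/2) m)"
    using assms by (simp add: ennreal_mult[symmetric] Beta_pos_real less_imp_le)
  finally have *: "(\<integral>\<^sup>+x. ennreal \<bar>x\<bar> \<partial>sym_measure m) = ennreal (Beta 1 m / Beta (1/2) m)" .
  show "integrable (sym_measure m) (\<lambda>x. \<bar>x\<bar>)"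
    using * by (intro integrableI_bounded) auto
  show "(LINT x|sym_measure m. \<bar>x\<bar>) = Beta 1 m / Beta (1/2) m"
    using * assms by (subst integral_eq_nn_integral) (auto simp: Beta_pos_real less_imp_le)
qed

text \<open>The summand of z^(-\<nu>) J(z) for order \<nu>, with natural powers of z in place of
  \<open>powr\<close>. At the order -1 the pole of Gamma appears as a zero of
  \<open>rGamma\<close>.\<close>

definition bessel_j_term :: "real \<Rightarrow> real \<Rightarrow> nat \<Rightarrow> real" where
  "bessel_j_term \<nu> z k = (-1) ^ k * rGamma (real k + \<nu> + 1) / (fact k * 2 powr (2 * real k + \<nu>)) * z ^ (2 * k)"

lemma bessel_j_eqI:
  assumes z: "0 < z" and "bessel_j_term \<nu> z sums L"
  shows "bessel_j \<nu> z = L"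
proof -
  have "(\<lambda>k. z powr \<nu> * bessel_j_term \<nu> z k) sums (z powr \<nu> * L)"
    using assms(2) by (rule sums_mult)
  also have "(\<lambda>k. z powr \<nu> * bessel_j_term \<nu> z k)
      = (\<lambda>k. (-1) ^ k * rGamma (real k + \<nu> + 1) / fact k * (z / 2) powr (2 * real k + \<nu>))"
  proof
    fix k
    have "z powr (2 * real k + \<nu>) = z ^ (2 * k) * z powr \<nu>"
      using z powr_realpow[of z "2 * k"] by (simp add: powr_add)
    then show "z powr \<nu> * bessel_j_term \<nu> z k
        = (-1) ^ k * rGamma (real k + \<nu> + 1) / fact k * (z / 2) powr (2 * real k + \<nu>)"
      using z by (simp add: bessel_j_term_def powr_divide)
  qed
  finally have "bessel_J \<nu> z = z powr \<nu> * L"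
    unfolding bessel_J_def by (rule sums_unique[symmetric])
  then show ?thesis using z by (simp add: bessel_j_def powr_minus field_simps)
qed

text \<open>
  Poisson's integral for \<open>j\<^sub>a\<close>, rewritten with \<open>j\<^bsub>a-1\<^esub>(z) = 2 a j\<^sub>a(z) + z j\<^sub>a'(z)\<close>, which extends it
  to orders down to \<open>-1\<close>.
\<close>

lemma bessel_j_Poisson_sums:
  assumes a: "0 \<le> a"
  shows "bessel_j_term (a - 1) z sums
    (rGamma (a + 1) / 2 powr a * (LINT x|sym_measure (a + 1/2). 2 * a * cos (z * x) - z * x * sin (z * x)))"
proof -
  let ?S = "sym_measure (a + 1/2)"
  have p: "prob_space ?S" and ae: "AE x in ?S. \<bar>x\<bar> \<le> 1"
    using a by (auto intro!: prob_space_sym_measure AE_sym_measure)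
  interpret prob_space ?S by fact
  define E where "E n = (LINT x|?S. x ^ n)" for n
  have "summable (\<lambda>n. norm (cos_coeff n * z ^ n))"
    using summable_norm_cos[of z] by simp
  from sums_moments[OF p _ _ ae _ this, of "\<lambda>_. 1"]
  have "(\<lambda>n. E n * (cos_coeff n * z ^ n)) sums (LINT x|?S. (\<Sum>n. x ^ n * (cos_coeff n * z ^ n)))"
    by (simp add: E_def)
  moreover have "(\<Sum>n. x ^ n * (cos_coeff n * z ^ n)) = cos (z * x)" for x
    using cos_converges[of "z * x"] by (simp add: sums_iff power_mult_distrib mult_ac)
  ultimately have C: "(\<lambda>n. E n * (cos_coeff n * z ^ n)) sums (LINT x|?S. cos (z * x))"
    by (simp only:)
  have "summable (\<lambda>n. norm (sin_coeff n * z ^ n))"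
    using summable_norm_sin[of z] by simp
  from sums_moments[OF p _ _ ae ae this]
  have "(\<lambda>n. E (Suc n) * (sin_coeff n * z ^ n)) sums (LINT x|?S. (\<Sum>n. x * x ^ n * (sin_coeff n * z ^ n)))"
    by (simp add: E_def)
  moreover have "(\<Sum>n. x * x ^ n * (sin_coeff n * z ^ n)) = x * sin (z * x)" for x
  proof -
    have "(\<lambda>n. x * (sin_coeff n *\<^sub>R (z * x) ^ n)) sums (x * sin (z * x))"
      by (intro sums_mult sin_converges)
    then show ?thesis by (simp add: sums_iff power_mult_distrib mult_ac)
  qed
  ultimately have S: "(\<lambda>n. E (Suc n) * (sin_coeff n * z ^ n)) sums (LINT x|?S. x * sin (z * x))"
    by (simp only:)
  \<comment> \<open>This is z times the differentiated cosine series: (n+1) times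
    \<open>cos_coeff (Suc n)\<close> is minus \<open>sin_coeff n\<close>. The index shift that
    follows is free because the factor n kills the term n = 0.\<close>
  have "(\<lambda>n. - z * (E (Suc n) * (sin_coeff n * z ^ n))) = (\<lambda>n. E (Suc n) * (cos_coeff (Suc n) * real (Suc n) * z ^ Suc n))"
    by (auto simp: cos_coeff_Suc)
  with sums_mult[OF S, of "- z"]
  have "(\<lambda>n. E (Suc n) * (cos_coeff (Suc n) * real (Suc n) * z ^ Suc n)) sums (- z * (LINT x|?S. x * sin (z * x)))"
    by (simp only:)
  then have S': "(\<lambda>n. E n * (cos_coeff n * real n * z ^ n)) sums (- z * (LINT x|?S. x * sin (z * x)))"
    by (subst (asm) sums_Suc_iff) simp
  have i1: "integrable ?S (\<lambda>x. cos (z * x))"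
    by (intro integrable_const_bound[of _ 1]) auto
  have i2: "integrable ?S (\<lambda>x. x * sin (z * x))"
    using ae by (intro integrable_const_bound[of _ 1]) (auto simp: abs_mult intro!: mult_le_one)
  define L where "L = (LINT x|?S. 2 * a * cos (z * x) - z * x * sin (z * x))"
  have L: "L = 2 * a * (LINT x|?S. cos (z * x)) + - z * (LINT x|?S. x * sin (z * x))"
    unfolding L_def using i1 i2 by (simp add: mult.assoc)
  have "(\<lambda>n. E n * (cos_coeff n * (2 * a + real n) * z ^ n)) sums L"
    using sums_add[OF sums_mult[OF C, of "2 * a"] S'] unfolding L by (simp add: algebra_simps)
  then have "(\<lambda>j. E (2 * j) * (cos_coeff (2 * j) * (2 * a + real (2 * j)) * z ^ (2 * j))) sums L"
    by (subst sums_mono_reindex[of "\<lambda>j. 2 * j"]) (auto simp: strict_mono_def cos_coeff_def elim!: evenE)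
  from sums_mult[OF this, of "rGamma (a + 1) / 2 powr a"]
  show ?thesis unfolding L_def[symmetric]
  proof (rule sums_cong[THEN iffD1, rotated])
    fix j
    have ph: "pochhammer (1/2) j = fact (2 * j) / (2 ^ (2 * j) * fact j :: real)"
      using fact_double[of j, where 'a = real] by simp
    have E: "E (2 * j) = pochhammer (1/2) j / pochhammer (a + 1) j"
      unfolding E_def using a by (subst sym_measure_moment) (auto simp: add.commute)
    have nz: "pochhammer (a + 1) j \<noteq> 0" using a by (intro pochhammer_pos less_imp_neq[symmetric]) auto
    have r1: "rGamma (a + 1) = pochhammer (a + 1) j * rGamma (real j + a + 1)"
      by (subst pochhammer_rGamma) (simp add: add_ac)
    \<comment> \<open>The factor 2a + 2j lowers the order from a to a - 1. With
      \<open>rGamma\<close> this includes j = 0, a = 0, where both sides are 0.\<close>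
    have r2: "rGamma (real j + (a - 1) + 1) = (real j + a) * rGamma (real j + a + 1)"
      using rGamma_plus1[of "real j + a"] by simp
    have r3: "2 powr (2 * real j + (a - 1)) = 2 ^ (2 * j) * 2 powr a / 2"
      using powr_realpow[of 2 "2 * j"] by (simp add: powr_add powr_diff)
    have r4: "cos_coeff (2 * j) = (-1) ^ j / fact (2 * j)" by (simp add: cos_coeff_def)
    show "rGamma (a + 1) / 2 powr a * (E (2 * j) * (cos_coeff (2 * j) * (2 * a + real (2 * j)) * z ^ (2 * j)))
      = bessel_j_term (a - 1) z j"
      unfolding E ph bessel_j_term_def r1 r2 r3 r4 using nz by (simp add: field_simps)
  qed
qed

text \<open>Estimating cos and sin by 1 leaves 2a + z E|x|. The first part yields exactly the value
  of j at 0, which is 0 for a = 0.\<close>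

lemma bessel_j_Poisson_bound:
  assumes a: "0 \<le> a" and z: "0 \<le> z"
  shows "\<bar>rGamma (a + 1) / 2 powr a * (LINT x|sym_measure (a + 1/2). 2 * a * cos (z * x) - z * x * sin (z * x))\<bar>
    \<le> 2 powr (1 - a) * (rGamma a + z * rGamma (a + 1/2) / sqrt pi)"
proof -
  let ?S = "sym_measure (a + 1/2)"
  have p: "prob_space ?S" and ae: "AE x in ?S. \<bar>x\<bar> \<le> 1"
    using a by (auto intro!: prob_space_sym_measure AE_sym_measure)
  interpret prob_space ?S by fact
  have i: "integrable ?S (\<lambda>x. \<bar>x\<bar>)" and e: "(LINT x|?S. \<bar>x\<bar>) = Beta 1 (a + 1/2) / Beta (1/2) (a + 1/2)"
    using a by (auto intro!: sym_measure_abs_moment)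
  have G: "Gamma (a + 1) > 0" "Gamma (a + 1/2) > 0" using a by auto
  have "\<bar>LINT x|?S. 2 * a * cos (z * x) - z * x * sin (z * x)\<bar>
      \<le> (LINT x|?S. norm (2 * a * cos (z * x) - z * x * sin (z * x)))"
    using integral_norm_bound[of ?S "\<lambda>x. 2 * a * cos (z * x) - z * x * sin (z * x)"] by simp
  also have "\<dots> \<le> (LINT x|?S. 2 * a + z * \<bar>x\<bar>)"
  proof (rule integral_mono_AE')
    show "AE x in ?S. norm (2 * a * cos (z * x) - z * x * sin (z * x)) \<le> 2 * a + z * \<bar>x\<bar>"
    proof (rule AE_I2)
      fix x
      have "\<bar>2 * a * cos (z * x)\<bar> \<le> 2 * a" "\<bar>z * x * sin (z * x)\<bar> \<le> z * \<bar>x\<bar>"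
        using a z by (auto simp: abs_mult mult_left_le)
      then show "norm (2 * a * cos (z * x) - z * x * sin (z * x)) \<le> 2 * a + z * \<bar>x\<bar>"
        unfolding real_norm_def by linarith
    qed
  qed (use i a z in auto)
  also have "\<dots> = 2 * a + z * (Beta 1 (a + 1/2) / Beta (1/2) (a + 1/2))"
    using i prob_space by (simp add: e)
  also have "Beta 1 (a + 1/2) / Beta (1/2) (a + 1/2) = Gamma (a + 1) * rGamma (a + 1/2) / ((a + 1/2) * sqrt pi)"
  proof -
    have "Gamma (1 + (a + 1/2)) = (a + 1/2) * Gamma (a + 1/2)"
      using G Gamma_plus1[of "a + 1/2"] Gamma_eq_zero_iff[of "a + 1/2"] by (auto simp only: add.commute[of 1])
    moreover have "Gamma (1/2 + (a + 1/2)) = Gamma (a + 1)"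
      by (rule arg_cong[of _ _ Gamma]) simp
    ultimately show ?thesis using G(2) a
      unfolding Beta_def rGamma_inverse_Gamma Gamma_one_half_real Gamma_1
      by (simp only:) (simp add: divide_simps add_nonneg_eq_0_iff)
  qed
  \<comment> \<open>Uses 1 / (a + 1/2) <= 2, an equality for a = 0.\<close>
  also have "\<dots> \<le> 2 * (Gamma (a + 1) * rGamma (a + 1/2) / sqrt pi)"
  proof -
    have "Gamma (a + 1) * rGamma (a + 1/2) / sqrt pi / (a + 1/2) \<le> Gamma (a + 1) * rGamma (a + 1/2) / sqrt pi / (1/2)"
      using a G by (intro divide_left_mono) (auto simp: rGamma_inverse_Gamma)
    then show ?thesis by (simp add: mult.commute)
  qed
  finally have "\<bar>LINT x|?S. 2 * a * cos (z * x) - z * x * sin (z * x)\<bar>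
      \<le> 2 * a + z * (2 * (Gamma (a + 1) * rGamma (a + 1/2) / sqrt pi))"
    using z by (auto elim: order.trans intro: mult_left_mono)
  then have "rGamma (a + 1) / 2 powr a * \<bar>LINT x|?S. 2 * a * cos (z * x) - z * x * sin (z * x)\<bar>
      \<le> rGamma (a + 1) / 2 powr a * (2 * a + z * (2 * (Gamma (a + 1) * rGamma (a + 1/2) / sqrt pi)))"
    using G by (intro mult_left_mono) (auto simp: rGamma_inverse_Gamma)
  also have "\<dots> = 2 powr (1 - a) * (a * rGamma (a + 1) + z * rGamma (a + 1/2) / sqrt pi)"
    using G by (simp add: powr_diff rGamma_inverse_Gamma field_simps)
  also have "a * rGamma (a + 1) = rGamma a" by (rule rGamma_plus1)
  finally show ?thesis using G by (simp add: abs_mult rGamma_inverse_Gamma)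
qed

lemma abs_bessel_j_le:
  assumes a: "0 \<le> a" and z: "0 \<le> z"
  shows "\<bar>bessel_j (a - 1) z\<bar> \<le> 2 powr (1 - a) * (rGamma a + z * rGamma (a + 1/2) / sqrt pi)"
proof (cases "z = 0")
  case True
  then show ?thesis
  proof (cases "a = 0")
    case False
    with a have "rGamma a > 0" by (simp add: rGamma_inverse_Gamma)
    with True show ?thesis by (simp add: bessel_j_def powr_diff field_simps)
  qed (simp add: bessel_j_def True)
next
  case False
  with z have "0 < z" by simp
  from bessel_j_eqI[OF this bessel_j_Poisson_sums[OF a]] bessel_j_Poisson_bound[OF assms]
  show ?thesis by simp
qed

text \<open>From J_{-1} = - J_1 one gets j_{-1}(z) = - z^2 j_1(z), so the Poisson bound at a = 0,
  whose constant part vanishes, controls z j_1(z). This handles the integral in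
  \<open>E_term\<close>.\<close>

lemma abs_bessel_j_one_le:
  assumes z: "0 \<le> z"
  shows "z * \<bar>bessel_j 1 z\<bar> \<le> 2 / sqrt pi"
proof (cases "z = 0")
  case False
  with z have z: "0 < z" by simp
  define L where "L = rGamma (0 + 1) / 2 powr 0 * (LINT x|sym_measure (0 + 1/2). 2 * 0 * cos (z * x) - z * x * sin (z * x))"
  have "bessel_j_term (-1) z sums L"
    using bessel_j_Poisson_sums[of 0 z] unfolding L_def by simp
  \<comment> \<open>The term k = 0 of order -1 vanishes because \<open>rGamma 0 = 0\<close>;
    dropping it turns the series into that of order 1.\<close>
  then have "(\<lambda>k. bessel_j_term (-1) z (Suc k)) sums L"
    by (subst sums_Suc_iff) (simp add: bessel_j_term_def)
  from sums_mult[OF this, of "- (1 / z\<^sup>2)"]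
  have "bessel_j_term 1 z sums (- (1 / z\<^sup>2) * L)"
  proof (rule sums_cong[THEN iffD1, rotated])
    fix k
    define N where "N = real k + 1"
    have N: "N > 0" "real (Suc k) = N" "real k + 1 = N" "real (Suc k) + -1 + 1 = N" by (auto simp: N_def)
    have e: "2 * N + -1 = 2 * real k + 1" by (simp add: N_def)
    have "rGamma N = N * rGamma (N + 1)" by (rule rGamma_plus1[symmetric])
    moreover have "z ^ (2 * Suc k) = z\<^sup>2 * z ^ (2 * k)" by (simp add: power2_eq_square)
    ultimately show "- (1 / z\<^sup>2) * bessel_j_term (-1) z (Suc k) = bessel_j_term 1 z k"
      using z N(1) unfolding bessel_j_term_def fact_Suc power_Suc N(2-4) e
      by (simp add: power2_eq_square)
  qed
  from bessel_j_eqI[OF z this] have "z * (z * \<bar>bessel_j 1 z\<bar>) = \<bar>L\<bar>"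
    using z by (simp add: abs_mult power2_eq_square)
  also have "\<bar>L\<bar> \<le> 2 powr (1 - 0) * (rGamma 0 + z * rGamma (0 + 1/2) / sqrt pi)"
    using bessel_j_Poisson_bound[of 0 z] z unfolding L_def by simp
  also have "rGamma (0 + 1/2::real) = 1 / sqrt pi" by (simp add: rGamma_inverse_Gamma Gamma_one_half_real inverse_eq_divide)
  also have "2 powr (1 - 0) * (rGamma 0 + z * (1 / sqrt pi) / sqrt pi) = z * (2 / pi)"
    by (simp add: field_simps)
  finally have "z * \<bar>bessel_j 1 z\<bar> \<le> 2 / pi" using z by (simp only: mult_le_cancel_left_pos)
  also have "2 / pi \<le> 2 / sqrt pi"
    using sqrt_le_D[of pi pi] pi_ge_two by (intro divide_left_mono) (auto intro!: real_le_lsqrt simp: power2_eq_square)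
  finally show ?thesis .
qed simp

subsection \<open>Pointwise domination of the translation\<close>

text \<open>A nonintegrable f is covered since its Bochner integral is 0 by convention; the
  translation can thus be dominated before its integrability is known.\<close>

lemma ennreal_abs_integral_le:
  fixes f :: "'a \<Rightarrow> real"
  shows "ennreal \<bar>LINT x|M. f x\<bar> \<le> (\<integral>\<^sup>+x. ennreal \<bar>f x\<bar> \<partial>M)"
proof (cases "integrable M f")
  case True
  then show ?thesis using integral_norm_bound_ennreal[of M f] by simp
qed (simp add: not_integrable_integral_eq)

lemma ennreal_le_mult_plusI:
  assumes "x \<le> p * q + r" "0 \<le> p" "0 \<le> q" "0 \<le> r"
  shows "ennreal x \<le> ennreal p * ennreal q + ennreal r"
  using ennreal_leI[OF assms(1)] assms by (simp add: ennreal_mult)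

text \<open>Substitution of - cos \<theta>, which increases on [0, pi]; a reflection then restores
  the sign.\<close>

lemma nn_integral_sin_powr:
  fixes m :: real and H :: "real \<Rightarrow> real"
  assumes m: "0 < m" and [measurable]: "H \<in> borel_measurable borel" and H: "\<And>x. 0 \<le> H x"
  shows "(\<integral>\<^sup>+\<theta>. ennreal (indicator {0..pi} \<theta> * (H (cos \<theta>) * sin \<theta> powr (2 * m - 1))) \<partial>lborel)
    = ennreal (Beta (1/2) m) * (\<integral>\<^sup>+x. ennreal (H x) \<partial>sym_measure m)"
proof -
  let ?f = "\<lambda>x. (1 - x\<^sup>2) powr (m - 1) * H (- x)"
  have "(\<integral>\<^sup>+\<theta>. ennreal (indicator {0..pi} \<theta> * (H (cos \<theta>) * sin \<theta> powr (2 * m - 1))) \<partial>lborel)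
    = (\<integral>\<^sup>+\<theta>. ennreal (?f (- cos \<theta>) * sin \<theta> * indicator {0..pi} \<theta>) \<partial>lborel)"
  proof (intro nn_integral_cong arg_cong[of _ _ ennreal])
    fix \<theta> :: real
    have "(1 - (- cos \<theta>)\<^sup>2) powr (m - 1) * sin \<theta> = sin \<theta> powr (2 * m - 1)" if "\<theta> \<in> {0..pi}"
      using powr_square_mult[of "sin \<theta>" m] that by (simp add: sin_squared_eq sin_ge_zero)
    then show "indicator {0..pi} \<theta> * (H (cos \<theta>) * sin \<theta> powr (2 * m - 1))
        = ?f (- cos \<theta>) * sin \<theta> * indicator {0..pi} \<theta>"
      by (auto simp: indicator_def)
  qed
  also have "\<dots> = (\<integral>\<^sup>+x. ennreal (?f x * indicator {- cos 0..- cos pi} x) \<partial>lborel)"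
    by (rule nn_integral_substitution[symmetric])
      (auto intro!: derivative_eq_intros continuous_intros simp: set_borel_measurable_def sin_ge_zero)
  also have "\<dots> = (\<integral>\<^sup>+x. ennreal ((1 - x\<^sup>2) powr (m - 1) * H x * indicator {-1..1} x) \<partial>lborel)"
    by (subst nn_integral_real_affine[where c = "-1" and t = 0])
      (auto intro!: nn_integral_cong simp: indicator_def)
  also have "\<dots> = (\<integral>\<^sup>+x. ennreal (Beta (1/2) m) *
      (ennreal (indicator {-1..1} x * (1 - x\<^sup>2) powr (m - 1) / Beta (1/2) m) * ennreal (H x)) \<partial>lborel)"
    using m H by (intro nn_integral_cong)
      (simp add: ennreal_mult[symmetric] Beta_pos_real less_imp_le less_imp_neq[symmetric] mult_ac)
  also have "\<dots> = ennreal (Beta (1/2) m) * (\<integral>\<^sup>+x. ennreal (H x) \<partial>sym_measure m)"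
    unfolding sym_measure_pos[OF m] by (subst nn_integral_cmult, simp, subst nn_integral_density) auto
  finally show ?thesis .
qed

text \<open>
  The translation averages \<open>trans_inner\<close> over the cube; for \<open>\<alpha> = 0\<close> this holds because
  \<open>cube_measure\<close> then consists of two point masses.
\<close>

definition trans_inner :: "real \<Rightarrow> (real \<Rightarrow> real) \<Rightarrow> real \<Rightarrow> real \<Rightarrow> real \<Rightarrow> real" where
  "trans_inner a g t s \<rho> = (if a = 0 then E_term g t s \<rho> else
     2 powr (a - 1) * Gamma (a + 1/2) / sqrt pi * (LINT \<theta>:{0..pi}|lborel.
       g (t + s + 2 * \<rho> * cos \<theta>) * exp (- \<rho> * cos \<theta>) * bessel_j (a - 1) (\<rho> * sin \<theta>) * (sin \<theta>) powr (2 * a - 1)))"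

lemma nn_integral_sym_measure_0:
  assumes [measurable]: "F \<in> borel_measurable borel"
  shows "(\<integral>\<^sup>+x. F x \<partial>sym_measure 0) = (F 1 + F (-1)) / 2"
proof -
  have "(\<integral>\<^sup>+x. F x \<partial>sym_measure 0) = (\<integral>\<^sup>+x. F x \<partial>uniform_count_measure {-1, 1::real})"
    unfolding sym_measure_def by (simp only: refl if_True, subst nn_integral_distr) auto
  also have "\<dots> = (F 1 + F (-1)) / 2"
    unfolding uniform_count_measure_def
    by (subst nn_integral_point_measure_finite)
      (auto simp: ennreal_divide_numeral[symmetric] divide_ennreal_def distrib_left add.commute mult.commute)
  finally show ?thesis .
qed

text \<open>The second operator: the linear term brings a further sin \<theta>, which raises the
  parameter of the symmetric law from a to a + 1/2. The quotient of Gammas is Beta(1/2, a + 1/2) /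
  sqrt pi.\<close>

lemma nn_integral_sin_weight:
  fixes g :: "real \<Rightarrow> real" and a \<rho> t s :: real
  assumes a: "0 \<le> a" and \<rho>: "0 \<le> \<rho>" and [measurable]: "g \<in> borel_measurable borel"
  defines "H \<equiv> \<lambda>x. \<bar>g (t + s + 2 * (\<rho> * x))\<bar> * exp (- (t + s + 2 * (\<rho> * x)) / 2)"
  shows "(\<integral>\<^sup>+\<theta>. ennreal (indicator {0..pi} \<theta> * (H (cos \<theta>) * (\<rho> / sqrt pi * sin \<theta> powr (2 * (a + 1/2) - 1)))) \<partial>lborel)
    = ennreal (\<rho> * Gamma (a + 1/2) / Gamma (a + 1)) * (\<integral>\<^sup>+x. ennreal (H x) \<partial>sym_measure (a + 1/2))"
proof -
  have [measurable]: "H \<in> borel_measurable borel" unfolding H_def by measurable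
  have "(\<integral>\<^sup>+\<theta>. ennreal (indicator {0..pi} \<theta> * (H (cos \<theta>) * (\<rho> / sqrt pi * sin \<theta> powr (2 * (a + 1/2) - 1)))) \<partial>lborel)
     = (\<integral>\<^sup>+\<theta>. ennreal (\<rho> / sqrt pi) * ennreal (indicator {0..pi} \<theta> * (H (cos \<theta>) * sin \<theta> powr (2 * (a + 1/2) - 1))) \<partial>lborel)"
    using \<rho> by (intro nn_integral_cong) (simp add: ennreal_mult[symmetric] H_def mult_ac)
  also have "\<dots> = ennreal (\<rho> / sqrt pi) * (ennreal (Beta (1/2) (a + 1/2)) * (\<integral>\<^sup>+x. ennreal (H x) \<partial>sym_measure (a + 1/2)))"
    using a by (subst nn_integral_cmult, simp, subst nn_integral_sin_powr) (auto simp: H_def)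
  also have "\<dots> = ennreal (\<rho> / sqrt pi * Beta (1/2) (a + 1/2)) * (\<integral>\<^sup>+x. ennreal (H x) \<partial>sym_measure (a + 1/2))"
    using a \<rho> by (simp add: ennreal_mult Beta_pos_real less_imp_le mult.assoc del: times_divide_eq_left)
  also have "\<rho> / sqrt pi * Beta (1/2) (a + 1/2) = \<rho> * Gamma (a + 1/2) / Gamma (a + 1)"
    by (simp add: Beta_def Gamma_one_half_real add.commute)
  finally show ?thesis .
qed

lemma ennreal_mult_abs_integral_le:
  assumes "0 \<le> c"
  shows "ennreal (c * \<bar>LINT x|M. f x\<bar>) \<le> (\<integral>\<^sup>+x. ennreal (c * \<bar>f x\<bar>) \<partial>M)"
proof -
  have "ennreal (c * \<bar>LINT x|M. f x\<bar>) = ennreal \<bar>LINT x|M. c * f x\<bar>"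
    using assms by (simp add: abs_mult)
  also have "\<dots> \<le> (\<integral>\<^sup>+x. ennreal \<bar>c * f x\<bar> \<partial>M)" by (rule ennreal_abs_integral_le)
  finally show ?thesis using assms by (simp add: abs_mult)
qed

text \<open>Half of the exponential weights in t and s combines with the kernel factor to exp(-r/2)
  at the very argument r of g, so g enters only as |g r| exp(-r/2), as in its norms.\<close>

lemma exp_split_half: "exp (- (t + s) / 2) * exp (- \<rho> * c) = exp (- (t + s + 2 * (\<rho> * c)) / (2::real))"
  by (simp add: exp_add[symmetric] field_simps)

text \<open>The constant part of the Bessel bound gives the first integral, with total mass 1; the
  linear part gives the second. For a = 0 the two boundary values in \<open>E_term\<close> are the
  integral against \<open>sym_measure 0\<close>.\<close>

lemma trans_inner_bound:
  fixes g :: "real \<Rightarrow> real" and a \<rho> t s :: real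
  assumes a: "0 \<le> a" and \<rho>: "0 \<le> \<rho>" and g[measurable]: "g \<in> borel_measurable borel"
  defines "H \<equiv> \<lambda>x. \<bar>g (t + s + 2 * (\<rho> * x))\<bar> * exp (- (t + s + 2 * (\<rho> * x)) / 2)"
  shows "ennreal (exp (- (t + s) / 2) * \<bar>trans_inner a g t s \<rho>\<bar>) \<le>
    (\<integral>\<^sup>+x. ennreal (H x) \<partial>sym_measure a)
     + ennreal (\<rho> * Gamma (a + 1/2) / Gamma (a + 1)) * (\<integral>\<^sup>+x. ennreal (H x) \<partial>sym_measure (a + 1/2))"
proof (cases "a = 0")
  case True
  have [measurable]: "H \<in> borel_measurable borel" unfolding H_def by measurable
  define I where "I = (LINT \<theta>:{0..pi}|lborel.
     g (t + s + 2 * \<rho> * cos \<theta>) * exp (- \<rho> * cos \<theta>) * bessel_j 1 (\<rho> * sin \<theta>) * sin \<theta>)"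
  define e where "e = exp (- (t + s) / 2)"
  have e: "e > 0" by (simp add: e_def)
  have e1: "e * exp (- \<rho>) = exp (- (t + s + 2 * (\<rho> * 1)) / 2)" and e2: "e * exp \<rho> = exp (- (t + s + 2 * (\<rho> * (- 1))) / 2)"
    unfolding e_def by (simp_all add: exp_add[symmetric] field_simps)
  have "ennreal (e * \<bar>E_term g t s \<rho>\<bar>)
     \<le> ennreal (e * (1/2 * (exp (- \<rho>) * \<bar>g (t + s + 2 * \<rho>)\<bar> + exp \<rho> * \<bar>g (t + s - 2 * \<rho>)\<bar>) + 1/2 * \<rho>\<^sup>2 * \<bar>I\<bar>))"
  proof (intro ennreal_leI mult_left_mono)
    have "\<bar>E_term g t s \<rho>\<bar> \<le> \<bar>1/2 * (exp (- \<rho>) * g (t + s + 2 * \<rho>) + exp \<rho> * g (t + s - 2 * \<rho>))\<bar> + \<bar>1/2 * \<rho>\<^sup>2 * I\<bar>"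
      unfolding E_term_def I_def by (rule abs_triangle_ineq4)
    also have "\<dots> \<le> 1/2 * (exp (- \<rho>) * \<bar>g (t + s + 2 * \<rho>)\<bar> + exp \<rho> * \<bar>g (t + s - 2 * \<rho>)\<bar>) + 1/2 * \<rho>\<^sup>2 * \<bar>I\<bar>"
    proof (intro add_mono)
      show "\<bar>1/2 * (exp (- \<rho>) * g (t + s + 2 * \<rho>) + exp \<rho> * g (t + s - 2 * \<rho>))\<bar>
        \<le> 1/2 * (exp (- \<rho>) * \<bar>g (t + s + 2 * \<rho>)\<bar> + exp \<rho> * \<bar>g (t + s - 2 * \<rho>)\<bar>)"
        using abs_triangle_ineq[of "exp (- \<rho>) * g (t + s + 2 * \<rho>)" "exp \<rho> * g (t + s - 2 * \<rho>)"]
        by (simp add: abs_mult)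
    qed (simp add: abs_mult)
    finally show "\<bar>E_term g t s \<rho>\<bar> \<le> \<dots>" .
  qed (use e in auto)
  also have "e * (1/2 * (exp (- \<rho>) * \<bar>g (t + s + 2 * \<rho>)\<bar> + exp \<rho> * \<bar>g (t + s - 2 * \<rho>)\<bar>) + 1/2 * \<rho>\<^sup>2 * \<bar>I\<bar>)
     = (H 1 + H (-1)) / 2 + e * (1/2 * \<rho>\<^sup>2) * \<bar>I\<bar>"
    unfolding H_def e1[symmetric] e2[symmetric] by (simp add: field_simps)
  also have "ennreal \<dots> = ennreal ((H 1 + H (-1)) / 2) + ennreal (e * (1/2 * \<rho>\<^sup>2) * \<bar>I\<bar>)"
    using e by (intro ennreal_plus) (auto simp: H_def)
  also have "ennreal ((H 1 + H (-1)) / 2) = (\<integral>\<^sup>+x. ennreal (H x) \<partial>sym_measure a)"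
    unfolding True by (subst nn_integral_sym_measure_0) (auto simp: H_def ennreal_divide_numeral[symmetric])
  also have "ennreal (e * (1/2 * \<rho>\<^sup>2) * \<bar>I\<bar>)
      \<le> (\<integral>\<^sup>+\<theta>. ennreal (e * (1/2 * \<rho>\<^sup>2) * \<bar>indicator {0..pi} \<theta> *\<^sub>R (g (t + s + 2 * \<rho> * cos \<theta>) * exp (- \<rho> * cos \<theta>) * bessel_j 1 (\<rho> * sin \<theta>) * sin \<theta>)\<bar>) \<partial>lborel)"
    unfolding I_def set_lebesgue_integral_def using e by (intro ennreal_mult_abs_integral_le) auto
  also have "\<dots> \<le> (\<integral>\<^sup>+\<theta>. ennreal (indicator {0..pi} \<theta> * (H (cos \<theta>) * (\<rho> / sqrt pi * sin \<theta> powr (2 * (a + 1/2) - 1)))) \<partial>lborel)"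
  proof (intro nn_integral_mono ennreal_leI)
    fix \<theta> :: real
    show "e * (1/2 * \<rho>\<^sup>2) * \<bar>indicator {0..pi} \<theta> *\<^sub>R (g (t + s + 2 * \<rho> * cos \<theta>) * exp (- \<rho> * cos \<theta>) * bessel_j 1 (\<rho> * sin \<theta>) * sin \<theta>)\<bar>
      \<le> indicator {0..pi} \<theta> * (H (cos \<theta>) * (\<rho> / sqrt pi * sin \<theta> powr (2 * (a + 1/2) - 1)))"
    \<comment> \<open>For a = 0 the exponent on the right is 0, and \<open>0 powr 0 = 0\<close>.
      Where sin \<theta> = 0 the left side vanishes through its own factor sin \<theta>.\<close>
    proof (cases "\<theta> \<in> {0..pi} \<and> sin \<theta> \<noteq> 0")
      case th: True
      then have s: "sin \<theta> > 0" using sin_ge_zero[of \<theta>] by auto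
      \<comment> \<open>With z = \<rho> sin \<theta>, one factor \<rho> completes z j_1(z), which is
        bounded; the other one remains.\<close>
      have "e * (1/2 * \<rho>\<^sup>2) * \<bar>g (t + s + 2 * \<rho> * cos \<theta>) * exp (- \<rho> * cos \<theta>) * bessel_j 1 (\<rho> * sin \<theta>) * sin \<theta>\<bar>
        = \<bar>g (t + s + 2 * (\<rho> * cos \<theta>))\<bar> * (e * exp (- \<rho> * cos \<theta>)) * (\<rho> / 2 * (\<rho> * sin \<theta> * \<bar>bessel_j 1 (\<rho> * sin \<theta>)\<bar>))"
        using s by (simp add: abs_mult power2_eq_square mult_ac)
      also have "\<dots> \<le> \<bar>g (t + s + 2 * (\<rho> * cos \<theta>))\<bar> * (e * exp (- \<rho> * cos \<theta>)) * (\<rho> / 2 * (2 / sqrt pi))"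
        using s \<rho> e by (intro mult_left_mono abs_bessel_j_one_le) auto
      also have "\<dots> = H (cos \<theta>) * (\<rho> / sqrt pi)"
        unfolding H_def e_def exp_split_half by simp
      finally show ?thesis using th s True by simp
    next
      case False
      then show ?thesis using \<rho> by (auto simp: H_def)
    qed
  qed
  also have "\<dots> = ennreal (\<rho> * Gamma (a + 1/2) / Gamma (a + 1)) * (\<integral>\<^sup>+x. ennreal (H x) \<partial>sym_measure (a + 1/2))"
    unfolding H_def using a \<rho> g by (rule nn_integral_sin_weight)
  finally show ?thesis using True by (simp add: trans_inner_def e_def add_left_mono)
next
  case False
  with a have a': "0 < a" by simp
  have [measurable]: "H \<in> borel_measurable borel" unfolding H_def by measurable
  define C where "C = 2 powr (a - 1) * Gamma (a + 1/2) / sqrt pi"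
  define e where "e = exp (- (t + s) / 2)"
  have e: "e > 0" by (simp add: e_def)
  have C: "C > 0" using a' by (simp add: C_def)
  define f where "f \<theta> = g (t + s + 2 * \<rho> * cos \<theta>) * exp (- \<rho> * cos \<theta>) * bessel_j (a - 1) (\<rho> * sin \<theta>) * (sin \<theta>) powr (2 * a - 1)" for \<theta>
  have "ennreal (e * \<bar>trans_inner a g t s \<rho>\<bar>) = ennreal (e * C * \<bar>LINT \<theta>:{0..pi}|lborel. f \<theta>\<bar>)"
    unfolding trans_inner_def C_def[symmetric] f_def using False C by (simp add: abs_mult mult.assoc)
  also have "\<dots> \<le> (\<integral>\<^sup>+\<theta>. ennreal (e * C * \<bar>indicator {0..pi} \<theta> *\<^sub>R f \<theta>\<bar>) \<partial>lborel)"
    unfolding set_lebesgue_integral_def using e C by (intro ennreal_mult_abs_integral_le) auto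
  also have "\<dots> \<le> (\<integral>\<^sup>+\<theta>. ennreal (1 / Beta (1/2) a) * ennreal (indicator {0..pi} \<theta> * (H (cos \<theta>) * sin \<theta> powr (2 * a - 1)))
      + ennreal (indicator {0..pi} \<theta> * (H (cos \<theta>) * (\<rho> / sqrt pi * sin \<theta> powr (2 * (a + 1/2) - 1)))) \<partial>lborel)"
  proof (intro nn_integral_mono)
    fix \<theta> :: real
    have "e * C * \<bar>indicator {0..pi} \<theta> *\<^sub>R f \<theta>\<bar> \<le>
      1 / Beta (1/2) a * (indicator {0..pi} \<theta> * (H (cos \<theta>) * sin \<theta> powr (2 * a - 1)))
      + indicator {0..pi} \<theta> * (H (cos \<theta>) * (\<rho> / sqrt pi * sin \<theta> powr (2 * (a + 1/2) - 1)))"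
    proof (cases "\<theta> \<in> {0..pi}")
      case th: True
      then have s: "sin \<theta> \<ge> 0" using sin_ge_zero[of \<theta>] by auto
      \<comment> \<open>The constant part becomes 1 / Beta(1/2, a), precisely the normalisation that
        turns the sine weight into \<open>sym_measure a\<close>.\<close>
      have C_eq: "C * (2 powr (1 - a) * (rGamma a + (\<rho> * sin \<theta>) * rGamma (a + 1/2) / sqrt pi))
         = 1 / Beta (1/2) a + \<rho> * sin \<theta> / pi"
      proof -
        have "C * 2 powr (1 - a) = Gamma (a + 1/2) / sqrt pi"
          by (simp add: C_def powr_diff)
        then have "C * (2 powr (1 - a) * (rGamma a + (\<rho> * sin \<theta>) * rGamma (a + 1/2) / sqrt pi))
          = Gamma (a + 1/2) / sqrt pi * (rGamma a + (\<rho> * sin \<theta>) * rGamma (a + 1/2) / sqrt pi)"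
          by (simp only: mult.assoc[symmetric])
        also have "\<dots> = 1 / Beta (1/2) a + \<rho> * sin \<theta> / pi"
        proof -
          define G1 G2 where "G1 = Gamma (a + 1/2)" and "G2 = Gamma a"
          have "G1 > 0" "G2 > 0" using a' by (auto simp: G1_def G2_def)
          then show ?thesis
            unfolding Beta_def rGamma_inverse_Gamma Gamma_one_half_real add.commute[of "1/2" a]
              G1_def[symmetric] G2_def[symmetric] by (simp add: field_simps)
        qed
        finally show ?thesis .
      qed
      have "e * C * \<bar>f \<theta>\<bar> = \<bar>g (t + s + 2 * (\<rho> * cos \<theta>))\<bar> * (e * exp (- \<rho> * cos \<theta>)) * (sin \<theta>) powr (2 * a - 1) *
          (C * \<bar>bessel_j (a - 1) (\<rho> * sin \<theta>)\<bar>)"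
        by (simp add: f_def abs_mult mult_ac)
      also have "\<dots> = H (cos \<theta>) * (sin \<theta>) powr (2 * a - 1) * (C * \<bar>bessel_j (a - 1) (\<rho> * sin \<theta>)\<bar>)"
        unfolding H_def e_def exp_split_half by simp
      also have "\<dots> \<le> H (cos \<theta>) * (sin \<theta>) powr (2 * a - 1) * 
          (C * (2 powr (1 - a) * (rGamma a + (\<rho> * sin \<theta>) * rGamma (a + 1/2) / sqrt pi)))"
        using s \<rho> C a by (intro mult_left_mono abs_bessel_j_le) (auto simp: H_def)
      \<comment> \<open>Weakening 1/pi to 1/sqrt pi gives the linear part the constant Gamma(a+1/2)
        / Gamma(a+1), which later cancels against a Beta quotient.\<close>
      also have "\<dots> \<le> H (cos \<theta>) * (sin \<theta>) powr (2 * a - 1) * (1 / Beta (1/2) a + \<rho> * sin \<theta> / sqrt pi)"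
        unfolding C_eq
      proof (intro mult_left_mono add_left_mono divide_left_mono)
        show "sqrt pi \<le> pi" using pi_ge_two by (intro real_le_lsqrt) (auto simp: power2_eq_square)
      qed (use s \<rho> in \<open>auto simp: H_def\<close>)
      also have "\<dots> = 1 / Beta (1/2) a * (H (cos \<theta>) * sin \<theta> powr (2 * a - 1))
          + H (cos \<theta>) * (\<rho> / sqrt pi * (sin \<theta> * sin \<theta> powr (2 * a - 1)))"
        by (simp add: algebra_simps)
      also have "sin \<theta> * sin \<theta> powr (2 * a - 1) = sin \<theta> powr (2 * (a + 1/2) - 1)"
        using s by (subst powr_mult_base) (auto simp: algebra_simps)
      finally show ?thesis using th by simp
    qed simp
    then show "ennreal (e * C * \<bar>indicator {0..pi} \<theta> *\<^sub>R f \<theta>\<bar>) \<le>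
      ennreal (1 / Beta (1/2) a) * ennreal (indicator {0..pi} \<theta> * (H (cos \<theta>) * sin \<theta> powr (2 * a - 1)))
      + ennreal (indicator {0..pi} \<theta> * (H (cos \<theta>) * (\<rho> / sqrt pi * sin \<theta> powr (2 * (a + 1/2) - 1))))"
      using a' \<rho> by (intro ennreal_le_mult_plusI) (auto simp: H_def Beta_pos_real less_imp_le)
  qed
  also have "\<dots> = ennreal (1 / Beta (1/2) a) * (\<integral>\<^sup>+\<theta>. ennreal (indicator {0..pi} \<theta> * (H (cos \<theta>) * sin \<theta> powr (2 * a - 1))) \<partial>lborel)
      + (\<integral>\<^sup>+\<theta>. ennreal (indicator {0..pi} \<theta> * (H (cos \<theta>) * (\<rho> / sqrt pi * sin \<theta> powr (2 * (a + 1/2) - 1)))) \<partial>lborel)"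
    by (subst nn_integral_add, measurable, subst nn_integral_cmult) auto
  also have "(\<integral>\<^sup>+\<theta>. ennreal (indicator {0..pi} \<theta> * (H (cos \<theta>) * sin \<theta> powr (2 * a - 1))) \<partial>lborel)
      = ennreal (Beta (1/2) a) * (\<integral>\<^sup>+x. ennreal (H x) \<partial>sym_measure a)"
    using a' by (intro nn_integral_sin_powr) (auto simp: H_def)
  also have "ennreal (1 / Beta (1/2) a) * (ennreal (Beta (1/2) a) * (\<integral>\<^sup>+x. ennreal (H x) \<partial>sym_measure a))
      = (\<integral>\<^sup>+x. ennreal (H x) \<partial>sym_measure a)"
  proof -
    have "ennreal (1 / Beta (1/2) a) * ennreal (Beta (1/2) a) = 1"
      using a' Beta_pos_real[of "1/2" a] by (simp flip: ennreal_mult)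
    then show ?thesis by (simp flip: mult.assoc)
  qed
  also have "(\<integral>\<^sup>+\<theta>. ennreal (indicator {0..pi} \<theta> * (H (cos \<theta>) * (\<rho> / sqrt pi * sin \<theta> powr (2 * (a + 1/2) - 1)))) \<partial>lborel)
    = ennreal (\<rho> * Gamma (a + 1/2) / Gamma (a + 1)) * (\<integral>\<^sup>+x. ennreal (H x) \<partial>sym_measure (a + 1/2))"
    unfolding H_def using a \<rho> g by (rule nn_integral_sin_weight)
  finally show ?thesis by (simp add: e_def)
qed

subsection \<open>Integration over the cone\<close>

lemma borel_measurable_fst_comp [measurable (raw)]:
  fixes f :: "'a \<Rightarrow> ('b::second_countable_topology \<times> 'c::second_countable_topology)"
  assumes "f \<in> borel_measurable M"
  shows "(\<lambda>x. fst (f x)) \<in> borel_measurable M"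
  using assms by (simp add: borel_prod[symmetric])

lemma borel_measurable_snd_comp [measurable (raw)]:
  fixes f :: "'a \<Rightarrow> ('b::second_countable_topology \<times> 'c::second_countable_topology)"
  assumes "f \<in> borel_measurable M"
  shows "(\<lambda>x. snd (f x)) \<in> borel_measurable M"
  using assms by (simp add: borel_prod[symmetric])

lemma borel_measurable_vec_nth_comp [measurable (raw)]:
  fixes f :: "'a \<Rightarrow> real ^ 'n"
  assumes [measurable]: "f \<in> borel_measurable M"
  shows "(\<lambda>x. f x $ i) \<in> borel_measurable M"
  using measurable_compose[OF assms, of "\<lambda>x. x $ i" borel]
  by (auto intro!: borel_measurable_continuous_onI continuous_intros)

lemma bessel_j_measurable [measurable]: "bessel_j \<nu> \<in> borel_measurable borel"
  unfolding bessel_j_def[abs_def] bessel_J_def by measurable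

lemma rho_measurable [measurable (raw)]:
  fixes P Q :: "'a \<Rightarrow> (real ^ 'n) \<times> real"
  assumes [measurable]: "P \<in> borel_measurable M" "Q \<in> borel_measurable M"
    "W \<in> measurable M ((\<Pi>\<^sub>M i\<in>UNIV. borel) \<Otimes>\<^sub>M borel)"
  shows "(\<lambda>z. rho (P z) (Q z) (W z)) \<in> borel_measurable M"
  unfolding rho_def split_beta by measurable

lemma sets_cube_measure [measurable_cong]:
  "sets (cube_measure \<kappa> \<mu>) = sets ((\<Pi>\<^sub>M i\<in>UNIV. borel) \<Otimes>\<^sub>M borel)"
  unfolding cube_measure_def by (intro sets_pair_measure_cong sets_PiM_cong) auto

lemma prob_space_cube_measure:
  assumes "\<And>i. 0 \<le> \<kappa> $ i" "0 \<le> \<mu>"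
  shows "prob_space (cube_measure \<kappa> \<mu>)"
  unfolding cube_measure_def using assms
  by (intro prob_space_pair prob_space_PiM prob_space_refl_measure prob_space_sym_measure)

lemma cube_measurable [measurable]:
  "cube \<in> sets (((\<Pi>\<^sub>M i\<in>(UNIV::'n::finite set). borel) \<Otimes>\<^sub>M borel) :: (('n \<Rightarrow> real) \<times> real) measure)"
proof -
  have "cube = {w \<in> space ((\<Pi>\<^sub>M i\<in>(UNIV::'n set). borel) \<Otimes>\<^sub>M borel). (\<forall>i. fst w i \<in> {-1..1::real}) \<and> snd w \<in> {-1..1}}"
    by (auto simp: cube_def space_pair_measure space_PiM Pi_def)
  also have "\<dots> \<in> sets ((\<Pi>\<^sub>M i\<in>(UNIV::'n set). borel) \<Otimes>\<^sub>M borel)" by measurable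
  finally show ?thesis .
qed

lemma E_term_measurable [measurable (raw)]:
  assumes [measurable]: "g \<in> borel_measurable borel" "t \<in> borel_measurable M" "s \<in> borel_measurable M" "\<rho> \<in> borel_measurable M"
  shows "(\<lambda>z. E_term g (t z) (s z) (\<rho> z)) \<in> borel_measurable M"
  unfolding E_term_def set_lebesgue_integral_def by measurable

lemma gen_trans_measurable [measurable (raw)]:
  fixes P Q :: "'a \<Rightarrow> (real ^ 'n) \<times> real"
  assumes "\<And>i. 0 \<le> \<kappa> $ i" "0 \<le> \<mu>" and [measurable]: "g \<in> borel_measurable borel"
    and [measurable]: "P \<in> borel_measurable M" "Q \<in> borel_measurable M"
  shows "(\<lambda>z. gen_trans \<kappa> \<mu> g (P z) (Q z)) \<in> borel_measurable M"
proof -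
  interpret prob_space "cube_measure \<kappa> \<mu>" by (intro prob_space_cube_measure assms)
  have [measurable]: "(\<lambda>_. w) \<in> measurable M ((\<Pi>\<^sub>M i\<in>UNIV. borel) \<Otimes>\<^sub>M borel)" for w :: "('n \<Rightarrow> real) \<times> real"
    by (rule measurable_const) (auto simp: space_pair_measure space_PiM)
  have "(\<lambda>z. trans_pos \<kappa> \<mu> g (P z) (Q z)) \<in> borel_measurable M"
    unfolding trans_pos_def set_lebesgue_integral_def Let_def by measurable
  then show ?thesis unfolding gen_trans_def by measurable
qed

lemma cone_measurable [measurable]: "cone \<in> sets borel"
proof -
  have "cone = {p \<in> space borel. 0 \<le> snd p \<and> norm (fst p) \<le> snd p}"
    by (auto simp: cone_def)
  also have "\<dots> \<in> sets borel" by measurable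
  finally show ?thesis .
qed

lemma u_wt_measurable [measurable]: "u_wt \<kappa> \<mu> \<in> borel_measurable borel"
  unfolding u_wt_def h_wt_def split_beta by measurable

lemma u_wt_nonneg: "0 \<le> u_wt \<kappa> \<mu> p"
  by (simp add: u_wt_def split_beta)

lemma W_wt_eq: "W_wt \<kappa> \<mu> p = u_wt \<kappa> \<mu> p * exp (- snd p)"
  by (simp add: u_wt_def W_wt_def split_beta)

section \<open>Reduction of cone and cube integrals to one spatial dimension\<close>

text \<open>The index type remains a type variable; \<open>UNIV = {i0}\<close> is the form in which
  d = 1 enters all later lemmas.\<close>

lemma UNIV_eq_singleton_if_CARD_1:
  assumes "CARD('n::finite) = 1"
  obtains i0 :: "'n::finite" where "UNIV = {i0}"
  using assms by (auto simp: card_1_singleton_iff)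

lemma nn_integral_cube_measure:
  fixes \<kappa> :: "real ^ 'n"
  assumes U: "UNIV = {i0::'n::finite}" and k: "0 \<le> \<kappa> $ i0" "0 \<le> \<mu>"
    and F: "F \<in> borel_measurable ((\<Pi>\<^sub>M i\<in>UNIV. borel) \<Otimes>\<^sub>M borel)"
  shows "(\<integral>\<^sup>+w. F w \<partial>cube_measure \<kappa> \<mu>)
    = (\<integral>\<^sup>+u. \<integral>\<^sup>+v. F (\<lambda>_. u, v) \<partial>sym_measure \<mu> \<partial>refl_measure (\<kappa> $ i0))"
proof -
  have all: "i = i0" for i using U by auto
  interpret S: prob_space "sym_measure \<mu>" using k by (intro prob_space_sym_measure)
  have "sigma_finite_measure (refl_measure (\<kappa> $ i))" for i
  proof -
    interpret prob_space "refl_measure (\<kappa> $ i)" using k all[of i] by (intro prob_space_refl_measure) simp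
    show ?thesis by (rule sigma_finite_measure_axioms)
  qed
  then interpret R: product_sigma_finite "\<lambda>i. refl_measure (\<kappa> $ i)"
    by (rule product_sigma_finite.intro)
  have F': "F \<in> borel_measurable ((\<Pi>\<^sub>M i\<in>UNIV. refl_measure (\<kappa> $ i)) \<Otimes>\<^sub>M sym_measure \<mu>)"
    using F by (subst measurable_cong_sets[OF sets_cube_measure[unfolded cube_measure_def] refl])
  define h where "h u = (\<integral>\<^sup>+v. F (\<lambda>_. u, v) \<partial>sym_measure \<mu>)" for u
  have "(\<lambda>p. ((\<lambda>_. fst p), snd p)) \<in> borel \<Otimes>\<^sub>M sym_measure \<mu> \<rightarrow>\<^sub>M (\<Pi>\<^sub>M i\<in>(UNIV::'n set). borel) \<Otimes>\<^sub>M borel"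
    by (intro measurable_Pair measurable_abs_UNIV) auto
  from measurable_compose[OF this F]
  have "(\<lambda>(u, v). F (\<lambda>_. u, v)) \<in> borel_measurable (borel \<Otimes>\<^sub>M sym_measure \<mu>)"
    by (simp add: split_beta)
  then have h: "h \<in> borel_measurable borel"
    unfolding h_def by (rule S.borel_measurable_nn_integral)
  have "(\<integral>\<^sup>+w. F w \<partial>cube_measure \<kappa> \<mu>)
    = (\<integral>\<^sup>+x. \<integral>\<^sup>+v. F (x, v) \<partial>sym_measure \<mu> \<partial>(\<Pi>\<^sub>M i\<in>UNIV. refl_measure (\<kappa> $ i)))"
    unfolding cube_measure_def by (rule S.nn_integral_fst[symmetric, OF F'])
  also have "\<dots> = (\<integral>\<^sup>+x. h (x i0) \<partial>(\<Pi>\<^sub>M i\<in>{i0}. refl_measure (\<kappa> $ i)))"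
  proof -
    have "(\<lambda>_. x i0) = x" for x :: "'n \<Rightarrow> real"
      by (rule ext, subst all, rule refl)
    then show ?thesis by (simp add: h_def U)
  qed
  also have "\<dots> = (\<integral>\<^sup>+u. h u \<partial>refl_measure (\<kappa> $ i0))"
    using h by (intro R.product_nn_integral_singleton) simp
  finally show ?thesis by (simp add: h_def)
qed

lemma vec_measurable [measurable]: "(vec :: real \<Rightarrow> real ^ 'n) \<in> borel_measurable borel"
  by (intro borel_measurable_continuous_onI) (auto simp: vec_def intro!: continuous_intros)

text \<open>Lebesgue measure on one-component vectors is the image of that on the line under
  \<open>vec\<close>, as comparison on boxes shows.\<close>

lemma nn_integral_lborel_vec_1:
  assumes U: "UNIV = {i0::'n::finite}" and [measurable]: "F \<in> borel_measurable (borel :: (real ^ 'n) measure)"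
  shows "(\<integral>\<^sup>+x. F x \<partial>lborel) = (\<integral>\<^sup>+r. F (vec r) \<partial>lborel)"
proof -
  have all: "i = i0" for i using U by auto
  have "lborel = distr lborel borel (vec :: real \<Rightarrow> real ^ 'n)"
  proof (rule lborel_eqI)
    fix l u :: "real ^ 'n" assume lu: "\<And>b. b \<in> Basis \<Longrightarrow> l \<bullet> b \<le> u \<bullet> b"
    have B: "Basis = {axis i0 1 :: real ^ 'n}" by (auto simp: Basis_vec_def U all)
    have "(\<forall>i. l $ i < r \<and> r < u $ i) \<longleftrightarrow> l $ i0 < r \<and> r < u $ i0" for r
      using all by metis
    then have "vec -` box l u = {l $ i0 <..< u $ i0}"
      by (auto simp: mem_box_cart)
    moreover have "l $ i0 \<le> u $ i0" using lu[of "axis i0 1"] by (simp add: B inner_axis)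
    ultimately show "emeasure (distr lborel borel (vec :: real \<Rightarrow> real ^ 'n)) (box l u) = ennreal (\<Prod>b\<in>Basis. (u - l) \<bullet> b)"
      by (simp add: emeasure_distr B inner_axis)
  qed simp
  then have "(\<integral>\<^sup>+x. F x \<partial>lborel) = (\<integral>\<^sup>+x. F x \<partial>distr lborel borel (vec :: real \<Rightarrow> real ^ 'n))" by simp
  also have "\<dots> = (\<integral>\<^sup>+r. F (vec r) \<partial>lborel)" by (rule nn_integral_distr) auto
  finally show ?thesis .
qed

lemma norm_vec_1:
  assumes U: "UNIV = {i0::'n::finite}"
  shows "norm (x :: real ^ 'n) = \<bar>x $ i0\<bar>"
  by (simp add: norm_vec_def L2_set_def U)

lemma nn_integral_lborel_vec_prod:
  assumes U: "UNIV = {i0::'n::finite}" and [measurable]: "H \<in> borel_measurable (borel :: ((real ^ 'n) \<times> real) measure)"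
  shows "(\<integral>\<^sup>+p. H p \<partial>lborel) = (\<integral>\<^sup>+t. \<integral>\<^sup>+r. H (vec r, t) \<partial>lborel \<partial>lborel)"
proof -
  have "(\<integral>\<^sup>+p. H p \<partial>lborel) = (\<integral>\<^sup>+p. H p \<partial>(lborel \<Otimes>\<^sub>M lborel))"
    by (simp add: lborel_prod)
  also have "\<dots> = (\<integral>\<^sup>+t. \<integral>\<^sup>+x. H (x, t) \<partial>lborel \<partial>lborel)"
    by (rule lborel_pair.nn_integral_snd[symmetric]) (simp add: lborel_prod)
  also have "\<dots> = (\<integral>\<^sup>+t. \<integral>\<^sup>+r. H (vec r, t) \<partial>lborel \<partial>lborel)"
    by (intro nn_integral_cong nn_integral_lborel_vec_1[OF U]) measurable
  finally show ?thesis .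
qed

text \<open>In the coordinates x = t w the Jacobian t and the homogeneity of the weight, of degree
  2(k + \<mu>) - 1, make up the power of t. What is left is the unnormalised density of
  \<open>eta\<close>.\<close>

lemma nn_integral_cone:
  fixes \<kappa> :: "real ^ 'n"
  assumes U: "UNIV = {i0::'n::finite}" and k: "0 \<le> \<kappa> $ i0" and m: "0 \<le> \<mu>"
    and [measurable]: "F \<in> borel_measurable borel"
  shows "(\<integral>\<^sup>+p. ennreal (indicator cone p * u_wt \<kappa> \<mu> p) * F p \<partial>lborel)
    = ennreal (Beta (\<kappa> $ i0 + 1/2) (\<mu> + 1/2)) * (\<integral>\<^sup>+t. ennreal (indicator {0<..} t * t powr (2 * (\<kappa> $ i0 + \<mu>))) *
       (\<integral>\<^sup>+w. F (vec (t * w), t) \<partial>eta (\<kappa> $ i0) \<mu>) \<partial>lborel)"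
proof -
  let ?k = "\<kappa> $ i0"
  define B where "B = Beta (?k + 1/2) (\<mu> + 1/2)"
  have B: "B > 0" using k m by (simp add: B_def Beta_pos_real)
  define H where "H p = ennreal (indicator cone p * u_wt \<kappa> \<mu> p) * F p" for p :: "(real ^ 'n) \<times> real"
  have [measurable]: "H \<in> borel_measurable borel" unfolding H_def by measurable
  have uw: "u_wt \<kappa> \<mu> (vec r, t) = (\<bar>r\<bar> powr ?k)\<^sup>2 * (t\<^sup>2 - r\<^sup>2) powr (\<mu> - 1/2)" for r t
    by (simp add: u_wt_def h_wt_def U norm_vec_1[OF U])
  have cw: "(vec r, t) \<in> (cone :: ((real ^ 'n) \<times> real) set) \<longleftrightarrow> 0 \<le> t \<and> \<bar>r\<bar> \<le> t" for r t
    by (simp add: cone_def norm_vec_1[OF U])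
  have "(\<integral>\<^sup>+p. H p \<partial>lborel) = (\<integral>\<^sup>+t. \<integral>\<^sup>+r. H (vec r, t) \<partial>lborel \<partial>lborel)"
    by (rule nn_integral_lborel_vec_prod[OF U]) measurable
  also have "\<dots> = (\<integral>\<^sup>+t. ennreal B * (ennreal (indicator {0<..} t * t powr (2 * (?k + \<mu>))) *
       (\<integral>\<^sup>+w. F (vec (t * w), t) \<partial>eta ?k \<mu>)) \<partial>lborel)"
  proof (intro nn_integral_cong)
    fix t :: real
    show "(\<integral>\<^sup>+r. H (vec r, t) \<partial>lborel) = ennreal B * (ennreal (indicator {0<..} t * t powr (2 * (?k + \<mu>))) *
       (\<integral>\<^sup>+w. F (vec (t * w), t) \<partial>eta ?k \<mu>))"
    proof (cases "t > 0")
      case True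
      have "(\<integral>\<^sup>+r. H (vec r, t) \<partial>lborel) = ennreal t * (\<integral>\<^sup>+w. H (vec (t * w), t) \<partial>lborel)"
        using True by (subst nn_integral_real_affine[where c = t and t = 0]) auto
      also have "\<dots> = (\<integral>\<^sup>+w. ennreal t * H (vec (t * w), t) \<partial>lborel)"
        by (rule nn_integral_cmult[symmetric]) measurable
      also have "\<dots> = (\<integral>\<^sup>+w. ennreal (B * t powr (2 * (?k + \<mu>))) * (ennreal
         (indicator {-1..1} w * (\<bar>w\<bar> powr (2 * ?k) * (1 - w\<^sup>2) powr (\<mu> - 1/2)) / B) * F (vec (t * w), t)) \<partial>lborel)"
      proof (intro nn_integral_cong)
        fix w :: real
        have "t * (indicator cone (vec (t * w) :: real ^ 'n, t) * u_wt \<kappa> \<mu> (vec (t * w), t))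
           = B * t powr (2 * (?k + \<mu>)) * (indicator {-1..1} w * (\<bar>w\<bar> powr (2 * ?k) * (1 - w\<^sup>2) powr (\<mu> - 1/2)) / B)"
        proof (cases "\<bar>w\<bar> \<le> 1")
          case w: True
          then have w2: "0 \<le> 1 - w\<^sup>2" by (simp add: abs_square_le_1)
          have "\<bar>t * w\<bar> \<le> t" using w True by (simp add: abs_mult)
          moreover have "w \<in> {-1..1}" using w by auto
          moreover have "t\<^sup>2 - (t * w)\<^sup>2 = t\<^sup>2 * (1 - w\<^sup>2)" by (simp add: power_mult_distrib algebra_simps)
          moreover have "(\<bar>t * w\<bar> powr ?k)\<^sup>2 = t powr (2 * ?k) * \<bar>w\<bar> powr (2 * ?k)"
            using True by (simp add: abs_mult powr_mult power2_eq_square powr_add[symmetric] mult_ac)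
          moreover have "(t\<^sup>2 * (1 - w\<^sup>2)) powr (\<mu> - 1/2) = t powr (2 * (\<mu> - 1/2)) * (1 - w\<^sup>2) powr (\<mu> - 1/2)"
            using True w2 by (subst powr_mult) (auto simp: powr_powr simp flip: powr_numeral)
          moreover have "t * (t powr (2 * ?k) * t powr (2 * (\<mu> - 1/2))) = t powr (2 * (?k + \<mu>))"
            using True by (subst powr_add[symmetric], subst powr_mult_base) (auto simp: algebra_simps)
          ultimately show ?thesis
            using True B by (simp add: cw uw mult_ac)
        next
          case w: False
          then have "\<not> \<bar>t * w\<bar> \<le> t" using True by (simp add: abs_mult)
          moreover have "w \<notin> {-1..1}" using w by auto
          ultimately show ?thesis by (simp add: cw)
        qed
        then show "ennreal t * H (vec (t * w), t) = ennreal (B * t powr (2 * (?k + \<mu>))) * (ennreal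
         (indicator {-1..1} w * (\<bar>w\<bar> powr (2 * ?k) * (1 - w\<^sup>2) powr (\<mu> - 1/2)) / B) * F (vec (t * w), t))"
          unfolding H_def mult.assoc[symmetric, of _ _ "F _"] using True B
          by (subst (1 2) ennreal_mult'[symmetric]) (auto simp: mult.assoc)
      qed
      also have "\<dots> = ennreal (B * t powr (2 * (?k + \<mu>))) * (\<integral>\<^sup>+w. ennreal
         (indicator {-1..1} w * (\<bar>w\<bar> powr (2 * ?k) * (1 - w\<^sup>2) powr (\<mu> - 1/2)) / B) * F (vec (t * w), t) \<partial>lborel)"
        by (rule nn_integral_cmult) measurable
      also have "(\<integral>\<^sup>+w. ennreal
         (indicator {-1..1} w * (\<bar>w\<bar> powr (2 * ?k) * (1 - w\<^sup>2) powr (\<mu> - 1/2)) / B) * F (vec (t * w), t) \<partial>lborel)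
         = (\<integral>\<^sup>+w. F (vec (t * w), t) \<partial>eta ?k \<mu>)"
        unfolding eta_def B_def by (subst nn_integral_density) auto
      finally show ?thesis using True B by (simp add: ennreal_mult mult.assoc)
    next
      case False
      \<comment> \<open>At the apex the weight is 0 because \<open>0 powr a = 0\<close>, whatever
        the sign of the exponent \<mu> - 1/2.\<close>
      have "H (vec r, t) = 0" for r
      proof (cases "0 \<le> t \<and> \<bar>r\<bar> \<le> t")
        case True
        with False have "r = 0" by auto
        then have "u_wt \<kappa> \<mu> (vec r, t) = 0" unfolding uw by simp
        then show ?thesis by (simp add: H_def)
      qed (simp add: H_def cw)
      with False show ?thesis by simp
    qed
  qed
  also have "\<dots> = ennreal B * (\<integral>\<^sup>+t. ennreal (indicator {0<..} t * t powr (2 * (?k + \<mu>))) *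
       (\<integral>\<^sup>+w. F (vec (t * w), t) \<partial>eta ?k \<mu>) \<partial>lborel)"
  proof (rule nn_integral_cmult)
    interpret prob_space "eta ?k \<mu>" using k m by (rule prob_space_eta)
    show "(\<lambda>t. ennreal (indicator {0<..} t * t powr (2 * (?k + \<mu>))) *
       (\<integral>\<^sup>+w. F (vec (t * w), t) \<partial>eta ?k \<mu>)) \<in> borel_measurable lborel" by measurable
  qed
  finally show ?thesis unfolding H_def B_def .
qed

section \<open>The translation as an operator on the weighted cone\<close>

lemma trans_inner_measurable [measurable (raw)]:
  assumes [measurable]: "g \<in> borel_measurable borel" "t \<in> borel_measurable M" "s \<in> borel_measurable M" "\<rho> \<in> borel_measurable M"
  shows "(\<lambda>z. trans_inner a g (t z) (s z) (\<rho> z)) \<in> borel_measurable M"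
  unfolding trans_inner_def set_lebesgue_integral_def by measurable

lemma alpha_1:
  fixes \<kappa> :: "real ^ 'n"
  assumes "UNIV = {i0::'n::finite}"
  shows "alpha \<kappa> \<mu> = \<kappa> $ i0 + \<mu>"
  by (simp add: alpha_def assms)

lemma trans_pos_eq:
  "alpha \<kappa> \<mu> \<noteq> 0 \<Longrightarrow> trans_pos \<kappa> \<mu> g p q =
    (LINT w:cube|cube_measure \<kappa> \<mu>. trans_inner (alpha \<kappa> \<mu>) g (snd p) (snd q) (rho p q w))"
  unfolding trans_pos_def trans_inner_def Let_def
  by (simp add: set_lebesgue_integral_def mult.left_commute[of "indicator cube _"] flip: integral_mult_right_zero)

text \<open>Brings both branches of \<open>gen_trans\<close> to one form. The free factor e later
  carries the exponential weight.\<close>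

lemma gen_trans_le:
  fixes \<kappa> :: "real ^ 'n"
  assumes U: "UNIV = {i0::'n::finite}" and k: "0 \<le> \<kappa> $ i0" and m: "0 \<le> \<mu>"
    and [measurable]: "g \<in> borel_measurable borel" and e: "0 \<le> e"
  shows "ennreal (e * \<bar>gen_trans \<kappa> \<mu> g p q\<bar>) \<le> (\<integral>\<^sup>+u. \<integral>\<^sup>+v.
     ennreal (e * \<bar>trans_inner (alpha \<kappa> \<mu>) g (snd p) (snd q) (rho p q (\<lambda>_. u, v))\<bar>) \<partial>sym_measure \<mu> \<partial>refl_measure (\<kappa> $ i0))"
proof -
  define h where "h w = trans_inner (alpha \<kappa> \<mu>) g (snd p) (snd q) (rho p q w)" for w
  have [measurable]: "h \<in> borel_measurable ((\<Pi>\<^sub>M i\<in>UNIV. borel) \<Otimes>\<^sub>M borel)"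
    unfolding h_def by measurable
  have "ennreal (e * \<bar>gen_trans \<kappa> \<mu> g p q\<bar>) \<le> (\<integral>\<^sup>+w. ennreal (e * \<bar>h w\<bar>) \<partial>cube_measure \<kappa> \<mu>)"
  proof (cases "alpha \<kappa> \<mu> = 0")
    case True
    then have k0: "\<kappa> $ i0 = 0" and m0: "\<mu> = 0" using k m by (auto simp: alpha_1[OF U])
    have 1: "(\<lambda>v. ((\<lambda>_. u), v)) \<in> borel \<rightarrow>\<^sub>M (\<Pi>\<^sub>M i\<in>(UNIV::'n set). borel) \<Otimes>\<^sub>M borel" for u :: real
      by (intro measurable_Pair measurable_abs_UNIV) auto
    have 2: "(\<lambda>v. ennreal (e * \<bar>h (\<lambda>_. u, v)\<bar>)) \<in> borel_measurable borel" for u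
      using measurable_compose[OF 1, of h borel u] by measurable
    have "(\<integral>\<^sup>+w. ennreal (e * \<bar>h w\<bar>) \<partial>cube_measure \<kappa> \<mu>)
       = (\<integral>\<^sup>+u. (\<integral>\<^sup>+v. ennreal (e * \<bar>h (\<lambda>_. u, v)\<bar>) \<partial>sym_measure \<mu>) \<partial>refl_measure (\<kappa> $ i0))"
      using U k m by (rule nn_integral_cube_measure) measurable
    also have "\<dots> = (\<integral>\<^sup>+u. (ennreal (e * \<bar>h (\<lambda>_. u, 1)\<bar>) + ennreal (e * \<bar>h (\<lambda>_. u, -1)\<bar>)) / 2 \<partial>return borel 1)"
      unfolding m0 k0 using 2 by (simp add: nn_integral_sym_measure_0 refl_measure_def)
    also have "\<dots> = (ennreal (e * \<bar>h (\<lambda>_. 1, 1)\<bar>) + ennreal (e * \<bar>h (\<lambda>_. 1, -1)\<bar>)) / 2"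
    proof (rule nn_integral_return)
      have 1: "(\<lambda>u. ((\<lambda>_. u), v)) \<in> borel \<rightarrow>\<^sub>M (\<Pi>\<^sub>M i\<in>(UNIV::'n set). borel) \<Otimes>\<^sub>M borel" for v :: real
        by (intro measurable_Pair measurable_abs_UNIV) auto
      have [measurable]: "(\<lambda>u. h (\<lambda>_. u, v)) \<in> borel_measurable borel" for v
        using measurable_compose[OF 1, of h borel v] by simp
      show "(\<lambda>u. (ennreal (e * \<bar>h (\<lambda>_. u, 1)\<bar>) + ennreal (e * \<bar>h (\<lambda>_. u, -1)\<bar>)) / 2) \<in> borel_measurable borel"
        by measurable
    qed simp
    also have "\<dots> = ennreal ((e * \<bar>h (\<lambda>_. 1, 1)\<bar> + e * \<bar>h (\<lambda>_. 1, -1)\<bar>) / 2)"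
      using e by (simp add: ennreal_divide_numeral[symmetric])
    finally have eq: "(\<integral>\<^sup>+w. ennreal (e * \<bar>h w\<bar>) \<partial>cube_measure \<kappa> \<mu>)
      = ennreal ((e * \<bar>h (\<lambda>_. 1, 1)\<bar> + e * \<bar>h (\<lambda>_. 1, -1)\<bar>) / 2)" .
    have "e * \<bar>gen_trans \<kappa> \<mu> g p q\<bar> \<le> (e * \<bar>h (\<lambda>_. 1, 1)\<bar> + e * \<bar>h (\<lambda>_. 1, -1)\<bar>) / 2"
    proof -
      have "\<bar>gen_trans \<kappa> \<mu> g p q\<bar> \<le> (\<bar>h (\<lambda>_. 1, 1)\<bar> + \<bar>h (\<lambda>_. 1, -1)\<bar>) / 2"
        using True by (simp add: gen_trans_def h_def trans_inner_def)
      from mult_left_mono[OF this e] show ?thesis by (simp add: field_simps)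
    qed
    then show ?thesis unfolding eq by (rule ennreal_leI)
  next
    case False
    then have "ennreal (e * \<bar>gen_trans \<kappa> \<mu> g p q\<bar>) = ennreal (e * \<bar>LINT w|cube_measure \<kappa> \<mu>. indicator cube w *\<^sub>R h w\<bar>)"
      by (simp add: gen_trans_def trans_pos_eq h_def set_lebesgue_integral_def)
    also have "\<dots> \<le> (\<integral>\<^sup>+w. ennreal (e * \<bar>indicator cube w *\<^sub>R h w\<bar>) \<partial>cube_measure \<kappa> \<mu>)"
      using e by (rule ennreal_mult_abs_integral_le)
    also have "\<dots> \<le> (\<integral>\<^sup>+w. ennreal (e * \<bar>h w\<bar>) \<partial>cube_measure \<kappa> \<mu>)"
      using e by (intro nn_integral_mono ennreal_leI mult_left_mono) (auto simp: indicator_def)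
    finally show ?thesis .
  qed
  also have "\<dots> = (\<integral>\<^sup>+u. \<integral>\<^sup>+v. ennreal (e * \<bar>h (\<lambda>_. u, v)\<bar>) \<partial>sym_measure \<mu> \<partial>refl_measure (\<kappa> $ i0))"
    using U k m by (rule nn_integral_cube_measure) measurable
  finally show ?thesis by (simp add: h_def)
qed

lemma rho_vec:
  fixes x y :: "real ^ 'n"
  assumes U: "UNIV = {i0::'n::finite}" and "t > 0" "s > 0" "x $ i0 = t * w" "y $ i0 = s * c" "U' i0 = u"
  shows "rho (x, t) (y, s) (U', v) =
    sqrt (t * s) * sqrt ((1 + (w * c * u + sqrt (1 - w\<^sup>2) * sqrt (1 - c\<^sup>2) * v)) / 2)"
proof -
  have "t\<^sup>2 - (t * w)\<^sup>2 = t\<^sup>2 * (1 - w\<^sup>2)" "s\<^sup>2 - (s * c)\<^sup>2 = s\<^sup>2 * (1 - c\<^sup>2)"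
    by (simp_all add: power_mult_distrib algebra_simps)
  then have a: "sqrt (t\<^sup>2 - (t * w)\<^sup>2) = t * sqrt (1 - w\<^sup>2)" "sqrt (s\<^sup>2 - (s * c)\<^sup>2) = s * sqrt (1 - c\<^sup>2)"
    using assms(2,3) by (simp_all add: real_sqrt_mult)
  have "rho (x, t) (y, s) (U', v) =
    sqrt (1/2 * (t * s + t * w * (s * c) * u + (t * sqrt (1 - w\<^sup>2)) * (s * sqrt (1 - c\<^sup>2)) * v))"
    unfolding rho_def using assms(2,3)
    by (simp add: U norm_vec_1[OF U] assms(4-6) a)
  also have "\<dots> = sqrt (t * s * ((1 + (w * c * u + sqrt (1 - w\<^sup>2) * sqrt (1 - c\<^sup>2) * v)) / 2))"
    by (simp add: algebra_simps)
  finally show ?thesis by (simp only: real_sqrt_mult)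
qed

text \<open>The central estimate, with the second point fixed and the first one integrated. The
  point (y, s) survives only in sqrt s, since \<open>cone_product_law\<close> removes y/s and the
  Laguerre translations remove the shift by s.\<close>

lemma cone_translation_norm_bound:
  fixes \<kappa> y :: "real ^ 'n"
  assumes U: "UNIV = {i0::'n::finite}" and k: "0 \<le> \<kappa> $ i0" and m: "0 \<le> \<mu>"
    and g[measurable]: "g \<in> borel_measurable borel" and y: "(y, s) \<in> cone" and s: "0 < s"
  defines "\<alpha> \<equiv> \<kappa> $ i0 + \<mu>"
  defines "N \<equiv> \<lambda>b. \<integral>\<^sup>+r. ennreal (indicator {0<..} r * r powr b) * ennreal (\<bar>g r\<bar> * exp (- r / 2)) \<partial>lborel"
  shows "(\<integral>\<^sup>+p. ennreal (indicator cone p * u_wt \<kappa> \<mu> p) *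
       ennreal (exp (- (snd p + s) / 2) * \<bar>gen_trans \<kappa> \<mu> g p (y, s)\<bar>) \<partial>lborel)
    \<le> ennreal (Beta (\<kappa> $ i0 + 1/2) (\<mu> + 1/2)) *
       (N (2 * \<alpha>) + ennreal (Gamma (2 * \<alpha> + 1) / Gamma (2 * \<alpha> + 3/2) * sqrt s) * N (2 * \<alpha> + 1/2))"
proof -
  let ?k = "\<kappa> $ i0"
  define G where "G r = ennreal (\<bar>g r\<bar> * exp (- r / 2))" for r
  have G[measurable]: "G \<in> borel_measurable borel" unfolding G_def by measurable
  have \<alpha>: "0 \<le> \<alpha>" using k m by (simp add: \<alpha>_def)
  define c where "c = y $ i0 / s"
  have y_eq: "y $ i0 = s * c" using s by (simp add: c_def)
  have c: "\<bar>c\<bar> \<le> 1" using y s by (simp add: c_def cone_def norm_vec_1[OF U])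
  define D where "D = Gamma (\<alpha> + 1/2) / Gamma (\<alpha> + 1)"
  have D: "D > 0" using \<alpha> by (simp add: D_def)
  define E where "E = Gamma (2 * \<alpha> + 1) / Gamma (2 * \<alpha> + 3/2)"
  have E: "E > 0" using \<alpha> by (simp add: E_def)
  define h where "h t \<xi> = sqrt (t * s) * sqrt ((1 + \<xi>) / 2)" for t \<xi>
  define \<Phi> where "\<Phi> t \<xi> = (\<integral>\<^sup>+x. G (t + s + 2 * (h t \<xi> * x)) \<partial>sym_measure \<alpha>)
     + ennreal (h t \<xi> * D) * (\<integral>\<^sup>+x. G (t + s + 2 * (h t \<xi> * x)) \<partial>sym_measure (\<alpha> + 1/2))" for t \<xi>
  interpret Sa: prob_space "sym_measure \<alpha>" using \<alpha> by (rule prob_space_sym_measure)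
  interpret Sb: prob_space "sym_measure (\<alpha> + 1/2)" using \<alpha> by (intro prob_space_sym_measure) simp
  have [measurable]: "(\<lambda>\<xi>. h t \<xi>) \<in> borel_measurable borel" for t unfolding h_def by measurable
  have \<Phi>[measurable]: "(\<lambda>\<xi>. \<Phi> t \<xi>) \<in> borel_measurable borel" for t
    unfolding \<Phi>_def by measurable
  have step1: "ennreal (exp (- (t + s) / 2) * \<bar>gen_trans \<kappa> \<mu> g (vec (t * w), t) (y, s)\<bar>)
      \<le> (\<integral>\<^sup>+u. \<integral>\<^sup>+v. \<Phi> t (w * c * u + sqrt (1 - w\<^sup>2) * sqrt (1 - c\<^sup>2) * v) \<partial>sym_measure \<mu> \<partial>refl_measure ?k)"
    if t: "t > 0" and w: "\<bar>w\<bar> \<le> 1" for t w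
  proof -
    have "ennreal (exp (- (t + s) / 2) * \<bar>gen_trans \<kappa> \<mu> g (vec (t * w), t) (y, s)\<bar>)
      \<le> (\<integral>\<^sup>+u. \<integral>\<^sup>+v. ennreal (exp (- (t + s) / 2) *
           \<bar>trans_inner \<alpha> g t s (rho (vec (t * w), t) (y, s) (\<lambda>_. u, v))\<bar>) \<partial>sym_measure \<mu> \<partial>refl_measure ?k)"
      using gen_trans_le[OF U k m g, of "exp (- (t + s) / 2)" "(vec (t * w), t)" "(y, s)"]
      by (simp add: alpha_1[OF U] \<alpha>_def)
    also have "\<dots> \<le> (\<integral>\<^sup>+u. \<integral>\<^sup>+v. \<Phi> t (w * c * u + sqrt (1 - w\<^sup>2) * sqrt (1 - c\<^sup>2) * v) \<partial>sym_measure \<mu> \<partial>refl_measure ?k)"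
    proof (rule nn_integral_mono_AE)
      show "AE u in refl_measure ?k. (\<integral>\<^sup>+v. ennreal (exp (- (t + s) / 2) *
           \<bar>trans_inner \<alpha> g t s (rho (vec (t * w), t) (y, s) (\<lambda>_. u, v))\<bar>) \<partial>sym_measure \<mu>)
         \<le> (\<integral>\<^sup>+v. \<Phi> t (w * c * u + sqrt (1 - w\<^sup>2) * sqrt (1 - c\<^sup>2) * v) \<partial>sym_measure \<mu>)"
        using AE_refl_measure[OF k]
      proof eventually_elim
        case u: (elim u)
        show ?case
        proof (rule nn_integral_mono_AE)
          show "AE v in sym_measure \<mu>. ennreal (exp (- (t + s) / 2) *
             \<bar>trans_inner \<alpha> g t s (rho (vec (t * w), t) (y, s) (\<lambda>_. u, v))\<bar>)
            \<le> \<Phi> t (w * c * u + sqrt (1 - w\<^sup>2) * sqrt (1 - c\<^sup>2) * v)"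
            using AE_sym_measure[OF m]
          proof eventually_elim
            case v: (elim v)
            define \<xi> where "\<xi> = w * c * u + sqrt (1 - w\<^sup>2) * sqrt (1 - c\<^sup>2) * v"
            have "\<bar>\<xi>\<bar> \<le> 1" unfolding \<xi>_def using w u v c by (rule abs_cone_product_le)
            then have h: "0 \<le> h t \<xi>" using t s by (simp add: h_def)
            have r: "rho (vec (t * w), t) (y, s) (\<lambda>_. u, v) = h t \<xi>"
              unfolding h_def \<xi>_def by (rule rho_vec[OF U t s _ y_eq]) auto
            show ?case
              using trans_inner_bound[OF \<alpha> h g, of t s]
              unfolding r \<xi>_def[symmetric] \<Phi>_def G_def D_def times_divide_eq_right[symmetric] .
          qed
        qed
      qed
    qed
    finally show ?thesis .
  qed
  have step2: "(\<integral>\<^sup>+\<xi>. \<Phi> t \<xi> \<partial>sym_measure (\<alpha> + 1/2)) =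
     (\<integral>\<^sup>+a. G (t + s + 2 * (sqrt (t * s) * a)) \<partial>sym_measure (2 * \<alpha> + 1/2))
     + ennreal (sqrt (t * s) * E) * (\<integral>\<^sup>+a. G (t + s + 2 * (sqrt (t * s) * a)) \<partial>sym_measure (2 * \<alpha> + 1/2 + 1/2))"
    if t: "t > 0" for t
  proof -
    let ?F = "\<lambda>a. G (t + s + 2 * (sqrt (t * s) * a))"
    have F: "?F \<in> borel_measurable borel" by measurable
    have "(\<integral>\<^sup>+\<xi>. \<Phi> t \<xi> \<partial>sym_measure (\<alpha> + 1/2)) =
      (\<integral>\<^sup>+\<xi>. (\<integral>\<^sup>+x. G (t + s + 2 * (h t \<xi> * x)) \<partial>sym_measure \<alpha>) \<partial>sym_measure (\<alpha> + 1/2))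
       + (\<integral>\<^sup>+\<xi>. ennreal (h t \<xi> * D) * (\<integral>\<^sup>+x. G (t + s + 2 * (h t \<xi> * x)) \<partial>sym_measure (\<alpha> + 1/2)) \<partial>sym_measure (\<alpha> + 1/2))"
      unfolding \<Phi>_def by (rule nn_integral_add) measurable
    \<comment> \<open>The factor \<open>powr 0\<close> is inserted to fit
      \<open>Gegenbauer_product_law\<close> with m = \<alpha> + 1/2 and r = 0, where its constant is
      1.\<close>
    also have "(\<integral>\<^sup>+\<xi>. (\<integral>\<^sup>+x. G (t + s + 2 * (h t \<xi> * x)) \<partial>sym_measure \<alpha>) \<partial>sym_measure (\<alpha> + 1/2))
      = (\<integral>\<^sup>+\<xi>. ennreal (((1 + \<xi>) / 2) powr 0) * (\<integral>\<^sup>+a. ?F (sqrt ((1 + \<xi>) / 2) * a) \<partial>sym_measure (\<alpha> + 1/2 + 0 - 1/2)) \<partial>sym_measure (\<alpha> + 1/2))"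
    proof (rule nn_integral_cong_AE)
      have "AE \<xi> in sym_measure (\<alpha> + 1/2). \<xi> \<noteq> -1" using \<alpha> by (intro AE_sym_measure_not_eq) simp
      then show "AE \<xi> in sym_measure (\<alpha> + 1/2). (\<integral>\<^sup>+x. G (t + s + 2 * (h t \<xi> * x)) \<partial>sym_measure \<alpha>)
        = ennreal (((1 + \<xi>) / 2) powr 0) * (\<integral>\<^sup>+a. ?F (sqrt ((1 + \<xi>) / 2) * a) \<partial>sym_measure (\<alpha> + 1/2 + 0 - 1/2))"
        by eventually_elim (simp add: h_def mult.assoc)
    qed
    also have "\<dots> = (\<integral>\<^sup>+a. ?F a \<partial>sym_measure (2 * \<alpha> + 1/2))"
    proof -
      have "2 * (\<alpha> + 1/2) + 0 - 1/2 = 2 * \<alpha> + 1/2" by simp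
      moreover have "Beta (\<alpha> + 1/2 + 0) (\<alpha> + 1/2) / Beta (\<alpha> + 1/2) (\<alpha> + 1/2) = 1"
        using Beta_pos_real[of "\<alpha> + 1/2" "\<alpha> + 1/2"] \<alpha> by simp
      ultimately show ?thesis
        using Gegenbauer_product_law[of "\<alpha> + 1/2" 0, OF _ _ _ F] \<alpha>
        by (simp add: add.commute[of "1/2"])
    qed
    \<comment> \<open>The factor h = sqrt(ts) sqrt((1 + \<xi>)/2) is what makes this the case r =
      1/2 of the same law.\<close>
    also have "(\<integral>\<^sup>+\<xi>. ennreal (h t \<xi> * D) * (\<integral>\<^sup>+x. G (t + s + 2 * (h t \<xi> * x)) \<partial>sym_measure (\<alpha> + 1/2)) \<partial>sym_measure (\<alpha> + 1/2))
      = (\<integral>\<^sup>+\<xi>. ennreal (sqrt (t * s) * D) * (ennreal (((1 + \<xi>) / 2) powr (1/2)) * (\<integral>\<^sup>+a. ?F (sqrt ((1 + \<xi>) / 2) * a) \<partial>sym_measure (\<alpha> + 1/2))) \<partial>sym_measure (\<alpha> + 1/2))"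
    proof (rule nn_integral_cong_AE)
      have "AE \<xi> in sym_measure (\<alpha> + 1/2). \<bar>\<xi>\<bar> \<le> 1" using \<alpha> by (intro AE_sym_measure) simp
      then show "AE \<xi> in sym_measure (\<alpha> + 1/2). ennreal (h t \<xi> * D) * (\<integral>\<^sup>+x. G (t + s + 2 * (h t \<xi> * x)) \<partial>sym_measure (\<alpha> + 1/2))
         = ennreal (sqrt (t * s) * D) * (ennreal (((1 + \<xi>) / 2) powr (1/2)) * (\<integral>\<^sup>+a. ?F (sqrt ((1 + \<xi>) / 2) * a) \<partial>sym_measure (\<alpha> + 1/2)))"
      proof eventually_elim
        case (elim \<xi>)
        then have x: "0 \<le> (1 + \<xi>) / 2" by auto
        have "ennreal (h t \<xi> * D) = ennreal (sqrt (t * s) * D) * ennreal (((1 + \<xi>) / 2) powr (1/2))"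
          using x t s D by (simp add: h_def powr_half_sqrt ennreal_mult[symmetric] mult_ac)
        then show ?case by (simp add: h_def mult.assoc)
      qed
    qed
    also have "\<dots> = ennreal (sqrt (t * s) * D) * (\<integral>\<^sup>+\<xi>. ennreal (((1 + \<xi>) / 2) powr (1/2)) *
        (\<integral>\<^sup>+a. ?F (sqrt ((1 + \<xi>) / 2) * a) \<partial>sym_measure (\<alpha> + 1/2)) \<partial>sym_measure (\<alpha> + 1/2))"
      by (rule nn_integral_cmult) measurable
    also have "(\<integral>\<^sup>+\<xi>. ennreal (((1 + \<xi>) / 2) powr (1/2)) *
        (\<integral>\<^sup>+a. ?F (sqrt ((1 + \<xi>) / 2) * a) \<partial>sym_measure (\<alpha> + 1/2)) \<partial>sym_measure (\<alpha> + 1/2))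
       = ennreal (Beta (\<alpha> + 1) (\<alpha> + 1/2) / Beta (\<alpha> + 1/2) (\<alpha> + 1/2)) * (\<integral>\<^sup>+a. ?F a \<partial>sym_measure (2 * \<alpha> + 1/2 + 1/2))"
    proof -
      have "\<alpha> + 1/2 + 1/2 - 1/2 = \<alpha> + 1/2" "2 * (\<alpha> + 1/2) + 1/2 - 1/2 = 2 * \<alpha> + 1/2 + 1/2"
        "\<alpha> + 1/2 + 1/2 = \<alpha> + 1" by simp_all
      note idx = this
      show ?thesis
        using Gegenbauer_product_law[of "\<alpha> + 1/2" "1/2" ?F, unfolded idx(1,2)] \<alpha> F
        by (simp add: idx(3))
    qed
    also have "ennreal (sqrt (t * s) * D) * \<dots> = ennreal (sqrt (t * s) * D * (Beta (\<alpha> + 1) (\<alpha> + 1/2) / Beta (\<alpha> + 1/2) (\<alpha> + 1/2)))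
       * (\<integral>\<^sup>+a. ?F a \<partial>sym_measure (2 * \<alpha> + 1/2 + 1/2))"
      using t s D \<alpha> by (subst (2) ennreal_mult) (auto simp: Beta_pos_real less_imp_le mult.assoc)
    \<comment> \<open>Gamma(\<alpha>+1/2) and Gamma(\<alpha>+1) cancel between D and the Beta
      quotient.\<close>
    also have "sqrt (t * s) * D * (Beta (\<alpha> + 1) (\<alpha> + 1/2) / Beta (\<alpha> + 1/2) (\<alpha> + 1/2)) = sqrt (t * s) * E"
    proof -
      have "Gamma (\<alpha> + 1/2) > 0" "Gamma (\<alpha> + 1) > 0" "Gamma (2 * \<alpha> + 1) > 0" "Gamma (2 * \<alpha> + 3/2) > 0" using \<alpha> by auto
      moreover have "\<alpha> + 1 + (\<alpha> + 1/2) = 2 * \<alpha> + 3/2" "\<alpha> + 1/2 + (\<alpha> + 1/2) = 2 * \<alpha> + 1" by auto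
      ultimately show ?thesis unfolding D_def E_def Beta_def by (simp only:) (simp add: divide_simps)
    qed
    finally show ?thesis .
  qed
  have "(\<integral>\<^sup>+p. ennreal (indicator cone p * u_wt \<kappa> \<mu> p) *
       ennreal (exp (- (snd p + s) / 2) * \<bar>gen_trans \<kappa> \<mu> g p (y, s)\<bar>) \<partial>lborel)
    = ennreal (Beta (?k + 1/2) (\<mu> + 1/2)) * (\<integral>\<^sup>+t. ennreal (indicator {0<..} t * t powr (2 * \<alpha>)) *
       (\<integral>\<^sup>+w. ennreal (exp (- (t + s) / 2) * \<bar>gen_trans \<kappa> \<mu> g (vec (t * w), t) (y, s)\<bar>) \<partial>eta ?k \<mu>) \<partial>lborel)"
  proof -
    have "i = i0" for i using U by auto
    then have "0 \<le> \<kappa> $ i" for i using k by metis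
    then show ?thesis
      using nn_integral_cone[OF U k m, of "\<lambda>p. ennreal (exp (- (snd p + s) / 2) * \<bar>gen_trans \<kappa> \<mu> g p (y, s)\<bar>)"] m
      by (simp add: \<alpha>_def)
  qed
  also have "\<dots> \<le> ennreal (Beta (?k + 1/2) (\<mu> + 1/2)) * (\<integral>\<^sup>+t. 
       ennreal (indicator {0<..} t * t powr (2 * \<alpha>)) * (\<integral>\<^sup>+a. G (t + s + 2 * (sqrt (t * s) * a)) \<partial>sym_measure (2 * \<alpha> + 1/2))
       + ennreal (E * sqrt s) * (ennreal (indicator {0<..} t * t powr (2 * \<alpha> + 1/2)) *
           (\<integral>\<^sup>+a. G (t + s + 2 * (sqrt (t * s) * a)) \<partial>sym_measure (2 * \<alpha> + 1/2 + 1/2))) \<partial>lborel)"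
  proof (intro mult_left_mono nn_integral_mono)
    fix t :: real
    show "ennreal (indicator {0<..} t * t powr (2 * \<alpha>)) *
       (\<integral>\<^sup>+w. ennreal (exp (- (t + s) / 2) * \<bar>gen_trans \<kappa> \<mu> g (vec (t * w), t) (y, s)\<bar>) \<partial>eta ?k \<mu>)
       \<le> ennreal (indicator {0<..} t * t powr (2 * \<alpha>)) * (\<integral>\<^sup>+a. G (t + s + 2 * (sqrt (t * s) * a)) \<partial>sym_measure (2 * \<alpha> + 1/2))
       + ennreal (E * sqrt s) * (ennreal (indicator {0<..} t * t powr (2 * \<alpha> + 1/2)) *
           (\<integral>\<^sup>+a. G (t + s + 2 * (sqrt (t * s) * a)) \<partial>sym_measure (2 * \<alpha> + 1/2 + 1/2)))"
    proof (cases "t > 0")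
      case t: True
      have "(\<integral>\<^sup>+w. ennreal (exp (- (t + s) / 2) * \<bar>gen_trans \<kappa> \<mu> g (vec (t * w), t) (y, s)\<bar>) \<partial>eta ?k \<mu>)
        \<le> (\<integral>\<^sup>+w. \<integral>\<^sup>+u. \<integral>\<^sup>+v. \<Phi> t (w * c * u + sqrt (1 - w\<^sup>2) * sqrt (1 - c\<^sup>2) * v) \<partial>sym_measure \<mu> \<partial>refl_measure ?k \<partial>eta ?k \<mu>)"
      proof (rule nn_integral_mono_AE)
        show "AE w in eta ?k \<mu>. ennreal (exp (- (t + s) / 2) * \<bar>gen_trans \<kappa> \<mu> g (vec (t * w), t) (y, s)\<bar>)
          \<le> (\<integral>\<^sup>+u. \<integral>\<^sup>+v. \<Phi> t (w * c * u + sqrt (1 - w\<^sup>2) * sqrt (1 - c\<^sup>2) * v) \<partial>sym_measure \<mu> \<partial>refl_measure ?k)"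
          using AE_eta by eventually_elim (rule step1[OF t])
      qed
      also have "\<dots> = (\<integral>\<^sup>+\<xi>. \<Phi> t \<xi> \<partial>sym_measure (\<alpha> + 1/2))"
        unfolding \<alpha>_def by (rule cone_product_law[OF k m c \<Phi>[unfolded \<alpha>_def]])
      also note step2[OF t]
      finally have "ennreal (t powr (2 * \<alpha>)) * (\<integral>\<^sup>+w. ennreal (exp (- (t + s) / 2) * \<bar>gen_trans \<kappa> \<mu> g (vec (t * w), t) (y, s)\<bar>) \<partial>eta ?k \<mu>)
        \<le> ennreal (t powr (2 * \<alpha>)) * ((\<integral>\<^sup>+a. G (t + s + 2 * (sqrt (t * s) * a)) \<partial>sym_measure (2 * \<alpha> + 1/2))
     + ennreal (sqrt (t * s) * E) * (\<integral>\<^sup>+a. G (t + s + 2 * (sqrt (t * s) * a)) \<partial>sym_measure (2 * \<alpha> + 1/2 + 1/2)))"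
        by (rule mult_left_mono) simp
      also have "\<dots> = ennreal (t powr (2 * \<alpha>)) * (\<integral>\<^sup>+a. G (t + s + 2 * (sqrt (t * s) * a)) \<partial>sym_measure (2 * \<alpha> + 1/2))
        + (ennreal (t powr (2 * \<alpha>)) * ennreal (sqrt (t * s) * E)) * (\<integral>\<^sup>+a. G (t + s + 2 * (sqrt (t * s) * a)) \<partial>sym_measure (2 * \<alpha> + 1/2 + 1/2))"
        by (simp only: distrib_left mult.assoc)
      \<comment> \<open>Here sqrt(ts) is split: sqrt t joins the half-line weight, sqrt s is kept
        for the starred norm.\<close>
      also have "ennreal (t powr (2 * \<alpha>)) * ennreal (sqrt (t * s) * E) = ennreal (E * sqrt s) * ennreal (t powr (2 * \<alpha> + 1/2))"
        using t s E by (simp add: ennreal_mult[symmetric] powr_add powr_half_sqrt real_sqrt_mult mult_ac)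
      finally show ?thesis using t by (simp add: mult.assoc)
    qed simp
  qed simp
  also have "(\<integral>\<^sup>+t. 
       ennreal (indicator {0<..} t * t powr (2 * \<alpha>)) * (\<integral>\<^sup>+a. G (t + s + 2 * (sqrt (t * s) * a)) \<partial>sym_measure (2 * \<alpha> + 1/2))
       + ennreal (E * sqrt s) * (ennreal (indicator {0<..} t * t powr (2 * \<alpha> + 1/2)) *
           (\<integral>\<^sup>+a. G (t + s + 2 * (sqrt (t * s) * a)) \<partial>sym_measure (2 * \<alpha> + 1/2 + 1/2))) \<partial>lborel)
     = (\<integral>\<^sup>+t. ennreal (indicator {0<..} t * t powr (2 * \<alpha>)) * (\<integral>\<^sup>+a. G (t + s + 2 * (sqrt (t * s) * a)) \<partial>sym_measure (2 * \<alpha> + 1/2)) \<partial>lborel)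
     + ennreal (E * sqrt s) * (\<integral>\<^sup>+t. ennreal (indicator {0<..} t * t powr (2 * \<alpha> + 1/2)) *
           (\<integral>\<^sup>+a. G (t + s + 2 * (sqrt (t * s) * a)) \<partial>sym_measure (2 * \<alpha> + 1/2 + 1/2)) \<partial>lborel)"
  proof -
    interpret S1: prob_space "sym_measure (2 * \<alpha> + 1/2)" using \<alpha> by (intro prob_space_sym_measure) simp
    interpret S2: prob_space "sym_measure (2 * \<alpha> + 1/2 + 1/2)" using \<alpha> by (intro prob_space_sym_measure) simp
    show ?thesis
      by (subst nn_integral_add, measurable, subst nn_integral_cmult, measurable)
  qed
  also have "\<dots> = N (2 * \<alpha>) + ennreal (E * sqrt s) * N (2 * \<alpha> + 1/2)"
    using \<alpha> s Laguerre_translation_invariant[OF _ _ G, of "2 * \<alpha>" s] Laguerre_translation_invariant[OF _ _ G, of "2 * \<alpha> + 1/2" s]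
    unfolding N_def G_def[symmetric] by simp
  finally show ?thesis unfolding E_def .
qed

subsection \<open>The pseudo convolution\<close>

lemma rho_bounds:
  fixes x y :: "real ^ 'n"
  assumes U: "UNIV = {i0::'n::finite}" and p: "(x, t) \<in> cone" and q: "(y, s) \<in> cone"
    and u: "\<bar>U' i0\<bar> \<le> 1" and v: "\<bar>v\<bar> \<le> 1"
  shows "0 \<le> rho (x, t) (y, s) (U', v)" "rho (x, t) (y, s) (U', v) \<le> sqrt (t * s)"
proof -
  have xt: "0 \<le> t" "\<bar>x $ i0\<bar> \<le> t" and ys: "0 \<le> s" "\<bar>y $ i0\<bar> \<le> s"
    using p q by (auto simp: cone_def norm_vec_1[OF U])
  have "0 \<le> rho (x, t) (y, s) (U', v) \<and> rho (x, t) (y, s) (U', v) \<le> sqrt (t * s)"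
  proof (cases "t = 0 \<or> s = 0")
    case True
    then have "rho (x, t) (y, s) (U', v) = 0"
      using xt ys by (auto simp: rho_def U norm_vec_1[OF U])
    then show ?thesis using xt ys by simp
  next
    case False
    then have t: "t > 0" and s: "s > 0" using xt ys by auto
    define w c where "w = x $ i0 / t" and "c = y $ i0 / s"
    have w: "\<bar>w\<bar> \<le> 1" and c: "\<bar>c\<bar> \<le> 1" using xt ys t s by (auto simp: w_def c_def)
    define \<xi> where "\<xi> = w * c * U' i0 + sqrt (1 - w\<^sup>2) * sqrt (1 - c\<^sup>2) * v"
    have "\<bar>\<xi>\<bar> \<le> 1" unfolding \<xi>_def using w u v c by (rule abs_cone_product_le)
    then have "0 \<le> sqrt ((1 + \<xi>) / 2)" "sqrt ((1 + \<xi>) / 2) \<le> 1" by auto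
    moreover have "rho (x, t) (y, s) (U', v) = sqrt (t * s) * sqrt ((1 + \<xi>) / 2)"
      unfolding \<xi>_def using t s by (intro rho_vec[OF U]) (auto simp: w_def c_def)
    ultimately show ?thesis using t s by (auto intro: mult_left_le)
  qed
  then show "0 \<le> rho (x, t) (y, s) (U', v)" "rho (x, t) (y, s) (U', v) \<le> sqrt (t * s)" by auto
qed

text \<open>By the arithmetic-geometric mean inequality, 2 \<rho> <= 2 sqrt(ts) <= t + s.\<close>

lemma translation_argument_nonneg:
  fixes t s \<rho> c :: real
  assumes "0 \<le> t" "0 \<le> s" "0 \<le> \<rho>" "\<rho> \<le> sqrt (t * s)" "\<bar>c\<bar> \<le> 1"
  shows "0 \<le> t + s + 2 * \<rho> * c"
proof -
  have "\<bar>\<rho> * c\<bar> \<le> \<rho>" using assms by (simp add: abs_mult mult_left_le)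
  moreover have "2 * \<rho> \<le> t + s" using arith_geo_mean_sqrt[OF assms(1,2)] assms(4) by simp
  ultimately show ?thesis by (simp add: abs_le_iff mult.assoc)
qed

text \<open>Membership in \<open>half_L1\<close> controls g only on [0, infinity). This permits
  replacing g by a Borel function that vanishes on negative numbers; the restriction to
  \<open>cube\<close> makes the equality hold exactly.\<close>

lemma gen_trans_cong:
  fixes \<kappa> :: "real ^ 'n"
  assumes U: "UNIV = {i0::'n::finite}" and p: "p \<in> cone" and q: "q \<in> cone"
    and eq: "\<And>r. 0 \<le> r \<Longrightarrow> g r = g' r"
  shows "gen_trans \<kappa> \<mu> g p q = gen_trans \<kappa> \<mu> g' p q"
proof -
  obtain x t y s where [simp]: "p = (x, t)" "q = (y, s)" by (cases p, cases q)
  have ts: "0 \<le> t" "0 \<le> s" using p q by (auto simp: cone_def)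
  have arg: "g (t + s + 2 * rho (x, t) (y, s) w * c) = g' (t + s + 2 * rho (x, t) (y, s) w * c)"
    if "w \<in> cube" "\<bar>c\<bar> \<le> 1" for w c
  proof (rule eq)
    obtain u v where w: "w = (u, v)" by (cases w)
    have "u i0 \<in> {-1..1}" "v \<in> {-1..1}" using that(1) by (auto simp: w cube_def)
    then have "\<bar>u i0\<bar> \<le> 1" "\<bar>v\<bar> \<le> 1" by auto
    then show "0 \<le> t + s + 2 * rho (x, t) (y, s) w * c"
      using rho_bounds[OF U, of x t y s u v] p q ts that
      by (intro translation_argument_nonneg) (auto simp: w)
  qed
  show ?thesis
  proof (cases "alpha \<kappa> \<mu> = 0")
    case True
    have E: "E_term g t s (rho (x, t) (y, s) w) = E_term g' t s (rho (x, t) (y, s) w)" if "w \<in> cube" for w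
    proof -
      have "g (t + s + 2 * rho (x, t) (y, s) w) = g' (t + s + 2 * rho (x, t) (y, s) w)" "g (t + s - 2 * rho (x, t) (y, s) w) = g' (t + s - 2 * rho (x, t) (y, s) w)"
        using arg[OF that, of 1] arg[OF that, of "-1"] by simp_all
      then show ?thesis unfolding E_term_def by (simp add: arg[OF that])
    qed
    have "(\<lambda>_. 1, 1) \<in> (cube :: (('n \<Rightarrow> real) \<times> real) set)" "(\<lambda>_. 1, -1) \<in> (cube :: (('n \<Rightarrow> real) \<times> real) set)"
      by (auto simp: cube_def)
    with True show ?thesis using E by (simp add: gen_trans_def)
  next
    case False
    have "trans_pos \<kappa> \<mu> g p q = trans_pos \<kappa> \<mu> g' p q"
      unfolding trans_pos_def Let_def set_lebesgue_integral_def
      by (intro arg_cong[of _ _ "(*) _"] Bochner_Integration.integral_cong refl) (simp add: indicator_def arg)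
    with False show ?thesis by (simp add: gen_trans_def)
  qed
qed

section \<open>Positivity of the weight, normalisation, half-line norms\<close>

text \<open>On each slice the weight can vanish only at r = 0 and |r| = t. This lets finiteness of a
  weighted function be passed on to the function itself.\<close>

lemma AE_u_wt_pos:
  fixes \<kappa> :: "real ^ 'n"
  assumes U: "UNIV = {i0::'n::finite}"
  shows "AE p in lborel. p \<in> cone \<longrightarrow> 0 < u_wt \<kappa> \<mu> p"
proof -
  let ?N = "{p \<in> space lborel. \<not> (p \<in> cone \<longrightarrow> 0 < u_wt \<kappa> \<mu> p)}"
  have uw: "u_wt \<kappa> \<mu> (vec r, t) = (\<bar>r\<bar> powr (\<kappa> $ i0))\<^sup>2 * (t\<^sup>2 - r\<^sup>2) powr (\<mu> - 1/2)" for r t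
    by (simp add: u_wt_def h_wt_def U norm_vec_1[OF U])
  have N: "?N \<in> sets lborel" by measurable
  then have [measurable]: "?N \<in> sets borel" by simp
  have "emeasure lborel ?N = (\<integral>\<^sup>+p. indicator ?N p \<partial>lborel)" using N by simp
  also have "\<dots> = (\<integral>\<^sup>+t. \<integral>\<^sup>+r. indicator ?N (vec r, t) \<partial>lborel \<partial>lborel)"
    by (rule nn_integral_lborel_vec_prod[OF U]) measurable
  also have "\<dots> = (\<integral>\<^sup>+t. 0 \<partial>(lborel :: real measure))"
  proof (rule nn_integral_cong)
    fix t :: real
    have "AE r in lborel. indicator ?N (vec r, t) = (0 :: ennreal)"
      using AE_lborel_singleton[of "0::real"] AE_lborel_singleton[of t] AE_lborel_singleton[of "- t"]
    proof eventually_elim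
      case (elim r)
      then have "r\<^sup>2 \<noteq> t\<^sup>2" by (simp add: power2_eq_iff)
      with elim have "0 < u_wt \<kappa> \<mu> (vec r, t)" unfolding uw by simp
      then show ?case by simp
    qed
    then have "(\<integral>\<^sup>+r. indicator ?N (vec r, t) \<partial>lborel) = (\<integral>\<^sup>+r. 0 \<partial>(lborel :: real measure))"
      by (rule nn_integral_cong_AE)
    then show "(\<integral>\<^sup>+r. indicator ?N (vec r, t) \<partial>lborel) = 0" by simp
  qed
  finally have "emeasure lborel ?N = 0" by simp
  with N show ?thesis by (intro AE_I[of _ _ ?N]) auto
qed

text \<open>In cone coordinates the mass of W factors into the Beta normalisation of
  \<open>eta\<close> and a Gamma integral in t.\<close>

lemma b_const_1:
  fixes \<kappa> :: "real ^ 'n"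
  assumes U: "UNIV = {i0::'n::finite}" and k: "0 \<le> \<kappa> $ i0" and m: "0 \<le> \<mu>"
  shows "b_const \<kappa> \<mu> = 1 / (Beta (\<kappa> $ i0 + 1/2) (\<mu> + 1/2) * Gamma (2 * (\<kappa> $ i0 + \<mu>) + 1))"
proof -
  let ?\<alpha> = "\<kappa> $ i0 + \<mu>"
  interpret prob_space "eta (\<kappa> $ i0) \<mu>" using k m by (rule prob_space_eta)
  have B: "0 < Beta (\<kappa> $ i0 + 1/2) (\<mu> + 1/2)" "0 < Gamma (2 * ?\<alpha> + 1)" using k m by (auto simp: Beta_pos_real)
  have "(\<integral>\<^sup>+p. ennreal (indicator cone p * W_wt \<kappa> \<mu> p) \<partial>lborel)
      = (\<integral>\<^sup>+p. ennreal (indicator cone p * u_wt \<kappa> \<mu> p) * ennreal (exp (- snd p)) \<partial>lborel)"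
    by (intro nn_integral_cong) (simp add: W_wt_eq u_wt_nonneg ennreal_mult[symmetric] mult.assoc)
  also have "\<dots> = ennreal (Beta (\<kappa> $ i0 + 1/2) (\<mu> + 1/2)) *
      (\<integral>\<^sup>+t. ennreal (indicator {0<..} t * t powr (2 * ?\<alpha>)) * (\<integral>\<^sup>+w. ennreal (exp (- t)) \<partial>eta (\<kappa> $ i0) \<mu>) \<partial>lborel)"
    using nn_integral_cone[OF U k m, of "\<lambda>p. ennreal (exp (- snd p))"] by simp
  also have "(\<integral>\<^sup>+t. ennreal (indicator {0<..} t * t powr (2 * ?\<alpha>)) * (\<integral>\<^sup>+w. ennreal (exp (- t)) \<partial>eta (\<kappa> $ i0) \<mu>) \<partial>lborel)
      = (\<integral>\<^sup>+t. ennreal (indicator {0..} t * t powr (2 * ?\<alpha> + 1 - 1) / exp t) \<partial>lborel)"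
    using emeasure_space_1
    by (intro nn_integral_cong) (auto simp: ennreal_mult[symmetric] exp_minus divide_inverse indicator_def)
  also have "\<dots> = ennreal (Gamma (2 * ?\<alpha> + 1))"
    using k m by (intro Gamma_conv_nn_integral_real[symmetric]) simp
  finally have "(\<integral>\<^sup>+p. ennreal (indicator cone p * W_wt \<kappa> \<mu> p) \<partial>lborel)
     = ennreal (Beta (\<kappa> $ i0 + 1/2) (\<mu> + 1/2) * Gamma (2 * ?\<alpha> + 1))"
    using B by (simp add: ennreal_mult)
  then have "(LINT p:cone|lborel. W_wt \<kappa> \<mu> p) = Beta (\<kappa> $ i0 + 1/2) (\<mu> + 1/2) * Gamma (2 * ?\<alpha> + 1)"
    unfolding set_lebesgue_integral_def using B
    by (subst integral_eq_nn_integral) (auto simp: W_wt_eq[abs_def] u_wt_nonneg)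
  then show ?thesis by (simp add: b_const_def)
qed

lemma nn_integral_half_norm1:
  assumes a: "0 \<le> a" and g: "g \<in> half_L1 a"
  shows "(\<integral>\<^sup>+r. ennreal (indicator {0<..} r * r powr a) * ennreal (\<bar>g r\<bar> * exp (- r / 2)) \<partial>lborel)
    = ennreal (Gamma (a + 1) * half_norm1 a g)" and "0 \<le> half_norm1 a g"
proof -
  have G: "0 < Gamma (a + 1)" using a by simp
  have "integrable lborel (\<lambda>t. norm (indicator {0..} t *\<^sub>R (g t * exp (- t / 2) * t powr a)))"
    using g by (intro integrable_norm) (simp add: half_L1_def set_integrable_def)
  then have i: "integrable lborel (\<lambda>t. indicator {0..} t *\<^sub>R (\<bar>g t\<bar> * exp (- t / 2) * t powr a))"
    by (simp add: abs_mult)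
  have "(\<integral>\<^sup>+r. ennreal (indicator {0<..} r * r powr a) * ennreal (\<bar>g r\<bar> * exp (- r / 2)) \<partial>lborel)
     = (\<integral>\<^sup>+r. ennreal (indicator {0..} r *\<^sub>R (\<bar>g r\<bar> * exp (- r / 2) * r powr a)) \<partial>lborel)"
    by (intro nn_integral_cong) (auto simp: ennreal_mult[symmetric] indicator_def mult_ac)
  also have "\<dots> = ennreal (LINT r:{0..}|lborel. \<bar>g r\<bar> * exp (- r / 2) * r powr a)"
    unfolding set_lebesgue_integral_def using i by (intro nn_integral_eq_integral) auto
  finally show "(\<integral>\<^sup>+r. ennreal (indicator {0<..} r * r powr a) * ennreal (\<bar>g r\<bar> * exp (- r / 2)) \<partial>lborel)
    = ennreal (Gamma (a + 1) * half_norm1 a g)"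
    using G by (simp add: half_norm1_def)
  have "0 \<le> (LINT r:{0..}|lborel. \<bar>g r\<bar> * exp (- r / 2) * r powr a)"
    unfolding set_lebesgue_integral_def by (intro integral_nonneg_AE) auto
  then show "0 \<le> half_norm1 a g" using G by (simp add: half_norm1_def)
qed

text \<open>Obtained by dividing the measurable integrand by its weight; 0 is treated separately
  because \<open>0 powr a = 0\<close> there.\<close>

lemma half_L1_measurable:
  assumes g: "g \<in> half_L1 a"
  shows "(\<lambda>r. indicator {0..} r * g r) \<in> borel_measurable borel"
proof -
  have [measurable]: "(\<lambda>t. indicator {0..} t *\<^sub>R (g t * exp (- t / 2) * t powr a)) \<in> borel_measurable borel"
    using g by (auto simp: half_L1_def set_integrable_def dest: borel_measurable_integrable)
  have "(\<lambda>r. indicator {0..} r * g r) = (\<lambda>r. if r = 0 then g 0 else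
      (indicator {0..} r *\<^sub>R (g r * exp (- r / 2) * r powr a)) / (exp (- r / 2) * r powr a))"
    by (auto simp: indicator_def)
  also have "\<dots> \<in> borel_measurable borel" by measurable
  finally show ?thesis .
qed

text \<open>Bochner integrals of nonintegrable functions are 0, so the norm inequality alone could
  hold vacuously. The first two conjuncts exclude this for the defining integral and for the norm on
  the left.\<close>

theorem theorem5p9:
  fixes \<kappa> :: "real ^ 'n" and \<mu> :: real
    and f :: "(real ^ 'n) \<times> real \<Rightarrow> real" and g :: "real \<Rightarrow> real"
  assumes "\<And>i. 0 \<le> \<kappa> $ i"
    and "0 \<le> \<mu>"
    and "alpha \<kappa> \<mu> < 1/2"
    and "f \<in> cone_L1 \<kappa> \<mu> \<inter> cone_L1_star \<kappa> \<mu>"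
    and "g \<in> half_L1 (2 * alpha \<kappa> \<mu>) \<inter> half_L1 (2 * alpha \<kappa> \<mu> + 1/2)"
  shows "(AE p in lborel. p \<in> cone \<longrightarrow> set_integrable lborel cone (pconv_integrand \<kappa> \<mu> f g p))
    \<and> pconv \<kappa> \<mu> f g \<in> cone_L1 \<kappa> \<mu>
    \<and> cone_norm1 \<kappa> \<mu> (pconv \<kappa> \<mu> f g)
        \<le> cone_norm1 \<kappa> \<mu> f * half_norm1 (2 * alpha \<kappa> \<mu>) g
          + cone_norm1_star \<kappa> \<mu> f * half_norm1 (2 * alpha \<kappa> \<mu> + 1/2) g"
proof -
  have "(real CARD('n) - 1) / 2 \<le> alpha \<kappa> \<mu>"
    using assms(1,2) by (simp add: alpha_def sum_nonneg)
  then have "real CARD('n) < 2" using assms(3) by simp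
  then have "CARD('n) = 1" using zero_less_card_finite[where 'a = 'n] by linarith
  then obtain i0 :: 'n where U: "UNIV = {i0}" by (rule UNIV_eq_singleton_if_CARD_1)
  define a where "a = alpha \<kappa> \<mu>"
  have a_eq: "a = \<kappa> $ i0 + \<mu>" by (simp add: a_def alpha_1[OF U])
  have k: "0 \<le> \<kappa> $ i0" and m: "0 \<le> \<mu>" using assms by auto
  then have a: "0 \<le> a" by (simp add: a_eq)
  define h1 h2 where "h1 = half_norm1 (2 * a) g" and "h2 = half_norm1 (2 * a + 1/2) g"
  have h: "0 \<le> h1" "0 \<le> h2"
    using assms(5) a nn_integral_half_norm1(2)[of "2 * a" g] nn_integral_half_norm1(2)[of "2 * a + 1/2" g]
    by (auto simp: h1_def h2_def a_def)
  define g' where "g' r = indicator {0..} r * g r" for r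
  have g'[measurable]: "g' \<in> borel_measurable borel"
    using assms(5) half_L1_measurable[of g] unfolding g'_def by blast
  have gg': "gen_trans \<kappa> \<mu> g p q = gen_trans \<kappa> \<mu> g' p q" if "p \<in> cone" "q \<in> cone" for p q
    using that by (intro gen_trans_cong[OF U]) (auto simp: g'_def)
  have T[measurable (raw)]: "(\<lambda>z. gen_trans \<kappa> \<mu> g' (P z) (Q z)) \<in> borel_measurable M"
    if "P \<in> borel_measurable M" "Q \<in> borel_measurable M"
    for P Q :: "'z \<Rightarrow> (real ^ 'n) \<times> real" and M
    using that assms(1,2) by (intro gen_trans_measurable g') auto
  define N where "N b = (\<integral>\<^sup>+r. ennreal (indicator {0<..} r * r powr b) * ennreal (\<bar>g' r\<bar> * exp (- r / 2)) \<partial>lborel)" for b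
  have N_eq: "N b = (\<integral>\<^sup>+r. ennreal (indicator {0<..} r * r powr b) * ennreal (\<bar>g r\<bar> * exp (- r / 2)) \<partial>lborel)" for b
    unfolding N_def by (intro nn_integral_cong) (auto simp: g'_def indicator_def)
  define G1 G2 where "G1 = Gamma (2 * a + 1)" and "G2 = Gamma (2 * a + 3/2)"
  have G: "0 < G1" "0 < G2" using a by (auto simp: G1_def G2_def)
  have N1: "N (2 * a) = ennreal (G1 * h1)"
    unfolding N_eq G1_def h1_def by (rule nn_integral_half_norm1(1)) (use a assms(5) in \<open>auto simp: a_def\<close>)
  have idx: "2 * a + 1/2 + 1 = 2 * a + 3/2" by simp
  have N2: "N (2 * a + 1/2) = ennreal (G2 * h2)"
    unfolding N_eq G2_def h2_def idx[symmetric]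
    by (rule nn_integral_half_norm1(1)) (use a assms(5) in \<open>auto simp: a_def\<close>)
  define B where "B = Beta (\<kappa> $ i0 + 1/2) (\<mu> + 1/2)"
  have B: "0 < B" using k m by (simp add: B_def Beta_pos_real)
  define b where "b = b_const \<kappa> \<mu>"
  have b_eq: "b = 1 / (B * G1)" by (simp add: b_def B_def G1_def a_eq b_const_1[OF U k m])
  have b: "0 < b" using B G by (simp add: b_eq)
  \<comment> \<open>Only the weighted product is known to be measurable, not f itself, so f is
    handled through \<phi> from here on.\<close>
  define \<phi> where "\<phi> q = indicator cone q *\<^sub>R (f q * exp (- snd q / 2) * u_wt \<kappa> \<mu> q)" for q
  define \<phi>s where "\<phi>s q = indicator cone q *\<^sub>R (f q * exp (- snd q / 2) * sqrt (snd q) * u_wt \<kappa> \<mu> q)" for q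
  have \<phi>: "integrable lborel \<phi>" and \<phi>s: "integrable lborel \<phi>s"
    using assms(4) unfolding \<phi>_def[abs_def] \<phi>s_def[abs_def]
    by (auto simp: cone_L1_def cone_L1_star_def set_integrable_def)
  have [measurable]: "\<phi> \<in> borel_measurable borel"
    using \<phi> by (auto dest: borel_measurable_integrable)
  have cone_snd: "0 \<le> snd q" if "q \<in> cone" for q :: "(real ^ 'n) \<times> real"
    using that by (auto simp: cone_def)
  have abs_\<phi>: "\<bar>\<phi> q\<bar> = indicator cone q *\<^sub>R (\<bar>f q\<bar> * exp (- snd q / 2) * u_wt \<kappa> \<mu> q)" for q
    by (simp add: \<phi>_def abs_mult u_wt_nonneg)
  have abs_\<phi>s: "\<bar>\<phi>s q\<bar> = indicator cone q *\<^sub>R (\<bar>f q\<bar> * exp (- snd q / 2) * sqrt (snd q) * u_wt \<kappa> \<mu> q)" for q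
    using cone_snd[of q] by (cases "q \<in> cone") (auto simp: \<phi>s_def abs_mult u_wt_nonneg)
  have \<phi>s_eq: "\<bar>\<phi>s q\<bar> = \<bar>\<phi> q\<bar> * sqrt (snd q)" for q
    by (simp add: abs_\<phi> abs_\<phi>s)
  define I1 I2 where "I1 = (LINT q|lborel. \<bar>\<phi> q\<bar>)" and "I2 = (LINT q|lborel. \<bar>\<phi>s q\<bar>)"
  have I1: "cone_norm1 \<kappa> \<mu> f = b * I1" and I2: "cone_norm1_star \<kappa> \<mu> f = b * I2"
    by (simp_all add: cone_norm1_def cone_norm1_star_def b_def I1_def I2_def abs_\<phi> abs_\<phi>s set_lebesgue_integral_def)
  have I_nonneg: "0 \<le> I1" "0 \<le> I2" by (simp_all add: I1_def I2_def)
  \<comment> \<open>The factor exp(-s) of W is halved: one half sits in \<phi>, the other is the one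
    used by \<open>cone_translation_norm_bound\<close>.\<close>
  define K where "K p q = \<phi> q * exp (- snd q / 2) * gen_trans \<kappa> \<mu> g' p q" for p q
  have [measurable (raw)]: "(\<lambda>z. K (P z) (Q z)) \<in> borel_measurable M"
    if [measurable]: "P \<in> borel_measurable M" "Q \<in> borel_measurable M"
    for P Q :: "'z \<Rightarrow> (real ^ 'n) \<times> real" and M
    unfolding K_def by measurable
  have K_eq: "indicator cone q *\<^sub>R pconv_integrand \<kappa> \<mu> f g p q = K p q" if p: "p \<in> cone" for p q
  proof (cases "q \<in> cone")
    case True
    have "exp (- snd q) = exp (- snd q / 2) * exp (- snd q / 2)" by (simp flip: exp_add)
    then show ?thesis
      using True gg'[OF p True] by (simp add: K_def \<phi>_def pconv_integrand_def W_wt_eq)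
  qed (simp add: K_def \<phi>_def)
  define wp where "wp p = indicator cone p * (exp (- snd p / 2) * u_wt \<kappa> \<mu> p)" for p
  have [measurable]: "wp \<in> borel_measurable borel" unfolding wp_def by measurable
  have wp: "0 \<le> wp p" for p by (simp add: wp_def u_wt_nonneg)
  define J where "J p = (\<integral>\<^sup>+q. ennreal \<bar>K p q\<bar> \<partial>lborel)" for p
  have [measurable]: "J \<in> borel_measurable borel" unfolding J_def by measurable
  have inner: "(\<integral>\<^sup>+p. ennreal (wp p) * ennreal \<bar>K p q\<bar> \<partial>lborel) \<le> ennreal (B * G1 * (h1 * \<bar>\<phi> q\<bar> + h2 * \<bar>\<phi>s q\<bar>))"
    for q
  proof (cases "\<phi> q = 0")
    case False
    obtain y s where q: "q = (y, s)" by (cases q)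
    have qc: "(y, s) \<in> cone" and u0: "u_wt \<kappa> \<mu> (y, s) \<noteq> 0" using False by (auto simp: \<phi>_def q indicator_def)
    \<comment> \<open>The central estimate divides by s; a nonzero weight rules out the
      apex.\<close>
    have s: "0 < s"
    proof (rule ccontr)
      assume "\<not> 0 < s"
      with qc have "y = 0" by (auto simp: cone_def)
      with u0 show False by (simp add: u_wt_def h_wt_def U)
    qed
    have "(\<integral>\<^sup>+p. ennreal (wp p) * ennreal \<bar>K p q\<bar> \<partial>lborel) = (\<integral>\<^sup>+p. ennreal \<bar>\<phi> q\<bar> * (ennreal (indicator cone p * u_wt \<kappa> \<mu> p) *
       ennreal (exp (- (snd p + s) / 2) * \<bar>gen_trans \<kappa> \<mu> g' p (y, s)\<bar>)) \<partial>lborel)"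
    proof (intro nn_integral_cong)
      fix p :: "(real ^ 'n) \<times> real"
      have "exp (- (snd p + s) / 2) = exp (- snd p / 2) * exp (- s / 2)"
        by (simp add: exp_add[symmetric] field_simps)
      then show "ennreal (wp p) * ennreal \<bar>K p q\<bar> = ennreal \<bar>\<phi> q\<bar> * (ennreal (indicator cone p * u_wt \<kappa> \<mu> p) *
       ennreal (exp (- (snd p + s) / 2) * \<bar>gen_trans \<kappa> \<mu> g' p (y, s)\<bar>))"
        by (simp add: ennreal_mult[symmetric] wp_def K_def q u_wt_nonneg abs_mult mult_ac)
    qed
    also have "\<dots> = ennreal \<bar>\<phi> q\<bar> * (\<integral>\<^sup>+p. ennreal (indicator cone p * u_wt \<kappa> \<mu> p) *
       ennreal (exp (- (snd p + s) / 2) * \<bar>gen_trans \<kappa> \<mu> g' p (y, s)\<bar>) \<partial>lborel)"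
      by (rule nn_integral_cmult) measurable
    also have "\<dots> \<le> ennreal \<bar>\<phi> q\<bar> * (ennreal B * (ennreal (G1 * h1) + ennreal (G1 / G2 * sqrt s) * ennreal (G2 * h2)))"
      using cone_translation_norm_bound[OF U k m g' qc s]
      unfolding a_eq[symmetric] N_def[symmetric] N1 N2 B_def[symmetric] G1_def[symmetric] G2_def[symmetric]
      by (rule mult_left_mono) simp
    also have "\<dots> = ennreal (\<bar>\<phi> q\<bar> * (B * (G1 * h1 + G1 / G2 * sqrt s * (G2 * h2))))"
      using B G h s by (simp flip: ennreal_mult ennreal_plus)
    also have "\<bar>\<phi> q\<bar> * (B * (G1 * h1 + G1 / G2 * sqrt s * (G2 * h2))) = B * G1 * (h1 * \<bar>\<phi> q\<bar> + h2 * \<bar>\<phi>s q\<bar>)"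
      using G unfolding \<phi>s_eq by (simp add: q field_simps)
    finally show ?thesis .
  qed (simp add: K_def)
  define Tot where "Tot = B * G1 * (h1 * I1 + h2 * I2)"
  have Tot: "0 \<le> Tot" using B G h I_nonneg by (simp add: Tot_def)
  have total: "(\<integral>\<^sup>+p. ennreal (wp p) * J p \<partial>lborel) \<le> ennreal Tot"
  proof -
    have "(\<integral>\<^sup>+p. ennreal (wp p) * J p \<partial>lborel) = (\<integral>\<^sup>+p. \<integral>\<^sup>+q. ennreal (wp p) * ennreal \<bar>K p q\<bar> \<partial>lborel \<partial>lborel)"
      unfolding J_def by (intro nn_integral_cong nn_integral_cmult[symmetric]) measurable
    also have "\<dots> = (\<integral>\<^sup>+q. \<integral>\<^sup>+p. ennreal (wp p) * ennreal \<bar>K p q\<bar> \<partial>lborel \<partial>lborel)"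
      by (rule lborel_pair.Fubini'[symmetric]) measurable
    also have "\<dots> \<le> (\<integral>\<^sup>+q. ennreal (B * G1 * (h1 * \<bar>\<phi> q\<bar> + h2 * \<bar>\<phi>s q\<bar>)) \<partial>lborel)"
      by (intro nn_integral_mono inner)
    also have "\<dots> = ennreal (LINT q|lborel. B * G1 * (h1 * \<bar>\<phi> q\<bar> + h2 * \<bar>\<phi>s q\<bar>))"
      using \<phi> \<phi>s B G h by (intro nn_integral_eq_integral) auto
    also have "(LINT q|lborel. B * G1 * (h1 * \<bar>\<phi> q\<bar> + h2 * \<bar>\<phi>s q\<bar>)) = Tot"
      using \<phi> \<phi>s by (simp add: Tot_def I1_def I2_def)
    finally show ?thesis .
  qed
  \<comment> \<open>The finite total makes the weighted J finite almost everywhere, and dividing by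
    the positive weight gives existence of the convolution integral.\<close>
  have "(\<integral>\<^sup>+p. ennreal (wp p) * J p \<partial>lborel) \<noteq> \<infinity>" using total by (auto simp: top_unique)
  then have "AE p in lborel. ennreal (wp p) * J p \<noteq> \<infinity>"
    by (intro nn_integral_PInf_AE) measurable
  moreover have "AE p in lborel. p \<in> cone \<longrightarrow> 0 < u_wt \<kappa> \<mu> p" by (rule AE_u_wt_pos[OF U])
  ultimately have part1: "AE p in lborel. p \<in> cone \<longrightarrow> set_integrable lborel cone (pconv_integrand \<kappa> \<mu> f g p)"
  proof eventually_elim
    case (elim p)
    show ?case
    proof
      assume p: "p \<in> cone"
      then have "wp p \<noteq> 0" using elim by (auto simp: wp_def)
      then have "J p < \<infinity>" using elim(1) wp[of p] by (auto simp: ennreal_mult_eq_top_iff less_top)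
      then have "integrable lborel (K p)" unfolding J_def by (intro integrableI_bounded) auto
      then show "set_integrable lborel cone (pconv_integrand \<kappa> \<mu> f g p)"
        unfolding set_integrable_def K_eq[OF p] .
    qed
  qed
  have pconv_eq: "pconv \<kappa> \<mu> f g p = b * (LINT q|lborel. K p q)" if "p \<in> cone" for p
    unfolding pconv_def b_def set_lebesgue_integral_def K_eq[OF that] by (rule refl)
  define F where "F p = wp p * (b * (LINT q|lborel. K p q))" for p
  have [measurable]: "F \<in> borel_measurable borel" unfolding F_def by measurable
  have F_eq: "indicator cone p *\<^sub>R (pconv \<kappa> \<mu> f g p * exp (- snd p / 2) * u_wt \<kappa> \<mu> p) = F p" for p
    by (cases "p \<in> cone") (auto simp: F_def wp_def pconv_eq)
  have F_le: "(\<integral>\<^sup>+p. ennreal \<bar>F p\<bar> \<partial>lborel) \<le> ennreal (b * Tot)"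
  proof -
    have "(\<integral>\<^sup>+p. ennreal \<bar>F p\<bar> \<partial>lborel) \<le> (\<integral>\<^sup>+p. ennreal b * (ennreal (wp p) * J p) \<partial>lborel)"
    proof (rule nn_integral_mono)
      fix p
      have "ennreal \<bar>F p\<bar> = ennreal b * (ennreal (wp p) * ennreal \<bar>LINT q|lborel. K p q\<bar>)"
        using b wp[of p] by (simp add: F_def abs_mult ennreal_mult mult_ac)
      also have "\<dots> \<le> ennreal b * (ennreal (wp p) * J p)"
        unfolding J_def by (intro mult_left_mono ennreal_abs_integral_le) auto
      finally show "ennreal \<bar>F p\<bar> \<le> ennreal b * (ennreal (wp p) * J p)" .
    qed
    also have "\<dots> = ennreal b * (\<integral>\<^sup>+p. ennreal (wp p) * J p \<partial>lborel)"
      by (rule nn_integral_cmult) measurable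
    also have "\<dots> \<le> ennreal b * ennreal Tot" using total by (rule mult_left_mono) simp
    finally show ?thesis using b Tot by (simp add: ennreal_mult)
  qed
  have F: "integrable lborel F"
    using F_le by (intro integrableI_bounded) (auto simp: less_top[symmetric] top_unique)
  then have part2: "pconv \<kappa> \<mu> f g \<in> cone_L1 \<kappa> \<mu>"
    unfolding cone_L1_def set_integrable_def mem_Collect_eq F_eq .
  have "cone_norm1 \<kappa> \<mu> (pconv \<kappa> \<mu> f g) = b * (LINT p|lborel. \<bar>F p\<bar>)"
    unfolding cone_norm1_def b_def[symmetric] set_lebesgue_integral_def F_eq[symmetric]
    by (simp add: abs_mult u_wt_nonneg)
  also have "(LINT p|lborel. \<bar>F p\<bar>) \<le> b * Tot"
  proof -
    have "ennreal (LINT p|lborel. \<bar>F p\<bar>) = (\<integral>\<^sup>+p. ennreal \<bar>F p\<bar> \<partial>lborel)"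
      using F by (intro nn_integral_eq_integral[symmetric]) auto
    with F_le have "ennreal (LINT p|lborel. \<bar>F p\<bar>) \<le> ennreal (b * Tot)" by simp
    then show ?thesis using b Tot by (simp add: ennreal_le_iff)
  qed
  \<comment> \<open>One factor b cancels B G1, the other turns I1 and I2 into the norms of
    f.\<close>
  also have "b * (b * Tot) = b * I1 * h1 + b * I2 * h2"
    using B G by (simp add: b_eq Tot_def field_simps)
  finally have "cone_norm1 \<kappa> \<mu> (pconv \<kappa> \<mu> f g) \<le> b * I1 * h1 + b * I2 * h2"
    using b by simp
  then have part3: "cone_norm1 \<kappa> \<mu> (pconv \<kappa> \<mu> f g)
      \<le> cone_norm1 \<kappa> \<mu> f * half_norm1 (2 * alpha \<kappa> \<mu>) g
        + cone_norm1_star \<kappa> \<mu> f * half_norm1 (2 * alpha \<kappa> \<mu> + 1/2) g"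
    unfolding I1 I2 h1_def h2_def a_def .
  from part1 part2 part3 show ?thesis by blast
qed

end
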